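(* For every integer $r\ge 0$, and all real numbers $\epsilon,\epsilon_1\in(0,1/2)$ and $\delta_1\in(0,1/(r+2))$, there exists an integer $t_0$, where $t_0=t_0(r,\epsilon_1,\delta_1)$ for $r\ge1$ and $t_0=t_0(\epsilon,\epsilon_1,\delta_1)$ for $r=0$, such that for all $n\ge t\ge t_0$ the following holds. Let $$\frac{r}{t+2r-1}\le p\le\frac{r+1}{t+2r+1}\ \text{ for } r\ge1,\qquad \frac{\epsilon}{t}\le p\le\frac1{t+1}\ \text{ for } r=0,$$ and let $\mathcal A,\mathcal B\subset 2^{[n]}$ be $t$-nice families. Suppose $$\mu_p(\mathcal A)\,\mu_p(\mathcal B)\ge(1-\delta_1)\,\mu_p(\mathcal F^t_r)^2 .$$ Then, up to switching $\mathcal A$ and $\mathcal B$, there exists a unique $(s,s')\in R_{\rm ex}$ such that, for $u=t-(s-s')$ and $v=t+(s-s')$, the following hold: (a) $X\le X_{\mathcal F}$, with equality holding if and only if $\mathcal A=\mathcal F^u_s$ and $\mathcal B=\mathcal F^v_{s'}$; (b) $X_*\le\epsilon_1 X_\Delta$; and (c) $\mu_p(\mathcal A)\mu_p(\mathcal B)\le\mu_p(\mathcal F^u_s)\mu_p(\mathcal F^v_{s'})$, with equality holding if and only if $\mathcal A=\mathcal F^u_s$ and $\mathcal B=\mathcal F^v_{s'}$.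
   Context: Here $n\ge t$ are positive integers. For a positive integer $m$, $[m]=\{1,\dots,m\}$, and $2^{[n]}$ is the set of all subsets of $[n]$. For a real number $p\in(0,1)$ and $\mathcal A\subset 2^{[n]}$, the product measure is $\mu_p(\mathcal A)=\sum_{A\in\mathcal A}p^{|A|}(1-p)^{n-|A|}$. For a positive integer $\ell$ and a non-negative integer $j$, $\mathcal F^\ell_j=\{F\subset[n]: |F\cap[\ell+2j]|\ge \ell+j\}$. The symmetric difference is $\mathcal F\triangle\mathcal G=(\mathcal F\setminus\mathcal G)\cup(\mathcal G\setminus\mathcal F)$. Families $\mathcal A,\mathcal B\subset 2^{[n]}$ are cross $t$-intersecting if $|A\cap B|\ge t$ for all $A\in\mathcal A$ and $B\in\mathcal B$. A family $\mathcal A\subset 2^{[n]}$ is shifted if $A\in\mathcal A$ and $\{i,j\}\cap A=\{j\}$ for some $1\le i<j\le n$ imply $(A\setminus\{j\})\cup\{i\}\in\mathcal A$. It is inclusion maximal if $A\in\mathcal A$ and $A\subset A'\subset[n]$ imply $A'\in\mathcal A$. Two families $\mathcal A$ and $\mathcal B$ are $t$-nice if they are shifted, inclusion maximal, and cross $t$-intersecting. $R_{\rm ex}=\{(0,0),(1,1),(1,0)\}$ if $r=0$, and $R_{\rm ex}=\{(r-1,r-1),(r,r),(r+1,r+1),(r,r-1),(r+1,r)\}$ if $r\ge1$. Given $(s,s')$ and $u,v$ as in the claim, the normalised measures are $X=p^{t-u}\mu_p(\mathcal A)+p^{t-v}\mu_p(\mathcal B)$, $X_{\mathcal F}=p^{t-u}\mu_p(\mathcal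 F^u_s)+p^{t-v}\mu_p(\mathcal F^v_{s'})$, $X_\Delta=p^{t-u}\mu_p(\mathcal A\triangle\mathcal F^u_s)+p^{t-v}\mu_p(\mathcal B\triangle\mathcal F^v_{s'})$, $X_*=p^{t-u}\mu_p(\mathcal A\setminus\mathcal F^u_s)+p^{t-v}\mu_p(\mathcal B\setminus\mathcal F^v_{s'})$.
   Formalization: The claim is false as stated: it is proved for n ≥ t+2r instead of n ≥ t, and uniqueness of (s,s') is asserted only when ε₁ < (1−ε₁)√(1−δ₁); existence of (s,s') with (a)–(c) is proved for all ε₁ in (0,1/2). *)

theory Defs
  imports Complex_Main
begin

definition mu :: "nat \<Rightarrow> real \<Rightarrow> nat set set \<Rightarrow> real" where
  "mu n p \<A> = (\<Sum>A\<in>\<A>. p ^ card A * (1 - p) ^ (n - card A))"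

(* The threshold family of the sets having at least l + j elements in {1..l + 2j}.
   It is meaningful as such only when {1..l + 2j} lies inside the ground set {1..n};
   for smaller n the formula gives a truncated, possibly empty, family. *)
definition frankl :: "nat \<Rightarrow> nat \<Rightarrow> nat \<Rightarrow> nat set set" where
  "frankl n l j = {F. F \<subseteq> {1..n} \<and> l + j \<le> card (F \<inter> {1..l + 2 * j})}"

definition cross_intersecting :: "nat \<Rightarrow> nat set set \<Rightarrow> nat set set \<Rightarrow> bool" where
  "cross_intersecting t \<A> \<B> \<longleftrightarrow> (\<forall>A\<in>\<A>. \<forall>B\<in>\<B>. t \<le> card (A \<inter> B))"

definition shifted :: "nat \<Rightarrow> nat set set \<Rightarrow> bool" where
  "shifted n \<A> \<longleftrightarrow>
    (\<forall>A\<in>\<A>. \<forall>i j. 1 \<le> i \<and> i < j \<and> j \<le> n \<and> {i, j} \<inter> A = {j} \<longrightarrow> (A - {j}) \<union> {i} \<in> \<A>)"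

definition inclusion_maximal :: "nat \<Rightarrow> nat set set \<Rightarrow> bool" where
  "inclusion_maximal n \<A> \<longleftrightarrow> (\<forall>A\<in>\<A>. \<forall>A'. A \<subseteq> A' \<and> A' \<subseteq> {1..n} \<longrightarrow> A' \<in> \<A>)"

definition nice :: "nat \<Rightarrow> nat \<Rightarrow> nat set set \<Rightarrow> nat set set \<Rightarrow> bool" where
  "nice n t \<A> \<B> \<longleftrightarrow>
    \<A> \<subseteq> Pow {1..n} \<and> \<B> \<subseteq> Pow {1..n} \<and>
    shifted n \<A> \<and> shifted n \<B> \<and>
    inclusion_maximal n \<A> \<and> inclusion_maximal n \<B> \<and>
    cross_intersecting t \<A> \<B>"

definition R_ex :: "nat \<Rightarrow> (nat \<times> nat) set" where
  "R_ex r =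
    (if r = 0 then {(0, 0), (1, 1), (1, 0)}
     else {(r - 1, r - 1), (r, r), (r + 1, r + 1), (r, r - 1), (r + 1, r)})"

(* The exponents t - u and t - v may be negative, hence the integer powers. *)
definition norm_measure ::
    "nat \<Rightarrow> real \<Rightarrow> nat \<Rightarrow> nat \<Rightarrow> nat \<Rightarrow> nat set set \<Rightarrow> nat set set \<Rightarrow> real" where
  "norm_measure n p t u v \<F> \<G> =
    p powi (int t - int u) * mu n p \<F> + p powi (int t - int v) * mu n p \<G>"

(* Every (s, s') in R_ex r satisfies s' \<le> s \<le> s' + 1, so that for t \<ge> 1 no subtraction below
   is truncated. *)
definition extremal_pair ::
    "nat \<Rightarrow> nat \<Rightarrow> real \<Rightarrow> real \<Rightarrow> nat set set \<Rightarrow> nat set set \<Rightarrow> nat \<times> nat \<Rightarrow> bool" where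
  "extremal_pair n t p \<epsilon>\<^sub>1 \<A> \<B> = (\<lambda>(s, s').
    let u = t - (s - s');
        v = t + (s - s');
        \<F> = frankl n u s;
        \<G> = frankl n v s';
        X = norm_measure n p t u v \<A> \<B>;
        X\<^sub>F = norm_measure n p t u v \<F> \<G>;
        X\<^sub>\<Delta> = norm_measure n p t u v (sym_diff \<A> \<F>) (sym_diff \<B> \<G>);
        Y = norm_measure n p t u v (\<A> - \<F>) (\<B> - \<G>)
    in X \<le> X\<^sub>F \<and> (X = X\<^sub>F \<longleftrightarrow> \<A> = \<F> \<and> \<B> = \<G>) \<and>
       Y \<le> \<epsilon>\<^sub>1 * X\<^sub>\<Delta> \<and>
       mu n p \<A> * mu n p \<B> \<le> mu n p \<F> * mu n p \<G> \<and>
       (mu n p \<A> * mu n p \<B> = mu n p \<F> * mu n p \<G> \<longleftrightarrow> \<A> = \<F> \<and> \<B> = \<G>))"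

definition extremal_pair_sw ::
    "nat \<Rightarrow> nat \<Rightarrow> real \<Rightarrow> real \<Rightarrow> nat set set \<Rightarrow> nat set set \<Rightarrow> nat \<times> nat \<Rightarrow> bool" where
  "extremal_pair_sw n t p \<epsilon>\<^sub>1 \<A> \<B> ss \<longleftrightarrow>
    extremal_pair n t p \<epsilon>\<^sub>1 \<A> \<B> ss \<or> extremal_pair n t p \<epsilon>\<^sub>1 \<B> \<A> ss"

(* The restriction on uniqueness is needed. Let \<epsilon>\<^sub>1 > (1 - \<epsilon>\<^sub>1) * sqrt (1 - \<delta>\<^sub>1) and let
   \<A> = \<B> = frankl n t (r + 1), with n \<ge> t + 2r + 2 and t large. If p is such that
   mu n p \<A> / mu n p (frankl n t r) is slightly larger than sqrt (1 - \<delta>\<^sub>1), then (r, r) and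
   (r + 1, r + 1) both satisfy extremal_pair: these two families are almost disjoint, so
   for the pair (r, r) the quotient of Y by X\<^sub>\<Delta> is close to q / (1 + q) with
   q = sqrt (1 - \<delta>\<^sub>1), which is smaller than \<epsilon>\<^sub>1. *)
definition stability ::
    "nat \<Rightarrow> nat \<Rightarrow> nat \<Rightarrow> real \<Rightarrow> real \<Rightarrow> real \<Rightarrow> bool" where
  "stability n t r p \<epsilon>\<^sub>1 \<delta>\<^sub>1 \<longleftrightarrow>
    (\<forall>\<A> \<B>. nice n t \<A> \<B> \<and>
      mu n p \<A> * mu n p \<B> \<ge> (1 - \<delta>\<^sub>1) * (mu n p (frankl n t r))\<^sup>2 \<longrightarrow>
      (\<exists>ss. ss \<in> R_ex r \<and> extremal_pair_sw n t p \<epsilon>\<^sub>1 \<A> \<B> ss) \<and>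
      (\<epsilon>\<^sub>1 < (1 - \<epsilon>\<^sub>1) * sqrt (1 - \<delta>\<^sub>1) \<longrightarrow>
        (\<exists>!ss. ss \<in> R_ex r \<and> extremal_pair_sw n t p \<epsilon>\<^sub>1 \<A> \<B> ss)))"

end

theory Submission
  imports Defs
begin

text \<open>Put \<open>c = t * p\<close>. The hypotheses on \<open>p\<close> keep \<open>c\<close> between positive constants and essentially
between \<open>r\<close> and \<open>r + 1\<close>, so \<open>p\<close> tends to \<open>0\<close> as \<open>t\<close> grows, and all estimates are asymptotics
for \<open>p\<close> tending to \<open>0\<close> from the right. Instead of elements of a set \<open>F\<close>, one counts its gaps in
\<open>{1..k}\<close>, that is, the elements of \<open>{1..k}\<close> missing from \<open>F\<close>. In these terms, shiftedness and the
intersection condition yield Frankl's walk inequality (\<open>frankl_walk_lemma\<close>): for all members \<open>F\<close>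
of \<open>\<A>\<close> and \<open>G\<close> of \<open>\<B>\<close> there is a \<open>k\<close> with \<open>t + gaps k F + gaps k G \<le> k\<close>. The whole proof
rests on this inequality.

At the relevant scale a set is \<open>typical\<close>: it has \<open>j\<close> gaps in \<open>{1..t}\<close>, contains the next \<open>m\<close>
points, and then almost nothing. Such sets have mass about \<open>p^(t + m - 2 j) * c^j / j!\<close>. A union
bound shows that, up to \<open>o(p^(2 t))\<close>, the pairs satisfying the walk inequality consist of two typical
sets with \<open>j\<close> and \<open>j'\<close> gaps and \<open>m = j + j'\<close>. Two different pairs \<open>(j, j')\<close> cannot both occur,
because the walk inequality fails for the mixed pairs of sets (\<open>typical_pair_unique\<close>). Hence
\<open>\<mu>(\<A>) \<mu>(\<B>)\<close> is at most \<open>p^(2 t) * (c^j / j! * c^j' / j'! + o(1))\<close> for a single pair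
(\<open>product_concentrates\<close>). The Poisson weights \<open>c^j / j!\<close> peak at \<open>r\<close>, and a pair that is not in
\<open>R_ex r\<close> in either order falls short of the square of the peak by a factor \<open>(r + 1) / (r + 2)\<close>,
which the lower bound on the product forbids. This determines \<open>(s, s')\<close>
(\<open>large_product_concentrates\<close>).

Stability comes from playing gains against losses. A member of \<open>\<A>\<close> outside its threshold family is
a gain; by the walk inequality it excludes from \<open>\<B>\<close> a whole set of typical members of the other
threshold family, which are losses. If the gains exist only because their walks return late,
at stage \<open>Q\<close>, then they have relative mass \<open>O(p^Q)\<close>, while the losses have relative mass at least
a constant times \<open>(1 - p)^(3 Q)\<close>. As both families do contain typical sets, \<open>Q \<ge> 1\<close>, so the gains
are \<open>O(p)\<close> times the losses (\<open>gains_le_losses\<close>). All three parts of the conclusion follow, the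
product inequality by the inequality of the arithmetic and geometric means for the measures divided
by those of the threshold families (\<open>product_stable\<close>).

For uniqueness, suppose that another pair \<open>(x, y)\<close> satisfies the second part of the conclusion. If
\<open>x - y\<close> differs from \<open>j - j'\<close>, then the weights of the two families are off by a factor \<open>1 / p\<close> and
the gains explode. Otherwise the typical members of \<open>\<A>\<close> and \<open>\<B>\<close> all lie outside the threshold
families belonging to \<open>(x, y)\<close>, so that the gains are at least about
\<open>2 * sqrt (1 - \<delta>\<^sub>1) * p^t * c^r / r!\<close> and the losses at most about \<open>2 * p^t * c^r / r!\<close>, which the
condition on \<open>\<epsilon>\<^sub>1\<close> rules out (\<open>extremal_index_unique\<close>).\<close>

section \<open>The walk inequality\<close>

definition gaps :: "nat \<Rightarrow> nat set \<Rightarrow> nat" where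
  "gaps k F = card ({1..k} - F)"

lemma gaps_add: "gaps (k + i) F + card (F \<inter> {k<..k + i}) = gaps k F + i"
proof -
  have "{1..k + i} - F = ({1..k} - F) \<union> ({k<..k + i} - F)" by auto
  hence "gaps (k + i) F = gaps k F + card ({k<..k + i} - F)"
    unfolding gaps_def by (simp add: card_Un_disjoint disjnt_def) (subst card_Un_disjoint, auto)
  moreover have "card (F \<inter> {k<..k + i}) + card ({k<..k + i} - F) = i"
    using card_Int_Diff[of "{k<..k + i}" F] by (simp add: Int_commute)
  ultimately show ?thesis by simp
qed

lemma gaps_mono: "k \<le> l \<Longrightarrow> gaps k F \<le> gaps l F"
  unfolding gaps_def by (intro card_mono) auto

lemma gaps_le: "gaps k F \<le> k"
  unfolding gaps_def using card_mono[of "{1..k}" "{1..k} - F"] by simp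

lemma gaps_Int: "gaps k F + card (F \<inter> {1..k}) = k"
  unfolding gaps_def using card_Int_Diff[of "{1..k}" F] by (simp add: Int_commute)

lemma gaps_lower: 
  assumes "F \<subseteq> {1..n}" shows "k \<le> gaps k F + n"
proof -
  have "card (F \<inter> {1..k}) \<le> card {1..n}" using assms by (intro card_mono) auto
  thus ?thesis using gaps_Int[of k F] by simp
qed

text \<open>Let \<open>x\<close> be the point at which \<open>F \<inter> G\<close> acquires its \<open>t\<close>-th element. If \<open>F \<union> G\<close> covers \<open>{1..x}\<close>,
then the inequality holds at \<open>k = x\<close>, with equality. Otherwise some \<open>y < x\<close> is in neither set, and
shifting \<open>x\<close> to \<open>y\<close> in \<open>F\<close> decreases \<open>F \<inter> G\<close>. For the new set the inequality cannot hold at any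
\<open>k < x\<close>, where there are fewer than \<open>t\<close> common elements, and from \<open>x\<close> on both sets have the same
gaps; so induction on the size of \<open>F \<inter> G\<close> applies.\<close>
lemma frankl_walk_lemma:
  assumes nice: "nice n t \<A> \<B>" and "F \<in> \<A>" "G \<in> \<B>"
  shows "\<exists>k\<le>n. t + gaps k F + gaps k G \<le> k"
  using \<open>F \<in> \<A>\<close>
proof (induction "card (F \<inter> G)" arbitrary: F rule: less_induct)
  case less
  have FG: "F \<subseteq> {1..n}" "G \<subseteq> {1..n}" and sh: "shifted n \<A>"
    and cr: "t \<le> card (F \<inter> G)"
    using nice less.prems \<open>G \<in> \<B>\<close> unfolding nice_def cross_intersecting_def by auto
  have fin: "finite F" "finite G" using FG finite_subset by blast+
  have pair: "t' + gaps k F' + gaps k G = k + t' - card ((F' \<inter> G) \<inter> {1..k}) + card ({1..k} - (F' \<union> G))"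
    if "t' \<ge> card ((F' \<inter> G) \<inter> {1..k})" for t' F' k
  proof -
    have "gaps k F' + gaps k G = card (({1..k} - F') \<union> ({1..k} - G)) + card (({1..k} - F') \<inter> ({1..k} - G))"
      unfolding gaps_def by (rule card_Un_Int) auto
    moreover have "({1..k} - F') \<union> ({1..k} - G) = {1..k} - (F' \<inter> G)" by auto
    moreover have "({1..k} - F') \<inter> ({1..k} - G) = {1..k} - (F' \<union> G)" by auto
    ultimately have "gaps k F' + gaps k G = card ({1..k} - (F' \<inter> G)) + card ({1..k} - (F' \<union> G))"
      by (simp only:)
    thus ?thesis using that gaps_Int[of k "F' \<inter> G"] by (simp add: gaps_def)
  qed
  show ?case
  proof (cases "t = 0")
    case True
    then show ?thesis by (intro exI[of _ 0]) (simp add: gaps_def)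
  next
    case False
    define c where "c k = card ((F \<inter> G) \<inter> {1..k})" for k
    define x where "x = (LEAST k. t \<le> c k)"
    have "(F \<inter> G) \<inter> {1..n} = F \<inter> G" using FG by auto
    hence cn: "t \<le> c n" using cr by (simp add: c_def)
    have cx: "t \<le> c x" unfolding x_def by (rule LeastI[of _ n]) (rule cn)
    have xn: "x \<le> n" unfolding x_def by (rule Least_le) (rule cn)
    have below: "c k < t" if "k < x" for k
      using not_less_Least[of k "\<lambda>k. t \<le> c k"] that by (auto simp: x_def)
    have "x \<noteq> 0"
    proof
      assume "x = 0"
      hence "c x = 0" by (simp add: c_def)
      thus False using cx False by simp
    qed
    then obtain x' where x': "x = Suc x'" by (cases x) auto
    have step: "c x = c x' + (if x \<in> F \<inter> G then 1 else 0)"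
    proof -
      have "F \<inter> G \<inter> {1..x} = (F \<inter> G \<inter> {1..x'}) \<union> (if x \<in> F \<inter> G then {x} else {})"
        by (auto simp: x' le_Suc_eq)
      thus ?thesis unfolding c_def by (auto simp: x')
    qed
    have xFG: "x \<in> F \<inter> G" using step cx below[of x'] x' by (auto split: if_splits)
    have cxt: "c x = t" using step cx below[of x'] x' by (auto split: if_splits)
    show ?thesis
    proof (cases "{1..x} \<subseteq> F \<union> G")
      case True
      hence "card ({1..x} - (F \<union> G)) = 0" by (simp add: Diff_eq_empty_iff[THEN iffD2])
      hence "t + gaps x F + gaps x G = x" using pair[of F x t] cxt by (simp add: c_def)
      thus ?thesis using xn by auto
    next
      case False
      then obtain y where "y \<in> {1..x}" "y \<notin> F \<union> G" by blast
      hence y: "1 \<le> y" "y \<le> x" "y \<notin> F" "y \<notin> G" by auto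
      have yx: "y < x" using y xFG by (cases "y = x") auto
      define F' where "F' = (F - {x}) \<union> {y}"
      have F'A: "F' \<in> \<A>"
        using sh less.prems y yx xn xFG unfolding shifted_def F'_def by blast
      have FG': "F' \<inter> G = (F \<inter> G) - {x}" using y by (auto simp: F'_def)
      have "card (F' \<inter> G) < card (F \<inter> G)"
        unfolding FG' using xFG fin by (intro psubset_card_mono) auto
      from less.hyps[OF this F'A] obtain k where k: "k \<le> n" "t + gaps k F' + gaps k G \<le> k" by blast
      have "\<not> k < x"
      proof
        assume "k < x"
        have "card ((F' \<inter> G) \<inter> {1..k}) \<le> c k"
          unfolding FG' c_def by (intro card_mono) auto
        hence "card ((F' \<inter> G) \<inter> {1..k}) < t" using below[OF \<open>k < x\<close>] by simp
        thus False using pair[of F' k t] k by simp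
      qed
      moreover have "gaps k F' = gaps k F" if "x \<le> k"
      proof -
        have "F' \<inter> {1..k} = insert y ((F \<inter> {1..k}) - {x})" using y yx that by (auto simp: F'_def)
        hence "card (F' \<inter> {1..k}) = Suc (card ((F \<inter> {1..k}) - {x}))"
          using y by (subst \<open>F' \<inter> {1..k} = _\<close>, subst card_insert_disjoint) auto
        also have "\<dots> = card (F \<inter> {1..k})"
          using that xFG y yx by (intro card_Suc_Diff1) auto
        finally show ?thesis using gaps_Int[of k F] gaps_Int[of k F'] by simp
      qed
      ultimately show ?thesis using k by auto
    qed
  qed
qed

section \<open>Threshold families and typical sets\<close>

text \<open>The Frankl families with the cut-off point \<open>k\<close> as a parameter. The two families of an extremal pair
\<open>(s, s')\<close> share the cut-off point \<open>t + s + s'\<close>, which their description by \<open>u\<close> and \<open>v\<close> hides.\<close>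
definition threshold_family :: "nat \<Rightarrow> nat \<Rightarrow> nat \<Rightarrow> nat set set" where
  "threshold_family n k g = {F. F \<subseteq> {1..n} \<and> gaps k F \<le> g}"

lemma frankl_eq_threshold: "frankl n u s = threshold_family n (u + 2 * s) s"
proof -
  have "u + s \<le> card (F \<inter> {1..u + 2 * s}) \<longleftrightarrow> gaps (u + 2 * s) F \<le> s" for F
    using gaps_Int[of "u + 2 * s" F] by linarith
  thus ?thesis unfolding frankl_def threshold_family_def by auto
qed

text \<open>Behind the initial segment \<open>{1..t + m}\<close> a typical set has density less than one third, measured from
the start of the tail: at most \<open>q\<close> of the first \<open>3 q + 3\<close> points. Any bound on the density strictly
below one half would serve. The sets with \<open>Q = 0\<close> are the generic ones. For larger \<open>Q\<close> the tail starts with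
\<open>3 Q + 3\<close> gaps, which is what a late gain of the other family excludes.\<close>
definition typical :: "nat \<Rightarrow> nat \<Rightarrow> nat \<Rightarrow> nat \<Rightarrow> nat \<Rightarrow> nat set set" where
  "typical n t m s Q = {F. F \<subseteq> {1..n} \<and> gaps t F = s \<and> {t<..t + m} \<subseteq> F \<and>
     (\<forall>q. card (F \<inter> {t + m<..t + m + 3 * q + 3}) \<le> (if q \<le> Q then 0 else q))}"

lemma typical_gaps_initial:
  assumes "F \<in> typical n t m s Q" "i \<le> m" shows "gaps (t + i) F = s"
proof -
  have "F \<inter> {t<..t + i} = {t<..t + i}" using assms by (auto simp: typical_def)
  thus ?thesis using gaps_add[of t i F] assms by (simp add: typical_def)
qed

lemma typical_gaps_tail:
  assumes "F \<in> typical n t m s Q"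
  shows "s + i \<le> gaps (t + m + i) F + (if i div 3 \<le> Q then 0 else i div 3)"
proof -
  let ?q = "i div 3"
  have "i \<le> 3 * ?q + 3" by presburger
  hence "card (F \<inter> {t + m<..t + m + i}) \<le> card (F \<inter> {t + m<..t + m + 3 * ?q + 3})"
    by (intro card_mono) auto
  also have "\<dots> \<le> (if ?q \<le> Q then 0 else ?q)" using assms by (simp add: typical_def)
  finally show ?thesis
    using gaps_add[of "t + m" i F] typical_gaps_initial[OF assms order_refl] by linarith
qed

text \<open>At \<open>k = t + x\<close> a typical set has \<open>j\<close> gaps and, if \<open>x > m\<close>, at least two thirds of \<open>x - m\<close> more. Beyond
both lengths the sum of the two gap numbers grows faster than \<open>x\<close>, so the walk inequality is weakest
at \<open>x = m'\<close>, where it gives the bound.\<close>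
lemma typical_cross_aux:
  assumes F: "F \<in> typical n t m j Q" and G: "G \<in> typical n t m' j' Q'"
    and k: "t + gaps k F + gaps k G \<le> k" and m: "m \<le> m'"
  shows "3 * (j + j') \<le> 2 * m + m'"
proof -
  obtain x where x: "k = t + x" using k by (metis add.assoc le_Suc_ex)
  have 1: "3 * j + 2 * (x - m) \<le> 3 * gaps k F"
    if "F \<in> typical n t m j Q" for F m j Q
  proof (cases "x \<le> m")
    case True then show ?thesis using typical_gaps_initial[OF that True] x by simp
  next
    case False
    then obtain i where i: "x = m + i" by (metis nat_le_linear le_Suc_ex)
    have "3 * j + 3 * i \<le> 3 * gaps (t + m + i) F + i"
      using typical_gaps_tail[OF that, of i] by (auto split: if_splits)
    then show ?thesis by (simp add: x i add.assoc)
  qed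
  consider "x \<le> m" | "m < x" "x \<le> m'" | "m' < x" by linarith
  thus ?thesis using 1[OF F] 1[OF G] k m unfolding x by cases simp_all
qed

lemma typical_cross:
  assumes "F \<in> typical n t m j Q" "G \<in> typical n t m' j' Q'"
    and "t + gaps k F + gaps k G \<le> k"
  shows "3 * (j + j') \<le> m + m' + min m m'"
proof (cases "m \<le> m'")
  case True
  show ?thesis using typical_cross_aux[OF assms True] True by (simp add: min_def)
next
  case False
  have "t + gaps k G + gaps k F \<le> k" using assms by simp
  from typical_cross_aux[OF assms(2,1) this] False show ?thesis by (simp add: min_def)
qed

text \<open>The walk inequality for the mixed pairs gives \<open>3 (j + i') \<le> m + m' + min m m'\<close> and the same bound for
\<open>3 (i + j')\<close>, where \<open>m = j + j'\<close> and \<open>m' = i + i'\<close>. Their sum forces \<open>m = m'\<close>, and then each of them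
compares the components.\<close>
lemma typical_pair_unique:
  assumes nice: "nice n t \<A> \<B>"
    and "\<A> \<inter> typical n t (j + j') j 0 \<noteq> {}" "\<B> \<inter> typical n t (j + j') j' 0 \<noteq> {}"
    and "\<A> \<inter> typical n t (i + i') i 0 \<noteq> {}" "\<B> \<inter> typical n t (i + i') i' 0 \<noteq> {}"
  shows "i = j \<and> i' = j'"
proof -
  have *: "3 * (j + i') \<le> (j + j') + (i + i') + min (j + j') (i + i')"
    if A: "\<A> \<inter> typical n t (j + j') j 0 \<noteq> {}" and B: "\<B> \<inter> typical n t (i + i') i' 0 \<noteq> {}" for i i' j j'
  proof -
    obtain F G where "F \<in> \<A>" "F \<in> typical n t (j + j') j 0" "G \<in> \<B>" "G \<in> typical n t (i + i') i' 0"
      using A B by auto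
    with frankl_walk_lemma[OF nice] typical_cross show ?thesis by blast
  qed
  show ?thesis using *[OF assms(2,5)] *[OF assms(4,3)] by (simp add: min_def split: if_splits)
qed

text \<open>Before the cut-off point, going back \<open>i\<close> places removes at most \<open>i\<close> of the \<open>s + 1\<close> gaps of \<open>F\<close>, while
\<open>G\<close> keeps its \<open>s'\<close> gaps; after it, the few elements of \<open>G\<close> that may occur by stage \<open>q\<close> are outweighed
by the more than \<open>s + q\<close> gaps of \<open>F\<close>. So the walk inequality fails everywhere.\<close>
lemma gain_excludes_typical:
  assumes nice: "nice n t \<A> \<B>" and F: "F \<in> \<A>" "Suc s \<le> gaps (t + (s + s')) F"
    and late: "\<And>q. Q < q \<Longrightarrow> s + q < gaps (t + (s + s') + 3 * q) F"
    and G: "G \<in> \<B>" "G \<in> typical n t (s + s') s' Q"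
  shows False
proof -
  let ?m = "s + s'"
  obtain k where k: "t + gaps k F + gaps k G \<le> k" using frankl_walk_lemma[OF nice F(1) G(1)] by blast
  obtain x where x: "k = t + x" using k by (metis add.assoc le_Suc_ex)
  show False
  proof (cases "x \<le> ?m")
    case True
    then obtain i where i: "?m = x + i" by (metis le_Suc_ex)
    have "gaps (t + ?m) F \<le> gaps k F + i" using gaps_add[of "t + x" i F] by (simp add: i x add.assoc)
    thus False using F k typical_gaps_initial[OF G(2) True] x i by simp
  next
    case False
    then obtain i where i: "x = ?m + i" by (metis nat_le_linear le_Suc_ex)
    let ?q = "i div 3"
    have kk: "k = t + ?m + i" by (simp add: x i)
    have "s' + i \<le> gaps k G + (if ?q \<le> Q then 0 else ?q)"
      using typical_gaps_tail[OF G(2), of i] kk by simp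
    moreover have "s + (if ?q \<le> Q then 0 else ?q) < gaps k F"
    proof (cases "?q \<le> Q")
      case True
      have "gaps (t + ?m) F \<le> gaps k F" by (rule gaps_mono) (simp add: kk)
      then show ?thesis using F True by simp
    next
      case False
      have "gaps (t + ?m + 3 * ?q) F \<le> gaps k F" by (rule gaps_mono) (simp add: kk)
      then show ?thesis using late[of ?q] False by simp
    qed
    ultimately show False using k kk by linarith
  qed
qed

lemma typical_subset_threshold: "typical n t m s Q \<subseteq> threshold_family n (t + m) s"
  using typical_gaps_initial[of _ n t m s Q m] by (auto simp: threshold_family_def typical_def)

text \<open>The first hypothesis says that the cut-off points \<open>t + j + j'\<close> and \<open>t + i + i'\<close> lie on the same line
\<open>i - i' = j - j'\<close>, so they differ by \<open>2 (i - j)\<close>. If \<open>i < j\<close> the \<open>j\<close> gaps are already too many; if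
\<open>i > j\<close> the sparse tail adds more than \<open>i - j\<close> gaps before the later cut-off point.\<close>
lemma typical_threshold_disjoint:
  assumes "i + j' = i' + j" "i \<noteq> j"
  shows "typical n t (j + j') j 0 \<inter> threshold_family n (t + (i + i')) i = {}"
proof -
  have False if F: "F \<in> typical n t (j + j') j 0" and le: "gaps (t + (i + i')) F \<le> i" for F
  proof (cases "i < j")
    case True
    then show False using typical_gaps_initial[OF F, of "i + i'"] le assms by simp
  next
    case False
    then obtain x where x: "i = j + x" "0 < x" using assms(2) by (metis less_imp_add_positive linorder_neqE_nat)
    have e: "t + (i + i') = t + (j + j') + 2 * x" using x assms(1) by simp
    have "j + 2 * x \<le> gaps (t + (i + i')) F + (2 * x) div 3"
      using typical_gaps_tail[OF F, of "2 * x"] unfolding e by (simp split: if_splits)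
    then show False using le x by linarith
  qed
  thus ?thesis by (auto simp: threshold_family_def)
qed

section \<open>The product measure\<close>

text \<open>The product measure on the subsets of an arbitrary finite set \<open>V\<close>: independence of disjoint blocks
of the ground set makes it necessary to vary \<open>V\<close>.\<close>
definition bernoulli_mass :: "real \<Rightarrow> 'a set \<Rightarrow> ('a set \<Rightarrow> bool) \<Rightarrow> real" where
  "bernoulli_mass p V P = (\<Sum>A | A \<subseteq> V \<and> P A. p ^ card A * (1 - p) ^ card (V - A))"

lemma mu_eq_bernoulli_mass:
  assumes "\<A> \<subseteq> Pow {1..n}"
  shows "mu n p \<A> = bernoulli_mass p {1..n} (\<lambda>A. A \<in> \<A>)"
  unfolding mu_def bernoulli_mass_def
proof (rule sum.cong)
  show "\<A> = {A. A \<subseteq> {1..n} \<and> A \<in> \<A>}" using assms by auto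
  show "p ^ card A * (1 - p) ^ (n - card A) = p ^ card A * (1 - p) ^ card ({1..n} - A)"
    if "A \<in> {A. A \<subseteq> {1..n} \<and> A \<in> \<A>}" for A
    using that by (subst card_Diff_subset) (auto intro: finite_subset)
qed

context
  fixes p :: real
  assumes p: "0 \<le> p" "p \<le> 1"
begin

lemma bernoulli_mass_nonneg: "0 \<le> bernoulli_mass p V P"
  unfolding bernoulli_mass_def using p by (intro sum_nonneg mult_nonneg_nonneg zero_le_power) auto

lemma bernoulli_mass_mono:
  assumes "finite V" "\<And>A. A \<subseteq> V \<Longrightarrow> P A \<Longrightarrow> Q A"
  shows "bernoulli_mass p V P \<le> bernoulli_mass p V Q"
  unfolding bernoulli_mass_def
proof (rule sum_mono2)
  show "finite {A. A \<subseteq> V \<and> Q A}" using assms(1) by simp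
qed (use assms p in \<open>auto intro!: mult_nonneg_nonneg zero_le_power\<close>)

lemma bernoulli_mass_split:
  assumes "finite U" "finite V" "U \<inter> V = {}"
  shows "bernoulli_mass p (U \<union> V) (\<lambda>A. P (A \<inter> U) \<and> Q (A \<inter> V)) =
    bernoulli_mass p U P * bernoulli_mass p V Q"
proof -
  have "bernoulli_mass p (U \<union> V) (\<lambda>A. P (A \<inter> U) \<and> Q (A \<inter> V)) =
    (\<Sum>(B, C)\<in>{B. B \<subseteq> U \<and> P B} \<times> {C. C \<subseteq> V \<and> Q C}.
      (p ^ card B * (1 - p) ^ card (U - B)) * (p ^ card C * (1 - p) ^ card (V - C)))"
    unfolding bernoulli_mass_def
  proof (rule sum.reindex_bij_witness[of _ "\<lambda>(B, C). B \<union> C" "\<lambda>A. (A \<inter> U, A \<inter> V)"], goal_cases)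
    case (1 A) thus ?case by auto
  next
    case (2 A) thus ?case by auto
  next
    case (3 x)
    then obtain B C where x: "x = (B, C)" "B \<subseteq> U" "P B" "C \<subseteq> V" "Q C" by auto
    thus ?case using assms(3) by auto
  next
    case (4 x)
    then obtain B C where x: "x = (B, C)" "B \<subseteq> U" "P B" "C \<subseteq> V" "Q C" by auto
    have "(B \<union> C) \<inter> U = B" "(B \<union> C) \<inter> V = C" using x assms(3) by auto
    thus ?case using x by auto
  next
    case (5 A)
    hence "A \<subseteq> U \<union> V" by auto
    hence "A = (A \<inter> U) \<union> (A \<inter> V)" "U \<union> V - A = (U - A \<inter> U) \<union> (V - A \<inter> V)" using assms(3) by auto
    moreover have "card ((A \<inter> U) \<union> (A \<inter> V)) = card (A \<inter> U) + card (A \<inter> V)"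
      using assms by (intro card_Un_disjoint) auto
    moreover have "card ((U - A \<inter> U) \<union> (V - A \<inter> V)) = card (U - A \<inter> U) + card (V - A \<inter> V)"
      using assms by (intro card_Un_disjoint) auto
    ultimately show ?case by (simp add: power_add)
  qed
  also have "\<dots> = bernoulli_mass p U P * bernoulli_mass p V Q"
    unfolding bernoulli_mass_def by (simp add: sum_product sum.cartesian_product)
  finally show ?thesis .
qed

lemma bernoulli_mass_total:
  assumes "finite V" shows "bernoulli_mass p V (\<lambda>_. True) = 1"
proof -
  have "(\<Prod>x\<in>V. p + (1 - p)) = (\<Sum>X\<in>Pow V. (\<Prod>x\<in>X. p) * (\<Prod>x\<in>V - X. 1 - p))"
    by (rule prod_add) (rule assms)
  thus ?thesis unfolding bernoulli_mass_def by (simp add: Pow_def)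
qed

lemma bernoulli_mass_compl:
  assumes "finite V" shows "bernoulli_mass p V P = 1 - bernoulli_mass p V (\<lambda>A. \<not> P A)"
proof -
  have "bernoulli_mass p V P + bernoulli_mass p V (\<lambda>A. \<not> P A) = bernoulli_mass p V (\<lambda>_. True)"
    unfolding bernoulli_mass_def using assms
    by (subst sum.union_disjoint[symmetric]) (auto intro!: sum.cong)
  thus ?thesis using bernoulli_mass_total[OF assms] by simp
qed

lemma bernoulli_mass_supersets:
  assumes "finite V"
  shows "bernoulli_mass p V (\<lambda>A. S \<subseteq> A) \<le> p ^ card S"
proof (cases "S \<subseteq> V")
  case True
  hence fS: "finite S" using assms finite_subset by blast
  have "bernoulli_mass p S (\<lambda>A. A = S) = p ^ card S"
  proof -
    have "{A. A \<subseteq> S \<and> A = S} = {S}" by auto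
    thus ?thesis unfolding bernoulli_mass_def by simp
  qed
  moreover have "bernoulli_mass p (S \<union> (V - S)) (\<lambda>A. A \<inter> S = S \<and> True) =
      bernoulli_mass p S (\<lambda>A. A = S) * bernoulli_mass p (V - S) (\<lambda>_. True)"
    by (rule bernoulli_mass_split) (use fS assms in auto)
  moreover have "S \<union> (V - S) = V" using True by auto
  moreover have "bernoulli_mass p V (\<lambda>A. S \<subseteq> A) \<le> bernoulli_mass p V (\<lambda>A. A \<inter> S = S \<and> True)"
    by (rule bernoulli_mass_mono) (use assms in auto)
  ultimately show ?thesis using bernoulli_mass_total[of "V - S"] assms by simp
next
  case False
  hence e: "{A. A \<subseteq> V \<and> S \<subseteq> A} = {}" by auto
  show ?thesis unfolding bernoulli_mass_def e using p by simp
qed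

lemma bernoulli_mass_union_bound:
  assumes "finite I" "finite V" "\<And>A. A \<subseteq> V \<Longrightarrow> P A \<Longrightarrow> \<exists>i\<in>I. R i A"
  shows "bernoulli_mass p V P \<le> (\<Sum>i\<in>I. bernoulli_mass p V (R i))"
proof -
  let ?w = "\<lambda>A. p ^ card A * (1 - p) ^ card (V - A)"
  have w: "0 \<le> ?w A" for A using p by simp
  have "bernoulli_mass p V P \<le> sum ?w (\<Union>i\<in>I. {A. A \<subseteq> V \<and> R i A})"
    unfolding bernoulli_mass_def using assms w by (intro sum_mono2) auto
  also have "\<dots> \<le> (\<Sum>i\<in>I. sum ?w {A. A \<subseteq> V \<and> R i A})"
    using \<open>finite I\<close>
  proof induction
    case (insert i I)
    have "sum ?w ({A. A \<subseteq> V \<and> R i A} \<union> (\<Union>i\<in>I. {A. A \<subseteq> V \<and> R i A}))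
      \<le> sum ?w {A. A \<subseteq> V \<and> R i A} + sum ?w (\<Union>i\<in>I. {A. A \<subseteq> V \<and> R i A})"
      using assms(2) insert.hyps w by (subst sum_Un) (auto intro!: sum_nonneg)
    thus ?case using insert by simp
  qed simp
  finally show ?thesis unfolding bernoulli_mass_def .
qed

text \<open>All upper bounds on measures are obtained in this way: a property that forces one of finitely many
sets \<open>S\<close> of size \<open>c\<close> to be contained costs \<open>p ^ c\<close> for each of them.\<close>
lemma bernoulli_mass_first_moment:
  assumes "finite \<S>" "finite V" "\<And>A. A \<subseteq> V \<Longrightarrow> P A \<Longrightarrow> \<exists>S\<in>\<S>. S \<subseteq> A"
    and "\<And>S. S \<in> \<S> \<Longrightarrow> card S = c"
  shows "bernoulli_mass p V P \<le> real (card \<S>) * p ^ c"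
proof -
  have "bernoulli_mass p V P \<le> (\<Sum>S\<in>\<S>. bernoulli_mass p V (\<lambda>A. S \<subseteq> A))"
    by (rule bernoulli_mass_union_bound) (use assms in auto)
  also have "\<dots> \<le> (\<Sum>S\<in>\<S>. p ^ c)"
    using bernoulli_mass_supersets[OF assms(2)] assms(4) by (intro sum_mono) metis
  finally show ?thesis by simp
qed

lemma sum_powers_le:
  fixes x :: real assumes "0 \<le> x" "x \<le> 1 / 2"
  shows "(\<Sum>q=a..b. x ^ q) \<le> 2 * x ^ a"
proof (cases "a \<le> b")
  case True
  have "(1 - x) * (\<Sum>q=a..b. x ^ q) = x ^ a - x ^ Suc b" using True by (rule sum_gp_multiplied)
  also have "\<dots> \<le> x ^ a" using assms by simp
  finally have "(1 - x) * (\<Sum>q=a..b. x ^ q) \<le> x ^ a" .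
  moreover have "1 / 2 * (\<Sum>q=a..b. x ^ q) \<le> (1 - x) * (\<Sum>q=a..b. x ^ q)"
    using assms by (intro mult_right_mono sum_nonneg) auto
  ultimately show ?thesis by simp
qed (use assms in simp)

text \<open>Choosing \<open>q + 1\<close> points among \<open>3 q + 3\<close> can be done in at most \<open>8 ^ (q + 1)\<close> ways, so the union bound
over \<open>q\<close> is a geometric series with ratio \<open>8 p\<close>. The set \<open>U\<close> of points prescribed before the tail
contributes its own factor.\<close>
lemma bernoulli_mass_dense_tail:
  assumes "16 * p \<le> 1" "finite V" and that: "finite U" "U \<inter> {k<..} = {}"
  shows "bernoulli_mass p V (\<lambda>A. U \<subseteq> A \<and> (\<exists>q. q < card (A \<inter> {k<..k + 3 * q + 3}))) \<le>
    16 * p * p ^ card U"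
proof -
  let ?\<S> = "\<lambda>q. {S. S \<subseteq> {k<..k + 3 * q + 3} \<and> card S = Suc q}"
  have "bernoulli_mass p V (\<lambda>A. U \<subseteq> A \<and> (\<exists>q. q < card (A \<inter> {k<..k + 3 * q + 3})))
    \<le> (\<Sum>q\<in>{0..card V}. bernoulli_mass p V (\<lambda>A. U \<subseteq> A \<and> q < card (A \<inter> {k<..k + 3 * q + 3})))"
  proof (rule bernoulli_mass_union_bound)
    fix A assume A: "A \<subseteq> V" "U \<subseteq> A \<and> (\<exists>q. q < card (A \<inter> {k<..k + 3 * q + 3}))"
    then obtain q where q: "q < card (A \<inter> {k<..k + 3 * q + 3})" by auto
    have "card (A \<inter> {k<..k + 3 * q + 3}) \<le> card V" using A assms by (intro card_mono) auto
    with q A show "\<exists>q\<in>{0..card V}. U \<subseteq> A \<and> q < card (A \<inter> {k<..k + 3 * q + 3})" by (intro bexI[of _ q]) auto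
  qed (use assms in auto)
  also have "\<dots> \<le> (\<Sum>q\<in>{0..card V}. p ^ card U * (8 * p) * (8 * p) ^ q)"
  proof (rule sum_mono)
    fix q
    have "bernoulli_mass p V (\<lambda>A. U \<subseteq> A \<and> q < card (A \<inter> {k<..k + 3 * q + 3}))
      \<le> real (card ((\<lambda>S. U \<union> S) ` ?\<S> q)) * p ^ (card U + Suc q)"
    proof (rule bernoulli_mass_first_moment)
      fix A assume "U \<subseteq> A \<and> q < card (A \<inter> {k<..k + 3 * q + 3})"
      then obtain S where "S \<subseteq> A \<inter> {k<..k + 3 * q + 3}" "card S = Suc q" and "U \<subseteq> A"
        using obtain_subset_with_card_n[of "Suc q"] by (metis Suc_leI)
      thus "\<exists>S\<in>(\<lambda>S. U \<union> S) ` ?\<S> q. S \<subseteq> A" by (intro bexI[of _ "U \<union> S"]) auto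
    next
      fix S assume "S \<in> (\<lambda>S. U \<union> S) ` ?\<S> q"
      then obtain S' where S': "S = U \<union> S'" "S' \<subseteq> {k<..k + 3 * q + 3}" "card S' = Suc q" by auto
      moreover have "U \<inter> S' = {}" using S' that(2) by fastforce
      ultimately show "card S = card U + Suc q"
        using that(1) finite_subset[of S' "{k<..k + 3 * q + 3}"] by (auto simp: card_Un_disjoint)
    qed (use assms in auto)
    also have "\<dots> \<le> 8 ^ Suc q * p ^ (card U + Suc q)"
    proof (rule mult_right_mono)
      have "card ((\<lambda>S. U \<union> S) ` ?\<S> q) \<le> card (Pow {k<..k + 3 * q + 3})"
        by (rule surj_card_le[of _ _ "\<lambda>S. U \<union> S", OF _ image_mono]) auto
      also have "\<dots> = 2 ^ (3 * Suc q)" by (simp add: card_Pow)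
      also have "\<dots> = 8 ^ Suc q" unfolding power_mult by simp
      finally show "real (card ((\<lambda>S. U \<union> S) ` ?\<S> q)) \<le> 8 ^ Suc q"
        using of_nat_mono by fastforce
    qed (use p in simp)
    finally show "bernoulli_mass p V (\<lambda>A. U \<subseteq> A \<and> q < card (A \<inter> {k<..k + 3 * q + 3})) \<le>
      p ^ card U * (8 * p) * (8 * p) ^ q"
      by (simp add: power_add power_mult_distrib mult_ac)
  qed
  also have "\<dots> = p ^ card U * (8 * p) * (\<Sum>q=0..card V. (8 * p) ^ q)" by (simp add: sum_distrib_left)
  also have "\<dots> \<le> p ^ card U * (8 * p) * (2 * (8 * p) ^ 0)"
    using p assms by (intro mult_left_mono sum_powers_le) auto
  finally show ?thesis by (simp add: mult_ac)
qed

text \<open>Keep the first \<open>3 Q + 3\<close> positions empty. What is left of the condition is implied by the generic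
sparseness of the remaining positions, whose failure has mass at most one half.\<close>
lemma sparse_tail_mass:
  assumes "32 * p \<le> 1"
  shows "bernoulli_mass p {k<..n} (\<lambda>A. \<forall>q. card (A \<inter> {k<..k + 3 * q + 3}) \<le> (if q \<le> Q then 0 else q))
    \<ge> (1 - p) ^ (3 * Q + 3) / 2"
proof -
  let ?U = "{k<..min n (k + 3 * Q + 3)}" and ?V = "{k + 3 * Q + 3<..n}"
  let ?R = "\<lambda>B. \<forall>q. card (B \<inter> {k<..k + 3 * q + 3}) \<le> q"
  have "bernoulli_mass p ?V (\<lambda>A. \<not> ?R A) \<le>
      bernoulli_mass p ?V (\<lambda>A. {} \<subseteq> A \<and> (\<exists>q. q < card (A \<inter> {k<..k + 3 * q + 3})))"
    by (rule bernoulli_mass_mono) (auto simp: not_le)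
  also have "\<dots> \<le> 16 * p * p ^ card ({} :: nat set)"
    by (rule bernoulli_mass_dense_tail) (use assms p in auto)
  finally have V: "1 / 2 \<le> bernoulli_mass p ?V ?R"
    using bernoulli_mass_compl[of ?V ?R] assms by simp
  have "{A. A \<subseteq> ?U \<and> A = {}} = {{}}" by auto
  hence "bernoulli_mass p ?U (\<lambda>A. A = {}) = (1 - p) ^ card ?U"
    unfolding bernoulli_mass_def by simp
  also have "\<dots> \<ge> (1 - p) ^ (3 * Q + 3)" using p by (intro power_decreasing) auto
  finally have U: "(1 - p) ^ (3 * Q + 3) \<le> bernoulli_mass p ?U (\<lambda>A. A = {})" .
  have "(1 - p) ^ (3 * Q + 3) / 2 \<le> bernoulli_mass p ?U (\<lambda>A. A = {}) * bernoulli_mass p ?V ?R"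
    using mult_mono[OF U V bernoulli_mass_nonneg] by simp
  also have "\<dots> = bernoulli_mass p (?U \<union> ?V) (\<lambda>A. A \<inter> ?U = {} \<and> ?R (A \<inter> ?V))"
    by (rule bernoulli_mass_split[symmetric]) auto
  also have "?U \<union> ?V = {k<..n}" by auto
  also have "bernoulli_mass p {k<..n} (\<lambda>A. A \<inter> ?U = {} \<and> ?R (A \<inter> ?V)) \<le>
    bernoulli_mass p {k<..n} (\<lambda>A. \<forall>q. card (A \<inter> {k<..k + 3 * q + 3}) \<le> (if q \<le> Q then 0 else q))"
  proof (rule bernoulli_mass_mono, safe)
    fix A q assume A: "A \<subseteq> {k<..n}" "A \<inter> ?U = {}" "?R (A \<inter> ?V)"
    have AV: "A \<inter> ?V = A" using A by fastforce
    show "card (A \<inter> {k<..k + 3 * q + 3}) \<le> (if q \<le> Q then 0 else q)"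
    proof (cases "q \<le> Q")
      case True
      hence "(A \<inter> ?V) \<inter> {k<..k + 3 * q + 3} = {}" by auto
      thus ?thesis using AV by simp
    next
      case False
      moreover have "card ((A \<inter> ?V) \<inter> {k<..k + 3 * q + 3}) \<le> q" using A(3) by blast
      ultimately show ?thesis using AV by simp
    qed
  qed
  finally show ?thesis .
qed

lemma mu_mono: "\<A> \<subseteq> \<B> \<Longrightarrow> \<B> \<subseteq> Pow {1..n} \<Longrightarrow> mu n p \<A> \<le> mu n p \<B>"
  unfolding mu_def using p finite_subset[of \<B> "Pow {1..n}"] by (intro sum_mono2) auto

lemma mu_nonneg: "0 \<le> mu n p \<A>"
  unfolding mu_def using p by (intro sum_nonneg) auto

lemma mu_Un_le:
  assumes "\<A> \<subseteq> Pow {1..n}" "\<B> \<subseteq> Pow {1..n}" 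
  shows "mu n p (\<A> \<union> \<B>) \<le> mu n p \<A> + mu n p \<B>"
proof -
  have f: "finite \<A>" "finite \<B>" using assms finite_subset[of _ "Pow {1..n}"] by auto
  have "mu n p (\<A> \<union> \<B>) + mu n p (\<A> \<inter> \<B>) = mu n p \<A> + mu n p \<B>"
    unfolding mu_def using f by (rule sum.union_inter)
  thus ?thesis using mu_nonneg[of n "\<A> \<inter> \<B>"] by simp
qed

lemma mu_Diff_Int:
  assumes "\<A> \<subseteq> Pow {1..n}" 
  shows "mu n p \<A> = mu n p (\<A> - \<B>) + mu n p (\<A> \<inter> \<B>)"
proof -
  have f: "finite \<A>" using assms finite_subset[of _ "Pow {1..n}"] by auto
  show ?thesis unfolding mu_def using f sum.Int_Diff[OF f] by (simp add: add.commute)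
qed

lemma mu_sym_diff:
  assumes "\<A> \<subseteq> Pow {1..n}" "\<B> \<subseteq> Pow {1..n}" 
  shows "mu n p (sym_diff \<A> \<B>) = mu n p (\<A> - \<B>) + mu n p (\<B> - \<A>)"
proof -
  have f: "finite \<A>" "finite \<B>" using assms finite_subset[of _ "Pow {1..n}"] by auto
  show ?thesis unfolding mu_def using f by (subst sum.union_disjoint) auto
qed

lemma mu_UN_le:
  assumes "finite I" "\<And>i. i \<in> I \<Longrightarrow> \<F> i \<subseteq> Pow {1..n}" "\<A> \<subseteq> (\<Union>i\<in>I. \<F> i)"
  shows "mu n p \<A> \<le> (\<Sum>i\<in>I. mu n p (\<F> i))"
proof -
  have "mu n p \<A> \<le> mu n p (\<Union>i\<in>I. \<F> i)" by (rule mu_mono) (use assms in auto)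
  also have "\<dots> \<le> (\<Sum>i\<in>I. mu n p (\<F> i))"
    using assms(1,2)
  proof induction
    case (insert i I)
    have "mu n p (\<F> i \<union> (\<Union>i\<in>I. \<F> i)) \<le> mu n p (\<F> i) + mu n p (\<Union>i\<in>I. \<F> i)"
      using insert by (intro mu_Un_le) auto
    thus ?case using insert by simp
  qed (simp add: mu_def)
  finally show ?thesis .
qed

text \<open>Subadditivity of the product of the measure with itself. It turns a condition on all pairs in
\<open>\<A> \<times> \<B>\<close>, such as the walk inequality, into a bound on \<open>mu n p \<A> * mu n p \<B>\<close>.\<close>
lemma mu_product_cover:
  assumes "finite I" "\<A> \<subseteq> Pow {1..n}" "\<B> \<subseteq> Pow {1..n}"
    and "\<And>i. i \<in> I \<Longrightarrow> \<P> i \<subseteq> Pow {1..n}" "\<And>i. i \<in> I \<Longrightarrow> \<Q> i \<subseteq> Pow {1..n}"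
    and cover: "\<And>F G. F \<in> \<A> \<Longrightarrow> G \<in> \<B> \<Longrightarrow> \<exists>i\<in>I. F \<in> \<P> i \<and> G \<in> \<Q> i"
  shows "mu n p \<A> * mu n p \<B> \<le> (\<Sum>i\<in>I. mu n p (\<P> i) * mu n p (\<Q> i))"
proof -
  let ?w = "\<lambda>A. p ^ card A * (1 - p) ^ (n - card A)"
  let ?v = "\<lambda>(A, B). ?w A * ?w B"
  have w: "0 \<le> ?v x" for x using p by (cases x) simp
  have fin: "finite \<X>" if "\<X> \<subseteq> Pow {1..n}" for \<X> using that finite_subset[of _ "Pow {1..n}"] by auto
  have prod: "mu n p \<X> * mu n p \<Y> = sum ?v (\<X> \<times> \<Y>)" for \<X> \<Y>
    unfolding mu_def by (simp add: sum_product sum.cartesian_product)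
  have "sum ?v (\<A> \<times> \<B>) \<le> sum ?v (\<Union>i\<in>I. \<P> i \<times> \<Q> i)"
  proof (rule sum_mono2)
    show "finite (\<Union>i\<in>I. \<P> i \<times> \<Q> i)" using assms(1) fin[OF assms(4)] fin[OF assms(5)] by simp
    show "\<A> \<times> \<B> \<subseteq> (\<Union>i\<in>I. \<P> i \<times> \<Q> i)" using cover by blast
  qed (rule w)
  also have "\<dots> \<le> (\<Sum>i\<in>I. sum ?v (\<P> i \<times> \<Q> i))"
    using assms(1,4,5)
  proof induction
    case (insert i I)
    have "sum ?v ((\<P> i \<times> \<Q> i) \<union> (\<Union>i\<in>I. \<P> i \<times> \<Q> i)) + sum ?v ((\<P> i \<times> \<Q> i) \<inter> (\<Union>i\<in>I. \<P> i \<times> \<Q> i))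
      = sum ?v (\<P> i \<times> \<Q> i) + sum ?v (\<Union>i\<in>I. \<P> i \<times> \<Q> i)"
      using insert fin by (intro sum.union_inter) auto
    moreover have "0 \<le> sum ?v ((\<P> i \<times> \<Q> i) \<inter> (\<Union>i\<in>I. \<P> i \<times> \<Q> i))"
      using w by (intro sum_nonneg) auto
    ultimately show ?case using insert by simp
  qed simp
  finally show ?thesis unfolding prod .
qed

end

lemma mu_eq_0_iff:
  assumes "0 < p" "p < 1" "\<A> \<subseteq> Pow {1..n}"
  shows "mu n p \<A> = 0 \<longleftrightarrow> \<A> = {}"
proof -
  have f: "finite \<A>" using assms finite_subset[of _ "Pow {1..n}"] by auto
  have pos: "0 < p ^ card A * (1 - p) ^ (n - card A)" for A using assms by simp
  have "\<A> = {}" if "mu n p \<A> = 0"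
  proof (rule ccontr)
    assume "\<A> \<noteq> {}"
    with f pos have "0 < mu n p \<A>" unfolding mu_def by (intro sum_pos) auto
    with that show False by simp
  qed
  thus ?thesis by (auto simp: mu_def)
qed

section \<open>Estimates for binomial coefficients\<close>

lemma power_div_fact_le_exp:
  fixes x :: real assumes "0 \<le> x" shows "x ^ k / fact k \<le> exp x"
proof -
  have "summable (\<lambda>n. x ^ n /\<^sub>R fact n)" using exp_converges[of x] by (rule sums_summable)
  from sum_le_suminf[OF this, of "{k}"] have "x ^ k /\<^sub>R fact k \<le> (\<Sum>n. x ^ n /\<^sub>R fact n)"
    using assms by simp
  thus ?thesis using sums_unique[OF exp_converges[of x]] by (simp add: divide_inverse mult.commute)
qed

lemma binomial_power_le:
  fixes p :: real assumes "0 \<le> p"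
  shows "real (N choose k) * p ^ k \<le> (real N * p) ^ k / fact k"
proof -
  have "real ((N choose k) * fact k) \<le> real (N ^ k)" using binomial_fact_pow of_nat_mono by blast
  hence "real (N choose k) * fact k \<le> real N ^ k" by simp
  hence "real (N choose k) \<le> real N ^ k / fact k" by (simp add: pos_le_divide_eq)
  hence "real (N choose k) * p ^ k \<le> real N ^ k / fact k * p ^ k"
    using assms by (intro mult_right_mono) auto
  thus ?thesis by (simp add: power_mult_distrib)
qed

text \<open>Here \<open>N * p\<close> is at most \<open>R\<close> plus \<open>3 k p\<close>. Where the first part dominates, the estimate
\<open>(N p)^k / k!\<close> gives a term of an exponential series; where the second dominates, \<open>k^k \<le> 3^k * k!\<close> turns it
into \<open>(18 p)^k\<close>, and \<open>36 p \<le> 1\<close> makes this at most \<open>2^(- k)\<close>.\<close>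
lemma binomial_power_split_le:
  fixes p :: real assumes "0 \<le> p" "36 * p \<le> 1" "real N * p \<le> R + 3 * real k * p" "0 \<le> R"
  shows "real (N choose k) * p ^ k \<le> (2 * R) ^ k / fact k + (1 / 2) ^ k"
proof -
  have "real (N choose k) * p ^ k \<le> (real N * p) ^ k / fact k" by (rule binomial_power_le) fact
  also have "(real N * p) ^ k \<le> (2 * R) ^ k + (6 * p * real k) ^ k"
  proof (cases "R \<le> 3 * real k * p")
    case True
    hence "real N * p \<le> 6 * p * real k" using assms(3) by (simp add: mult_ac)
    hence "(real N * p) ^ k \<le> (6 * p * real k) ^ k" using assms by (intro power_mono) auto
    thus ?thesis using assms by (simp add: add_increasing)
  next
    case False
    hence "(real N * p) ^ k \<le> (2 * R) ^ k" using assms by (intro power_mono) auto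
    thus ?thesis using assms by (simp add: add_increasing2)
  qed
  also have "((2 * R) ^ k + (6 * p * real k) ^ k) / fact k
    = (2 * R) ^ k / fact k + (6 * p) ^ k * (real k ^ k / fact k)"
    by (simp add: add_divide_distrib power_mult_distrib)
  also have "(6 * p) ^ k * (real k ^ k / fact k) \<le> (6 * p) ^ k * 3 ^ k"
  proof (rule mult_left_mono)
    have "real k ^ k / fact k \<le> exp (real k)" by (rule power_div_fact_le_exp) simp
    also have "\<dots> = exp 1 ^ k" by (simp add: exp_of_nat_mult[symmetric])
    also have "\<dots> \<le> 3 ^ k" using exp_le by (intro power_mono) auto
    finally show "real k ^ k / fact k \<le> 3 ^ k" .
  qed (use assms in simp)
  also have "(6 * p) ^ k * 3 ^ k = (18 * p) ^ k" unfolding power_mult_distrib[symmetric] by simp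
  also have "\<dots> \<le> (1 / 2) ^ k" using assms by (intro power_mono) auto
  finally show ?thesis by (simp add: divide_right_mono)
qed

lemma binomial_lower_power:
  assumes "r \<le> t" shows "(real t - real r) ^ r \<le> fact r * real (t choose r)"
  using assms
proof (induction r)
  case (Suc r)
  have "Suc r * (t choose Suc r) = (t - r) * (t choose r)"
    using binomial_absorption[of r t] binomial_absorb_comp[of t r] Suc.prems by simp
  hence e: "real (Suc r) * real (t choose Suc r) = (real t - real r) * real (t choose r)"
    using Suc.prems by (metis Suc_leD of_nat_diff of_nat_mult)
  have "(real t - real (Suc r)) ^ Suc r \<le> (real t - real r) ^ Suc r"
    using Suc.prems by (intro power_mono) auto
  also have "\<dots> \<le> (real t - real r) * (fact r * real (t choose r))"
    using Suc by (simp add: mult_left_mono)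
  also have "\<dots> = fact r * (real (Suc r) * real (t choose Suc r))" using e by (simp add: mult_ac)
  finally show ?case by (simp add: mult_ac)
qed simp

section \<open>Measures of threshold families and typical sets\<close>

lemma threshold_subset_Pow: "threshold_family n k g \<subseteq> Pow {1..n}"
  by (auto simp: threshold_family_def)

lemma typical_subset_Pow: "typical n t m s Q \<subseteq> Pow {1..n}"
  by (auto simp: typical_def)

lemma subset_of_few_gaps:
  assumes "gaps k F \<le> g" shows "\<exists>S\<subseteq>{1..k}. card S = k - g \<and> S \<subseteq> F"
proof -
  have "k - g \<le> card (F \<inter> {1..k})" using gaps_Int[of k F] assms by linarith
  then obtain S where "S \<subseteq> F \<inter> {1..k}" "card S = k - g" using obtain_subset_with_card_n by metis
  thus ?thesis by blast
qed

definition atypical :: "nat \<Rightarrow> nat \<Rightarrow> nat \<Rightarrow> nat \<Rightarrow> nat set set" where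
  "atypical n t m j = threshold_family n (t + m) j - typical n t m j 0"

lemma atypical_subset_Pow: "atypical n t m j \<subseteq> Pow {1..n}"
  by (auto simp: atypical_def threshold_family_def)

lemma bernoulli_mass_layer:
  fixes p :: real
  assumes "finite V" "s \<le> card V"
  shows "bernoulli_mass p V (\<lambda>A. card (V - A) = s) =
    real (card V choose s) * (p ^ (card V - s) * (1 - p) ^ s)"
proof -
  have "{A. A \<subseteq> V \<and> card (V - A) = s} = {A. A \<subseteq> V \<and> card A = card V - s}"
    using assms by (auto simp: card_Diff_subset finite_subset card_mono)
  moreover have "bernoulli_mass p V (\<lambda>A. card (V - A) = s) =
    (\<Sum>A | A \<subseteq> V \<and> card (V - A) = s. p ^ (card V - s) * (1 - p) ^ s)"
    unfolding bernoulli_mass_def using assms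
    by (intro sum.cong) (auto simp: card_Diff_subset finite_subset card_mono)
  ultimately show ?thesis
    using n_subsets[OF assms(1), of "card V - s"] binomial_symmetric[OF assms(2)] by simp
qed

context
  fixes p :: real
  assumes p: "0 \<le> p" "p \<le> 1"
begin

lemma mu_first_moment:
  assumes "finite \<S>" "\<A> \<subseteq> Pow {1..n}" "\<And>A. A \<in> \<A> \<Longrightarrow> \<exists>S\<in>\<S>. S \<subseteq> A" "\<And>S. S \<in> \<S> \<Longrightarrow> card S = c"
  shows "mu n p \<A> \<le> real (card \<S>) * p ^ c"
  unfolding mu_eq_bernoulli_mass[OF assms(2)]
  by (rule bernoulli_mass_first_moment[OF p]) (use assms in auto)

lemma mu_threshold_le:
  assumes "g \<le> k" shows "mu n p (threshold_family n k g) \<le> real (k choose g) * p ^ (k - g)"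
proof -
  have "mu n p (threshold_family n k g) \<le> real (card {S. S \<subseteq> {1..k} \<and> card S = k - g}) * p ^ (k - g)"
  proof (rule mu_first_moment)
    fix A assume "A \<in> threshold_family n k g"
    thus "\<exists>S\<in>{S. S \<subseteq> {1..k} \<and> card S = k - g}. S \<subseteq> A"
      using subset_of_few_gaps[of k A g] by (auto simp: threshold_family_def)
  qed (auto simp: threshold_family_def)
  thus ?thesis using n_subsets[of "{1..k}" "k - g"] binomial_symmetric[OF assms] by simp
qed

lemma mu_typical_le:
  assumes "s \<le> t" shows "mu n p (typical n t m s Q) \<le> real (t choose s) * p ^ (t + m - s)"
proof -
  let ?\<S> = "{S. S \<subseteq> {1..t} \<and> card S = t - s}"
  have fin: "finite ?\<S>" by simp
  have "mu n p (typical n t m s Q) \<le> real (card ((\<lambda>S. S \<union> {t<..t + m}) ` ?\<S>)) * p ^ (t + m - s)"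
  proof (rule mu_first_moment)
    fix A assume A: "A \<in> typical n t m s Q"
    then obtain S where "S \<subseteq> {1..t}" "card S = t - s" "S \<subseteq> A"
      using subset_of_few_gaps[of t A s] by (auto simp: typical_def)
    with A show "\<exists>S\<in>(\<lambda>S. S \<union> {t<..t + m}) ` ?\<S>. S \<subseteq> A" by (auto simp: typical_def)
  next
    fix S assume "S \<in> (\<lambda>S. S \<union> {t<..t + m}) ` ?\<S>"
    then obtain S' where S': "S = S' \<union> {t<..t + m}" "S' \<subseteq> {1..t}" "card S' = t - s" by auto
    hence "finite S'" "S' \<inter> {t<..t + m} = {}" using finite_subset by auto
    with S' assms show "card S = t + m - s" by (simp add: card_Un_disjoint)
  qed (use fin typical_subset_Pow in auto)
  also have "\<dots> \<le> real (card ?\<S>) * p ^ (t + m - s)"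
    using p card_image_le[OF fin] by (intro mult_right_mono) auto
  also have "card ?\<S> = t choose s" using n_subsets[of "{1..t}" "t - s"] binomial_symmetric[OF assms] by simp
  finally show ?thesis .
qed

text \<open>The three summands belong to the three ways of being atypical: a gap behind \<open>t\<close>, fewer than \<open>j\<close> gaps
in all, and a dense tail. Compared with the bound for the threshold family each of them is smaller by
a factor of order \<open>p\<close>: fixing the position of a gap saves a factor \<open>t\<close> in the binomial coefficient,
and the other two require additional elements.\<close>
lemma mu_atypical_le:
  assumes "16 * p \<le> 1" "j \<le> t + m"
  shows "mu n p (atypical n t m j) \<le>
    real m * (real ((t + m - 1) choose (t + m - j)) * p ^ (t + m - j)) +
    real ((t + m) choose (t + m - j + 1)) * p ^ (t + m - j + 1) +
    16 * p * (real ((t + m) choose j) * p ^ (t + m - j))"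
proof -
  let ?k = "t + m" and ?l = "t + m - j"
  let ?X = "\<lambda>x. {F. F \<subseteq> {1..n} \<and> (\<exists>S\<in>{S. S \<subseteq> {1..?k} - {x} \<and> card S = ?l}. S \<subseteq> F)}"
  let ?Y = "{F. F \<subseteq> {1..n} \<and> (\<exists>S\<in>{S. S \<subseteq> {1..?k} \<and> card S = ?l + 1}. S \<subseteq> F)}"
  let ?\<S> = "{S. S \<subseteq> {1..?k} \<and> card S = ?l}"
  let ?Z = "{F. F \<subseteq> {1..n} \<and> (\<exists>S\<in>?\<S>. S \<subseteq> F \<and> (\<exists>q. q < card (F \<inter> {?k<..?k + 3 * q + 3})))}"
  have "atypical n t m j \<subseteq> ((\<Union>x\<in>{t<..?k}. ?X x) \<union> ?Y) \<union> ?Z"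
  proof
    fix F assume F: "F \<in> atypical n t m j"
    hence Fn: "F \<subseteq> {1..n}" and g: "gaps ?k F \<le> j" and nt: "F \<notin> typical n t m j 0"
      by (auto simp: atypical_def threshold_family_def)
    consider x where "x \<in> {t<..?k}" "x \<notin> F" | "gaps ?k F < j"
      | "{t<..?k} \<subseteq> F" "gaps ?k F = j" using g by force
    then show "F \<in> ((\<Union>x\<in>{t<..?k}. ?X x) \<union> ?Y) \<union> ?Z"
    proof cases
      case (1 x)
      obtain S where "S \<subseteq> {1..?k}" "card S = ?l" "S \<subseteq> F" using subset_of_few_gaps[OF g] by auto
      hence "S \<in> {S. S \<subseteq> {1..?k} - {x} \<and> card S = ?l}" using 1 by auto
      hence "F \<in> ?X x" using Fn \<open>S \<subseteq> F\<close> by blast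
      thus ?thesis using 1 by blast
    next
      case 2
      hence "gaps ?k F \<le> j - 1" "?k - (j - 1) = ?l + 1" using assms(2) by auto
      with subset_of_few_gaps[of ?k F "j - 1"] Fn have "F \<in> ?Y" by auto
      thus ?thesis by blast
    next
      case 3
      have "F \<inter> {t<..?k} = {t<..?k}" using 3 by auto
      hence "gaps t F = j" using 3 gaps_add[of t m F] by simp
      with nt Fn 3 obtain q where "q < card (F \<inter> {?k<..?k + 3 * q + 3})"
        by (auto simp: typical_def not_le split: if_splits)
      moreover obtain S where "S \<in> ?\<S>" "S \<subseteq> F" using subset_of_few_gaps[OF g] by auto
      ultimately have "F \<in> ?Z" using Fn by blast
      thus ?thesis by blast
    qed
  qed
  hence "mu n p (atypical n t m j) \<le> mu n p (((\<Union>x\<in>{t<..?k}. ?X x) \<union> ?Y) \<union> ?Z)"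
    by (rule mu_mono[OF p]) auto
  also have "\<dots> \<le> mu n p ((\<Union>x\<in>{t<..?k}. ?X x) \<union> ?Y) + mu n p ?Z"
    by (rule mu_Un_le[OF p]) auto
  also have "mu n p ((\<Union>x\<in>{t<..?k}. ?X x) \<union> ?Y) \<le> mu n p (\<Union>x\<in>{t<..?k}. ?X x) + mu n p ?Y"
    by (rule mu_Un_le[OF p]) auto
  also have "mu n p (\<Union>x\<in>{t<..?k}. ?X x) \<le> (\<Sum>x\<in>{t<..?k}. mu n p (?X x))"
    by (rule mu_UN_le[OF p]) auto
  also have "\<dots> \<le> (\<Sum>x\<in>{t<..?k}. real ((?k - 1) choose ?l) * p ^ ?l)"
  proof (rule sum_mono)
    fix x assume x: "x \<in> {t<..?k}"
    have "mu n p (?X x) \<le> real (card {S. S \<subseteq> {1..?k} - {x} \<and> card S = ?l}) * p ^ ?l"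
      by (rule mu_first_moment) auto
    also have "card {S. S \<subseteq> {1..?k} - {x} \<and> card S = ?l} = (?k - 1) choose ?l"
      using x by (subst n_subsets) auto
    finally show "mu n p (?X x) \<le> real ((?k - 1) choose ?l) * p ^ ?l" .
  qed
  also have "\<dots> = real m * (real ((?k - 1) choose ?l) * p ^ ?l)" by simp
  also have "mu n p ?Y \<le> real (card {S. S \<subseteq> {1..?k} \<and> card S = ?l + 1}) * p ^ (?l + 1)"
    by (rule mu_first_moment) auto
  also have "card {S. S \<subseteq> {1..?k} \<and> card S = ?l + 1} = ?k choose (?l + 1)"
    using n_subsets[of "{1..?k}"] by simp
  also have "mu n p ?Z \<le> 16 * p * (real (?k choose j) * p ^ ?l)"
  proof -
    have "mu n p ?Z = bernoulli_mass p {1..n} (\<lambda>A. A \<in> ?Z)" by (rule mu_eq_bernoulli_mass) auto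
    also have "\<dots> \<le> (\<Sum>S\<in>?\<S>. bernoulli_mass p {1..n}
        (\<lambda>A. S \<subseteq> A \<and> (\<exists>q. q < card (A \<inter> {?k<..?k + 3 * q + 3}))))"
      by (rule bernoulli_mass_union_bound[OF p]) auto
    also have "\<dots> \<le> (\<Sum>S\<in>?\<S>. 16 * p * p ^ ?l)"
    proof (rule sum_mono)
      fix S assume S: "S \<in> ?\<S>"
      hence "finite S" "S \<inter> {?k<..} = {}" using finite_subset by fastforce+
      from bernoulli_mass_dense_tail[OF p assms(1) finite_atLeastAtMost this] S
      show "bernoulli_mass p {1..n} (\<lambda>A. S \<subseteq> A \<and> (\<exists>q. q < card (A \<inter> {?k<..?k + 3 * q + 3}))) \<le> 16 * p * p ^ ?l"
        by simp
    qed
    also have "\<dots> = real (card ?\<S>) * (16 * p * p ^ ?l)" by simp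
    also have "card ?\<S> = ?k choose j" using n_subsets[of "{1..?k}" ?l] binomial_symmetric[OF assms(2)] by simp
    finally show ?thesis by (simp add: mult_ac)
  qed
  finally show ?thesis by simp
qed

text \<open>Membership is guaranteed by independent conditions on the blocks \<open>{1..t}\<close>, \<open>{t<..t + m}\<close> and
\<open>{t + m<..n}\<close>, the first of which has the exact binomial probability of \<open>s\<close> gaps.\<close>
lemma mu_layered_lower:
  assumes "s \<le> t" "t + m \<le> n" "\<A> \<subseteq> Pow {1..n}"
    and "\<And>F. F \<subseteq> {1..n} \<Longrightarrow> gaps t F = s \<Longrightarrow> {t<..t + m} \<subseteq> F \<Longrightarrow> T (F \<inter> {t + m<..n}) \<Longrightarrow> F \<in> \<A>"
  shows "real (t choose s) * (p ^ (t - s) * (1 - p) ^ s) * p ^ m * bernoulli_mass p {t + m<..n} T \<le> mu n p \<A>"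
proof -
  let ?U = "{1..t}" and ?M = "{t<..t + m}" and ?W = "{t + m<..n}"
  have "{A. A \<subseteq> ?M \<and> A = ?M} = {?M}" by auto
  hence M: "bernoulli_mass p ?M (\<lambda>A. A = ?M) = p ^ m" unfolding bernoulli_mass_def by simp
  have U: "bernoulli_mass p ?U (\<lambda>A. card (?U - A) = s) = real (t choose s) * (p ^ (t - s) * (1 - p) ^ s)"
    using bernoulli_mass_layer[of ?U s p] assms(1) by simp
  have "real (t choose s) * (p ^ (t - s) * (1 - p) ^ s) * p ^ m * bernoulli_mass p ?W T =
    bernoulli_mass p ?U (\<lambda>A. card (?U - A) = s) * (bernoulli_mass p ?M (\<lambda>A. A = ?M) * bernoulli_mass p ?W T)"
    unfolding U M by (simp add: mult_ac)
  also have "\<dots> = bernoulli_mass p ?U (\<lambda>A. card (?U - A) = s) *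
    bernoulli_mass p (?M \<union> ?W) (\<lambda>A. A \<inter> ?M = ?M \<and> T (A \<inter> ?W))"
    by (subst bernoulli_mass_split[OF p]) auto
  also have "\<dots> = bernoulli_mass p (?U \<union> (?M \<union> ?W)) (\<lambda>A. card (?U - A \<inter> ?U) = s \<and>
      (A \<inter> (?M \<union> ?W) \<inter> ?M = ?M \<and> T (A \<inter> (?M \<union> ?W) \<inter> ?W)))"
    by (rule bernoulli_mass_split[OF p, symmetric]) auto
  also have "?U \<union> (?M \<union> ?W) = {1..n}" using assms(2) by auto
  also have "bernoulli_mass p {1..n} (\<lambda>A. card (?U - A \<inter> ?U) = s \<and>
      (A \<inter> (?M \<union> ?W) \<inter> ?M = ?M \<and> T (A \<inter> (?M \<union> ?W) \<inter> ?W))) \<le> bernoulli_mass p {1..n} (\<lambda>A. A \<in> \<A>)"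
  proof (rule bernoulli_mass_mono[OF p])
    fix A assume A: "A \<subseteq> {1..n}" "card (?U - A \<inter> ?U) = s \<and>
      (A \<inter> (?M \<union> ?W) \<inter> ?M = ?M \<and> T (A \<inter> (?M \<union> ?W) \<inter> ?W))"
    have "?U - A \<inter> ?U = ?U - A" "A \<inter> (?M \<union> ?W) \<inter> ?W = A \<inter> ?W" by auto
    with A show "A \<in> \<A>" by (intro assms(4)) (auto simp: gaps_def)
  qed auto
  finally show ?thesis unfolding mu_eq_bernoulli_mass[OF assms(3)] .
qed

lemma mu_typical_ge:
  assumes "s \<le> t" "t + m \<le> n" "32 * p \<le> 1"
  shows "real (t choose s) * (p ^ (t - s) * (1 - p) ^ s) * p ^ m * ((1 - p) ^ (3 * Q + 3) / 2)
    \<le> mu n p (typical n t m s Q)"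
proof -
  let ?T = "\<lambda>A. \<forall>q. card (A \<inter> {t + m<..t + m + 3 * q + 3}) \<le> (if q \<le> Q then 0 else q)"
  have "real (t choose s) * (p ^ (t - s) * (1 - p) ^ s) * p ^ m * ((1 - p) ^ (3 * Q + 3) / 2) \<le>
    real (t choose s) * (p ^ (t - s) * (1 - p) ^ s) * p ^ m * bernoulli_mass p {t + m<..n} ?T"
    using p by (intro mult_left_mono[OF sparse_tail_mass[OF p assms(3)]]) auto
  also have "\<dots> \<le> mu n p (typical n t m s Q)"
  proof (rule mu_layered_lower)
    fix F assume F: "F \<subseteq> {1..n}" "gaps t F = s" "{t<..t + m} \<subseteq> F" "?T (F \<inter> {t + m<..n})"
    have "F \<inter> {t + m<..n} \<inter> {t + m<..t + m + 3 * q + 3} = F \<inter> {t + m<..t + m + 3 * q + 3}" for q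
      using F(1) by auto
    with F show "F \<in> typical n t m s Q" by (simp add: typical_def)
  qed (use assms typical_subset_Pow in auto)
  finally show ?thesis .
qed

lemma mu_threshold_ge:
  assumes "s \<le> t" "t + m \<le> n"
  shows "real (t choose s) * (p ^ (t - s) * (1 - p) ^ s) * p ^ m \<le> mu n p (threshold_family n (t + m) s)"
proof -
  have "real (t choose s) * (p ^ (t - s) * (1 - p) ^ s) * p ^ m * bernoulli_mass p {t + m<..n} (\<lambda>_. True)
    \<le> mu n p (threshold_family n (t + m) s)"
  proof (rule mu_layered_lower)
    fix F assume F: "F \<subseteq> {1..n}" "gaps t F = s" "{t<..t + m} \<subseteq> F"
    have "F \<inter> {t<..t + m} = {t<..t + m}" using F by auto
    with F show "F \<in> threshold_family n (t + m) s" 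
      using gaps_add[of t m F] by (simp add: threshold_family_def)
  qed (use assms threshold_subset_Pow in auto)
  thus ?thesis using bernoulli_mass_total[OF p, of "{t + m<..n}"] by simp
qed

end

section \<open>Concentration on one pair of gap numbers\<close>

text \<open>A bound on \<open>(N choose k) * p ^ k\<close> that is uniform in \<open>k\<close> as long as \<open>N * p \<le> R + 1 + 3 * k * p\<close>.\<close>
definition binomial_bound :: "real \<Rightarrow> real" where
  "binomial_bound R = exp (2 * (R + 1)) + 1"

lemma binomial_bound_ge_1: "1 \<le> binomial_bound R"
  unfolding binomial_bound_def by simp

lemma binomial_power_bounded:
  fixes p :: real
  assumes "0 \<le> p" "36 * p \<le> 1" "real t * p \<le> R" "0 \<le> R" "real m * p \<le> 1" "N \<le> t + m + 3 * k"
  shows "real (N choose k) * p ^ k \<le> binomial_bound R"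
proof -
  have "real N \<le> real t + real m + 3 * real k" using assms(6) by linarith
  hence "real N * p \<le> (real t + real m + 3 * real k) * p" using assms(1) by (rule mult_right_mono)
  hence "real N * p \<le> (R + 1) + 3 * real k * p" using assms by (simp add: algebra_simps)
  hence "real (N choose k) * p ^ k \<le> (2 * (R + 1)) ^ k / fact k + (1 / 2) ^ k"
    using assms by (intro binomial_power_split_le) auto
  also have "\<dots> \<le> exp (2 * (R + 1)) + 1"
    using assms by (intro add_mono power_div_fact_le_exp power_le_one) auto
  finally show ?thesis by (simp add: binomial_bound_def)
qed

text \<open>The factor \<open>p ^ j\<close> absorbs the binomial coefficient, of order \<open>t ^ j\<close>; products of such estimates for
\<open>j\<close> and \<open>J - j\<close> recombine to \<open>p ^ (2 * t)\<close>.\<close>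
lemma weighted_mu_threshold_le:
  fixes p :: real
  assumes "0 \<le> p" "36 * p \<le> 1" "real t * p \<le> R" "0 \<le> R" "real m * p \<le> 1" "j \<le> t + m"
  shows "p ^ j * mu n p (threshold_family n (t + m) j) \<le> binomial_bound R * p ^ (t + m - j)"
proof -
  have "p ^ j * mu n p (threshold_family n (t + m) j) \<le> p ^ j * (real ((t + m) choose j) * p ^ (t + m - j))"
    using assms by (intro mult_left_mono mu_threshold_le) auto
  also have "\<dots> = (real ((t + m) choose j) * p ^ j) * p ^ (t + m - j)" by (simp add: mult_ac)
  also have "\<dots> \<le> binomial_bound R * p ^ (t + m - j)"
    using assms by (intro mult_right_mono binomial_power_bounded[of p t R m]) auto
  finally show ?thesis .
qed

lemma weighted_mu_atypical_le:
  fixes p :: real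
  assumes "0 \<le> p" "36 * p \<le> 1" "real t * p \<le> R" "0 \<le> R" "real m * p \<le> 1" "j \<le> t + m" "1 \<le> t"
  shows "p ^ j * mu n p (atypical n t m j) \<le> (real m + 17) * binomial_bound R * p * p ^ (t + m - j)"
proof -
  let ?k = "t + m" and ?l = "t + m - j" and ?C = "binomial_bound R"
  have p1: "p \<le> 1" using assms by simp
  have C0: "0 \<le> ?C" using binomial_bound_ge_1[of R] by simp
  have C: "real (N choose i) * p ^ i \<le> ?C" if "N \<le> t + m" for N i
    using assms that by (intro binomial_power_bounded[of p t R m]) auto
  have b1: "real ((?k - 1) choose ?l) * p ^ j \<le> ?C * p"
  proof (cases j)
    case 0 thus ?thesis using assms C0 by (simp add: binomial_eq_0)
  next
    case (Suc i)
    hence "(?k - 1) choose ?l = (?k - 1) choose i"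
      using binomial_symmetric[of i "?k - 1"] assms(6) by (simp add: Suc_le_eq)
    thus ?thesis using mult_right_mono[OF C[of "?k - 1" i] assms(1)] Suc by (simp add: mult_ac)
  qed
  have b2: "real (?k choose (?l + 1)) * p ^ j \<le> ?C * p"
  proof (cases j)
    case 0 thus ?thesis using assms C0 by (simp add: binomial_eq_0)
  next
    case (Suc i)
    hence "?k choose (?l + 1) = ?k choose i"
      using binomial_symmetric[of i "?k"] assms(6) by (simp add: Suc_diff_Suc)
    thus ?thesis using mult_right_mono[OF C[of "?k" i] assms(1)] Suc by (simp add: mult_ac)
  qed
  have "p ^ j * mu n p (atypical n t m j) \<le> p ^ j * (real m * (real ((?k - 1) choose ?l) * p ^ ?l) +
    real (?k choose (?l + 1)) * p ^ (?l + 1) + 16 * p * (real (?k choose j) * p ^ ?l))"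
    using assms p1 by (intro mult_left_mono mu_atypical_le) auto
  also have "\<dots> = p ^ ?l * (real m * (real ((?k - 1) choose ?l) * p ^ j) +
      (real (?k choose (?l + 1)) * p ^ j) * p + 16 * p * (real (?k choose j) * p ^ j))"
    by (simp add: algebra_simps)
  also have "\<dots> \<le> p ^ ?l * (real m * (?C * p) + (?C * p) * 1 + 16 * p * ?C)"
  proof (rule mult_left_mono)
    have "(real (?k choose (?l + 1)) * p ^ j) * p \<le> (?C * p) * 1"
      by (rule mult_mono[OF b2 p1]) (use assms(1) C0 in auto)
    thus "real m * (real ((?k - 1) choose ?l) * p ^ j) +
      (real (?k choose (?l + 1)) * p ^ j) * p + 16 * p * (real (?k choose j) * p ^ j) \<le>
      real m * (?C * p) + (?C * p) * 1 + 16 * p * ?C"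
      using mult_left_mono[OF b1, of "real m"] mult_left_mono[OF C[of ?k j], of "16 * p"] assms(1)
      by (intro add_mono) auto
  qed (use assms(1) in simp)
  also have "\<dots> = (real m + 17) * ?C * p * p ^ ?l" by (simp add: algebra_simps)
  finally show ?thesis .
qed

text \<open>The sum over the distributions of \<open>J\<close> gaps to two sets is Vandermonde's convolution, so it behaves
as the mass of a single set with \<open>J\<close> gaps among \<open>2 (t + J)\<close> points. The result is summable in \<open>J\<close>.\<close>
lemma pair_mu_threshold_sum_le:
  fixes p :: real
  assumes "0 \<le> p" "36 * p \<le> 1" "real t * p \<le> R" "0 \<le> R"
  shows "(\<Sum>j\<le>J. mu n p (threshold_family n (t + J) j) * mu n p (threshold_family n (t + J) (J - j)))
    \<le> p ^ (2 * t) * ((4 * R) ^ J / fact J + (1 / 2) ^ J)"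
proof -
  have p1: "p \<le> 1" using assms by simp
  have "(\<Sum>j\<le>J. mu n p (threshold_family n (t + J) j) * mu n p (threshold_family n (t + J) (J - j)))
    \<le> (\<Sum>j\<le>J. p ^ (2 * t + J) * (real ((t + J) choose j) * real ((t + J) choose (J - j))))"
  proof (rule sum_mono)
    fix j assume "j \<in> {..J}"
    hence j: "j \<le> J" by simp
    have "mu n p (threshold_family n (t + J) j) * mu n p (threshold_family n (t + J) (J - j)) \<le>
      (real ((t + J) choose j) * p ^ (t + J - j)) * (real ((t + J) choose (J - j)) * p ^ (t + J - (J - j)))"
      using assms p1 j by (intro mult_mono mu_threshold_le) (auto intro: mu_nonneg)
    also have "\<dots> = (p ^ (t + J - j) * p ^ (t + J - (J - j))) * (real ((t + J) choose j) * real ((t + J) choose (J - j)))"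
      by (simp add: mult_ac)
    also have "p ^ (t + J - j) * p ^ (t + J - (J - j)) = p ^ (2 * t + J)"
      unfolding power_add[symmetric] using j by (intro arg_cong[of _ _ "power p"]) simp
    finally show "mu n p (threshold_family n (t + J) j) * mu n p (threshold_family n (t + J) (J - j)) \<le>
      p ^ (2 * t + J) * (real ((t + J) choose j) * real ((t + J) choose (J - j)))" .
  qed
  also have "\<dots> = p ^ (2 * t + J) * real (\<Sum>j\<le>J. ((t + J) choose j) * ((t + J) choose (J - j)))"
    by (simp add: sum_distrib_left)
  also have "\<dots> = p ^ (2 * t) * (real ((2 * t + 2 * J) choose J) * p ^ J)"
    proof -
    have "t + J + (t + J) = 2 * t + 2 * J" by simp
    thus ?thesis unfolding vandermonde by (simp only: \<open>t + J + (t + J) = _\<close>) (simp add: power_add mult_ac)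
  qed
  also have "\<dots> \<le> p ^ (2 * t) * ((2 * (2 * R)) ^ J / fact J + (1 / 2) ^ J)"
  proof (intro mult_left_mono binomial_power_split_le)
    have "real (2 * t + 2 * J) * p = 2 * (real t * p) + 2 * (real J * p)" by (simp add: algebra_simps)
    also have "\<dots> \<le> 2 * R + 3 * (real J * p)" using assms by (intro add_mono mult_right_mono) auto
    finally show "real (2 * t + 2 * J) * p \<le> 2 * R + 3 * real J * p" by (simp add: mult_ac)
  qed (use assms in auto)
  finally show ?thesis by simp
qed

text \<open>By the walk inequality every pair in \<open>\<A> \<times> \<B>\<close> has, for some \<open>J\<close>, at most \<open>J\<close> gaps altogether in
\<open>{1..t + J}\<close>. The values \<open>J \<ge> K\<close> contribute the tail of a convergent series. For each of the finitely
many \<open>J < K\<close>, either one of the two sets is atypical, which costs a factor \<open>p\<close>, or both are typical,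
and that happens for one pair of gap numbers only.\<close>
lemma product_concentrates:
  fixes p :: real
  assumes nice: "nice n t \<A> \<B>" 
    and p: "0 < p" "36 * p \<le> 1" "real t * p \<le> R" "0 \<le> R" "1 \<le> t" and J1: "real K * p \<le> 1" "1 \<le> K"
  shows "\<exists>j j'. mu n p \<A> * mu n p \<B> \<le>
    p ^ (2 * t) * ((\<Sum>J=K..n. (4 * R) ^ J / fact J + (1 / 2) ^ J) +
      2 * real K * real K * (real K + 17) * (binomial_bound R)\<^sup>2 * p) +
    mu n p (\<A> \<inter> typical n t (j + j') j 0) * mu n p (\<B> \<inter> typical n t (j + j') j' 0)"
proof -
  have p01: "0 \<le> p" "p \<le> 1" using p by auto
  let ?C = "binomial_bound R"
  let ?T = "\<lambda>J j. threshold_family n (t + J) j"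
  let ?D = "(real K + 17) * ?C\<^sup>2 * p * p ^ (2 * t)"
  have C0: "0 \<le> ?C" using binomial_bound_ge_1[of R] by simp
  \<comment> \<open>Rectangles of kind 0 serve for large \<open>J\<close>; for small \<open>J\<close>, kinds 1 and 2 have an atypical side, and in kind 3 both sides are typical.\<close>
  define kinds :: "nat \<Rightarrow> nat set" where "kinds J = (if J < K then {1, 2, 3} else {0})" for J
  define P where "P = (\<lambda>(J, j, c). if c = 0 then ?T J j else if c = 1 then atypical n t J j
    else if c = (2::nat) then ?T J j else \<A> \<inter> typical n t J j 0)"
  define Q where "Q = (\<lambda>(J, j, c). if c = 0 then ?T J (J - j) else if c = 1 then ?T J (J - j)
    else if c = (2::nat) then atypical n t J (J - j) else \<B> \<inter> typical n t J (J - j) 0)"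
  define I where "I = (SIGMA J:{..<K} \<union> {K..n}. {..J} \<times> kinds J)"
  have AB: "\<A> \<subseteq> Pow {1..n}" "\<B> \<subseteq> Pow {1..n}" using nice by (auto simp: nice_def)
  have "mu n p \<A> * mu n p \<B> \<le> (\<Sum>i\<in>I. mu n p (P i) * mu n p (Q i))"
  proof (rule mu_product_cover[OF p01 _ AB])
    show "finite I" by (auto simp: I_def kinds_def)
    show "P i \<subseteq> Pow {1..n}" "Q i \<subseteq> Pow {1..n}" for i
      using AB threshold_subset_Pow atypical_subset_Pow by (cases i; auto simp: P_def Q_def)+
    fix F G assume FG: "F \<in> \<A>" "G \<in> \<B>"
    then obtain k where k: "k \<le> n" "t + gaps k F + gaps k G \<le> k" using frankl_walk_lemma[OF nice] by blast
    then obtain J where J: "k = t + J" by (metis add.assoc le_Suc_ex)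
    define j where "j = gaps k F"
    have T: "F \<in> ?T J j" "G \<in> ?T J (J - j)" "j \<le> J"
      using FG AB k J by (auto simp: threshold_family_def j_def)
    show "\<exists>i\<in>I. F \<in> P i \<and> G \<in> Q i"
    proof (cases "J < K")
      case False
      thus ?thesis using T k J by (intro bexI[of _ "(J, j, 0)"]) (auto simp: P_def Q_def I_def kinds_def)
    next
      case True
      consider "F \<in> atypical n t J j" | "G \<in> atypical n t J (J - j)"
        | "F \<in> typical n t J j 0" "G \<in> typical n t J (J - j) 0"
        using T by (auto simp: atypical_def)
      thus ?thesis
      proof cases
        case 1
        thus ?thesis using T True by (intro bexI[of _ "(J, j, 1)"]) (auto simp: P_def Q_def I_def kinds_def)
      next
        case 2
        thus ?thesis using T True by (intro bexI[of _ "(J, j, 2)"]) (auto simp: P_def Q_def I_def kinds_def)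
      next
        case 3
        thus ?thesis using T True FG by (intro bexI[of _ "(J, j, 3)"]) (auto simp: P_def Q_def I_def kinds_def)
      qed
    qed
  qed
  also have "\<dots> = (\<Sum>J\<in>{..<K} \<union> {K..n}. \<Sum>j\<le>J. \<Sum>c\<in>kinds J. mu n p (P (J, j, c)) * mu n p (Q (J, j, c)))"
  proof -
    have "finite (kinds J)" for J by (simp add: kinds_def)
    thus ?thesis unfolding I_def by (simp add: sum.cartesian_product sum.Sigma split_def)
  qed
  also have "\<dots> = (\<Sum>J<K. \<Sum>j\<le>J. \<Sum>c\<in>kinds J. mu n p (P (J, j, c)) * mu n p (Q (J, j, c))) +
    (\<Sum>J=K..n. \<Sum>j\<le>J. \<Sum>c\<in>kinds J. mu n p (P (J, j, c)) * mu n p (Q (J, j, c)))"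
    by (rule sum.union_disjoint) auto
  finally have main: "mu n p \<A> * mu n p \<B> \<le>
    (\<Sum>J<K. \<Sum>j\<le>J. \<Sum>c\<in>kinds J. mu n p (P (J, j, c)) * mu n p (Q (J, j, c))) +
    (\<Sum>J=K..n. \<Sum>j\<le>J. \<Sum>c\<in>kinds J. mu n p (P (J, j, c)) * mu n p (Q (J, j, c)))" .
  have large: "(\<Sum>J=K..n. \<Sum>j\<le>J. \<Sum>c\<in>kinds J. mu n p (P (J, j, c)) * mu n p (Q (J, j, c)))
    \<le> p ^ (2 * t) * (\<Sum>J=K..n. (4 * R) ^ J / fact J + (1 / 2) ^ J)"
    unfolding sum_distrib_left
  proof (rule sum_mono)
    fix J assume "J \<in> {K..n}"
    hence "kinds J = {0}" by (simp add: kinds_def)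
    thus "(\<Sum>j\<le>J. \<Sum>c\<in>kinds J. mu n p (P (J, j, c)) * mu n p (Q (J, j, c)))
      \<le> p ^ (2 * t) * ((4 * R) ^ J / fact J + (1 / 2) ^ J)"
      using pair_mu_threshold_sum_le[OF p01(1) p(2-4)] by (simp add: P_def Q_def)
  qed
  define h where "h J j = mu n p (\<A> \<inter> typical n t J j 0) * mu n p (\<B> \<inter> typical n t J (J - j) 0)" for J j
  have atyp: "mu n p (atypical n t J j) * mu n p (?T J (J - j)) \<le> ?D" if "J < K" "j \<le> J" for J j
  proof -
    have Jp: "real J * p \<le> 1" using J1 that p by (meson less_imp_le mult_right_mono of_nat_le_iff order_trans)
    have "p ^ J * (mu n p (atypical n t J j) * mu n p (?T J (J - j))) =
      (p ^ j * mu n p (atypical n t J j)) * (p ^ (J - j) * mu n p (?T J (J - j)))"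
      using that by (simp add: power_add[symmetric] mult_ac)
    also have "\<dots> \<le> ((real J + 17) * ?C * p * p ^ (t + J - j)) * (?C * p ^ (t + J - (J - j)))"
      using p01 p Jp that C0
      by (intro mult_mono weighted_mu_atypical_le weighted_mu_threshold_le) (auto intro!: mu_nonneg mult_nonneg_nonneg)
    also have "\<dots> = ((real J + 17) * ?C\<^sup>2 * p) * (p ^ (t + J - j) * p ^ (t + J - (J - j)))"
      by (simp add: power2_eq_square mult_ac)
    also have "p ^ (t + J - j) * p ^ (t + J - (J - j)) = p ^ J * p ^ (2 * t)"
      unfolding power_add[symmetric] using that by (intro arg_cong[of _ _ "power p"]) simp
    also have "((real J + 17) * ?C\<^sup>2 * p) * (p ^ J * p ^ (2 * t)) \<le> ((real K + 17) * ?C\<^sup>2 * p) * (p ^ J * p ^ (2 * t))"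
      using that p01 by (intro mult_right_mono) auto
    also have "\<dots> = p ^ J * ?D" by (simp add: mult_ac)
    finally show ?thesis using p by (simp add: mult_le_cancel_left_pos)
  qed
  have "(\<Sum>J<K. \<Sum>j\<le>J. \<Sum>c\<in>kinds J. mu n p (P (J, j, c)) * mu n p (Q (J, j, c)))
    \<le> (\<Sum>J<K. \<Sum>j\<le>J. 2 * ?D + h J j)"
  proof (intro sum_mono)
    fix J j assume "J \<in> {..<K}" "j \<in> {..J}"
    hence Jj: "J < K" "j \<le> J" by auto
    have "(\<Sum>c\<in>kinds J. mu n p (P (J, j, c)) * mu n p (Q (J, j, c))) =
      mu n p (atypical n t J j) * mu n p (?T J (J - j)) + mu n p (?T J j) * mu n p (atypical n t J (J - j)) + h J j"
      using Jj by (simp add: kinds_def P_def Q_def h_def)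
    thus "(\<Sum>c\<in>kinds J. mu n p (P (J, j, c)) * mu n p (Q (J, j, c))) \<le> 2 * ?D + h J j"
      using atyp[of J j] atyp[of J "J - j"] Jj by (simp add: mult.commute)
  qed
  also have "\<dots> = (\<Sum>J<K. (1 + real J) * (2 * ?D)) + (\<Sum>J<K. \<Sum>j\<le>J. h J j)"
    by (simp add: sum.distrib)
  also have "(\<Sum>J<K. (1 + real J) * (2 * ?D)) \<le> (\<Sum>J<K. real K * (2 * ?D))"
    using p01 by (intro sum_mono mult_right_mono) auto
  also have "\<dots> = p ^ (2 * t) * (2 * real K * real K * (real K + 17) * ?C\<^sup>2 * p)" by (simp add: mult_ac)
  finally have small: "(\<Sum>J<K. \<Sum>j\<le>J. \<Sum>c\<in>kinds J. mu n p (P (J, j, c)) * mu n p (Q (J, j, c)))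
    \<le> p ^ (2 * t) * (2 * real K * real K * (real K + 17) * ?C\<^sup>2 * p) + (\<Sum>J<K. \<Sum>j\<le>J. h J j)" by simp
  have "\<exists>j j'. (\<Sum>J<K. \<Sum>j\<le>J. h J j) \<le> h (j + j') j"
  proof (cases "\<exists>J j. j \<le> J \<and> h J j \<noteq> 0")
    case False
    hence "(\<Sum>J<K. \<Sum>j\<le>J. h J j) = 0" by (intro sum.neutral) auto
    thus ?thesis using mu_nonneg[OF p01] by (intro exI[of _ 0]) (simp add: h_def)
  next
    case True
    then obtain J0 j0 where 0: "j0 \<le> J0" "h J0 j0 \<noteq> 0" by auto
    have uniq: "J = J0 \<and> j = j0" if "j \<le> J" "h J j \<noteq> 0" for J j
    proof -
      have ne: "\<A> \<inter> typical n t (j + (J - j)) j 0 \<noteq> {} \<and> \<B> \<inter> typical n t (j + (J - j)) (J - j) 0 \<noteq> {}"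
        if "j \<le> J" "h J j \<noteq> 0" for J j
        using that by (auto simp: h_def mu_def)
      from typical_pair_unique[OF nice] ne[OF 0] ne[OF that] have "j = j0 \<and> J - j = J0 - j0" by metis
      thus ?thesis using 0 that by auto
    qed
    have "(\<Sum>J<K. \<Sum>j\<le>J. h J j) = (\<Sum>x\<in>(SIGMA J:{..<K}. {..J}). h (fst x) (snd x))"
      by (simp add: sum.Sigma case_prod_beta)
    also have "\<dots> \<le> (\<Sum>x\<in>insert (J0, j0) (SIGMA J:{..<K}. {..J}). h (fst x) (snd x))"
      using mu_nonneg[OF p01] by (intro sum_mono2) (auto simp: h_def)
    also have "\<dots> = (\<Sum>x\<in>{(J0, j0)}. h (fst x) (snd x))"
    proof (rule sum.mono_neutral_right)
      show "\<forall>x\<in>insert (J0, j0) (SIGMA J:{..<K}. {..J}) - {(J0, j0)}. h (fst x) (snd x) = 0"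
      proof
        fix x assume x: "x \<in> insert (J0, j0) (SIGMA J:{..<K}. {..J}) - {(J0, j0)}"
        hence "snd x \<le> fst x" "x \<noteq> (J0, j0)" by auto
        with uniq[of "snd x" "fst x"] show "h (fst x) (snd x) = 0" by (cases x) fastforce
      qed
    qed auto
    also have "\<dots> = h (j0 + (J0 - j0)) j0" using 0 by simp
    finally show ?thesis by blast
  qed
  then obtain j j' where "(\<Sum>J<K. \<Sum>j\<le>J. h J j) \<le> h (j + j') j" by blast
  hence "mu n p \<A> * mu n p \<B> \<le>
    p ^ (2 * t) * ((\<Sum>J=K..n. (4 * R) ^ J / fact J + (1 / 2) ^ J) +
      2 * real K * real K * (real K + 17) * ?C\<^sup>2 * p) + h (j + j') j"
    using main small large by (simp add: algebra_simps)
  thus ?thesis unfolding h_def by auto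
qed

section \<open>Poisson weights\<close>

text \<open>Membership in \<open>R_ex r\<close> up to order; exchanging the components corresponds to exchanging the families.\<close>
definition near_mode :: "nat \<Rightarrow> nat \<Rightarrow> nat \<Rightarrow> bool" where
  "near_mode r j j' \<longleftrightarrow> (j, j') \<in> R_ex r \<or> (j', j) \<in> R_ex r"

lemma not_near_mode_cases:
  assumes "\<not> near_mode r j j'"
  shows "(r + 2 \<le> j \<or> j + 2 \<le> r) \<or> (r + 2 \<le> j' \<or> j' + 2 \<le> r) \<or>
    (1 \<le> r \<and> ((j = r + 1 \<and> j' = r - 1) \<or> (j = r - 1 \<and> j' = r + 1)))"
proof (cases r)
  case 0
  with assms show ?thesis by (simp add: near_mode_def R_ex_def) linarith
next
  case (Suc d)
  show ?thesis
  proof (rule ccontr)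
    assume n: "\<not> ?thesis"
    have "j = d \<or> j = Suc d \<or> j = Suc (Suc d)" "j' = d \<or> j' = Suc d \<or> j' = Suc (Suc d)"
      using n Suc by linarith+
    with assms n Suc show False by (elim disjE) (simp_all add: near_mode_def R_ex_def)
  qed
qed

lemma near_mode_le: "near_mode r j j' \<Longrightarrow> j \<le> r + 1 \<and> j' \<le> r + 1"
  by (auto simp: near_mode_def R_ex_def split: if_splits)

text \<open>For \<open>c\<close> between \<open>r\<close> and \<open>r + 1\<close> the weights \<open>c ^ j / fact j\<close> increase up to \<open>j = r\<close> and decrease from
there on. Here \<open>c\<close> may be slightly smaller than \<open>r\<close>, which is compensated by powers of \<open>L\<close>.\<close>
context
  fixes c L :: real and r :: nat
  assumes c: "0 < c" "c \<le> real r + 1" and L: "1 \<le> L" "real r \<le> L * c"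
begin

lemma poisson_weight_Suc: "c ^ Suc j / fact (Suc j) = c / real (Suc j) * (c ^ j / fact j)"
  by (simp add: field_simps)

lemma poisson_weight_decreasing:
  assumes "r \<le> i" "i \<le> j" shows "c ^ j / fact j \<le> c ^ i / fact i"
  using assms(2)
proof (induction j rule: dec_induct)
  case (step j)
  have "c ^ Suc j / fact (Suc j) \<le> 1 * (c ^ j / fact j)"
    unfolding poisson_weight_Suc using c step assms(1) by (intro mult_right_mono) auto
  thus ?case using step by simp
qed simp

lemma poisson_weight_above:
  assumes "r + 2 \<le> j" shows "c ^ j / fact j \<le> (real r + 1) / (real r + 2) * (c ^ r / fact r)"
proof -
  have "c ^ j / fact j \<le> c ^ (r + 2) / fact (r + 2)" by (rule poisson_weight_decreasing) (use assms in auto)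
  also have "\<dots> = c / (real r + 2) * (c ^ Suc r / fact (Suc r))"
    using poisson_weight_Suc[of "Suc r"] by (simp add: numeral_2_eq_2 add_ac)
  also have "\<dots> \<le> (real r + 1) / (real r + 2) * (c ^ r / fact r)"
    using c by (intro mult_mono poisson_weight_decreasing divide_right_mono) auto
  finally show ?thesis .
qed

lemma poisson_weight_increasing:
  assumes "i \<le> r" shows "c ^ i / fact i \<le> L ^ (r - i) * (c ^ r / fact r)"
proof -
  have "c ^ (r - d) / fact (r - d) \<le> L ^ d * (c ^ r / fact r)" if "d \<le> r" for d
    using that
  proof (induction d)
    case (Suc d)
    let ?i = "r - Suc d"
    have i: "Suc ?i = r - d" using Suc.prems by simp
    have "real (Suc ?i) \<le> L * c" using L Suc.prems by linarith
    hence "1 \<le> L * (c / real (Suc ?i))" using c by (simp add: field_simps)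
    hence "1 * (c ^ ?i / fact ?i) \<le> L * (c / real (Suc ?i)) * (c ^ ?i / fact ?i)"
      using c by (intro mult_right_mono) auto
    also have "\<dots> = L * (c ^ (r - d) / fact (r - d))" using poisson_weight_Suc[of ?i] i by simp
    also have "\<dots> \<le> L * (L ^ d * (c ^ r / fact r))" using Suc L by (intro mult_left_mono) auto
    finally show ?case by (simp add: mult_ac)
  qed simp
  from this[of "r - i"] assms show ?thesis by simp
qed

lemma poisson_weight_le_mode: "c ^ j / fact j \<le> L ^ r * (c ^ r / fact r)"
proof (cases "r \<le> j")
  case True
  have "1 * (c ^ r / fact r) \<le> L ^ r * (c ^ r / fact r)"
    using L c by (intro mult_right_mono one_le_power) auto
  thus ?thesis using poisson_weight_decreasing[OF order_refl True] by simp
next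
  case False
  have "L ^ (r - j) * (c ^ r / fact r) \<le> L ^ r * (c ^ r / fact r)"
    using L c by (intro mult_right_mono power_increasing) auto
  thus ?thesis using poisson_weight_increasing[of j] False by simp
qed

lemma poisson_weight_far:
  assumes "r + 2 \<le> j \<or> j + 2 \<le> r"
  shows "c ^ j / fact j \<le> L ^ r * ((real r + 1) / (real r + 2)) * (c ^ r / fact r)"
  using assms
proof
  assume "r + 2 \<le> j"
  hence "c ^ j / fact j \<le> (real r + 1) / (real r + 2) * (c ^ r / fact r)" by (rule poisson_weight_above)
  also have "\<dots> = 1 * ((real r + 1) / (real r + 2) * (c ^ r / fact r))" by simp
  also have "\<dots> \<le> L ^ r * ((real r + 1) / (real r + 2) * (c ^ r / fact r))"
    using L c by (intro mult_right_mono one_le_power) auto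
  finally show ?thesis by (simp add: mult_ac)
next
  assume j: "j + 2 \<le> r"
  have w: "c ^ j / fact j = real (Suc j) / c * (c ^ Suc j / fact (Suc j))"
    unfolding poisson_weight_Suc using c by simp
  have "real (Suc j) \<le> (real r + 1) / (real r + 2) * real r"
  proof -
    have "(real r - 1) * (real r + 2) \<le> (real r + 1) * real r" by (simp add: algebra_simps)
    hence "real r - 1 \<le> (real r + 1) / (real r + 2) * real r" by (simp add: field_simps)
    thus ?thesis using j by linarith
  qed
  also have "\<dots> \<le> (real r + 1) / (real r + 2) * (L * c)" using L by (intro mult_left_mono) auto
  finally have "real (Suc j) / c \<le> (real r + 1) / (real r + 2) * L"
    using c by (simp add: pos_divide_le_eq mult_ac)
  hence "c ^ j / fact j \<le> (real r + 1) / (real r + 2) * L * (L ^ (r - Suc j) * (c ^ r / fact r))"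
    unfolding w using j L c by (intro mult_mono poisson_weight_increasing) auto
  also have "\<dots> = L ^ (r - j) * ((real r + 1) / (real r + 2) * (c ^ r / fact r))"
  proof -
    have "r - j = Suc (r - Suc j)" using j by simp
    thus ?thesis by (simp add: mult_ac)
  qed
  also have "\<dots> \<le> L ^ r * ((real r + 1) / (real r + 2) * (c ^ r / fact r))"
    using L c by (intro mult_right_mono power_increasing) auto
  finally show ?thesis by (simp add: mult_ac)
qed

text \<open>If one of the indices has distance at least two from \<open>r\<close>, its weight alone is small enough. The only
other case is \<open>{r - 1, r + 1}\<close>, where the product of the weights is \<open>r / (r + 1)\<close> times the square of
the weight at \<open>r\<close>.\<close>
lemma poisson_pair_not_near_mode:
  assumes "\<not> near_mode r j j'"
  shows "(c ^ j / fact j) * (c ^ j' / fact j') \<le> L ^ (2 * r) * ((real r + 1) / (real r + 2)) * (c ^ r / fact r)\<^sup>2"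
proof -
  define \<phi> where "\<phi> i = c ^ i / fact i" for i
  let ?q = "(real r + 1) / (real r + 2)"
  have pos: "0 < \<phi> i" for i using c by (simp add: \<phi>_def)
  have mode: "\<phi> i \<le> L ^ r * \<phi> r" for i unfolding \<phi>_def by (rule poisson_weight_le_mode)
  have far: "\<phi> i * \<phi> i' \<le> L ^ (2 * r) * ?q * (\<phi> r)\<^sup>2" if "r + 2 \<le> i \<or> i + 2 \<le> r" for i i'
  proof -
    have "\<phi> i \<le> L ^ r * ?q * \<phi> r" unfolding \<phi>_def by (rule poisson_weight_far[OF that])
    hence "\<phi> i * \<phi> i' \<le> (L ^ r * ?q * \<phi> r) * (L ^ r * \<phi> r)"
      using mode[of i'] pos L by (intro mult_mono) (auto intro: less_imp_le)
    also have "\<dots> = L ^ (2 * r) * ?q * (\<phi> r)\<^sup>2" by (simp add: power2_eq_square power_mult mult_2 power_add mult_ac)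
    finally show ?thesis .
  qed
  have mid: "\<phi> (r + 1) * \<phi> (r - 1) \<le> L ^ (2 * r) * ?q * (\<phi> r)\<^sup>2" if r1: "1 \<le> r"
  proof -
    obtain d where d: "r = Suc d" using r1 by (cases r) auto
    have e: "\<phi> (r + 1) = c / (real r + 1) * \<phi> r" "\<phi> r = c / real r * \<phi> (r - 1)"
      using poisson_weight_Suc[of r] poisson_weight_Suc[of d] by (simp_all add: \<phi>_def d add_ac)
    have e': "\<phi> (r - 1) = real r / c * \<phi> r" unfolding e(2) using c r1 by simp
    have "\<phi> (r + 1) * \<phi> (r - 1) = real r / (real r + 1) * (\<phi> r)\<^sup>2"
      unfolding e(1) e' using c by (simp add: power2_eq_square)
    also have "\<dots> \<le> ?q * (\<phi> r)\<^sup>2"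
      by (intro mult_right_mono) (auto simp: field_simps)
    also have "\<dots> = 1 * (?q * (\<phi> r)\<^sup>2)" by simp
    also have "\<dots> \<le> L ^ (2 * r) * (?q * (\<phi> r)\<^sup>2)"
      using L by (intro mult_right_mono one_le_power) auto
    finally show ?thesis by (simp add: mult_ac)
  qed
  have "\<phi> j * \<phi> j' \<le> L ^ (2 * r) * ?q * (\<phi> r)\<^sup>2"
    using not_near_mode_cases[OF assms] far[of j j'] far[of j' j] mid
    by (metis mult.commute)
  thus ?thesis unfolding \<phi>_def .
qed

end

section \<open>The index pair of a large product\<close>

lemma weighted_mu_typical_le:
  fixes p :: real
  assumes "0 \<le> p" "p \<le> 1"
  shows "p ^ s * mu n p (typical n t m s Q) \<le> (real t * p) ^ s / fact s * p ^ (t + m - s)"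
proof (cases "s \<le> t")
  case True
  have "p ^ s * mu n p (typical n t m s Q) \<le> p ^ s * (real (t choose s) * p ^ (t + m - s))"
    using assms True by (intro mult_left_mono mu_typical_le) auto
  also have "\<dots> = (real (t choose s) * p ^ s) * p ^ (t + m - s)" by (simp add: mult_ac)
  also have "\<dots> \<le> (real t * p) ^ s / fact s * p ^ (t + m - s)"
    using assms by (intro mult_right_mono binomial_power_le) auto
  finally show ?thesis .
next
  case False
  have "typical n t m s Q = {}" using False gaps_le[of t] by (fastforce simp: typical_def)
  thus ?thesis using assms by (simp add: mu_def)
qed

text \<open>The powers of \<open>p\<close> combine to \<open>p ^ (2 * t)\<close> because the common length of the prefix is the sum of the
two gap numbers.\<close>
lemma mu_typical_pair_le:
  fixes p :: real
  assumes "0 < p" "p \<le> 1" 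
  shows "mu n p (typical n t (j + j') j Q) * mu n p (typical n t (j + j') j' Q') \<le>
    p ^ (2 * t) * ((real t * p) ^ j / fact j * ((real t * p) ^ j' / fact j'))"
proof -
  have p0: "0 \<le> p" using assms by simp
  have "p ^ (j + j') * (mu n p (typical n t (j + j') j Q) * mu n p (typical n t (j + j') j' Q')) =
    (p ^ j * mu n p (typical n t (j + j') j Q)) * (p ^ j' * mu n p (typical n t (j + j') j' Q'))"
    by (simp add: power_add mult_ac)
  also have "\<dots> \<le> ((real t * p) ^ j / fact j * p ^ (t + (j + j') - j)) *
      ((real t * p) ^ j' / fact j' * p ^ (t + (j + j') - j'))"
    using p0 assms by (intro mult_mono weighted_mu_typical_le) (auto intro!: mult_nonneg_nonneg mu_nonneg)
  also have "\<dots> = p ^ (j + j') * (p ^ (2 * t) * ((real t * p) ^ j / fact j * ((real t * p) ^ j' / fact j')))"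
    unfolding mult_2 power_add by (simp add: power_add mult_ac)
  finally show ?thesis by (rule mult_left_le_imp_le) (use assms in simp)
qed

lemma mu_frankl_ge:
  fixes p :: real
  assumes "0 < p" "p \<le> 1" "r \<le> t" "t + 2 * r \<le> n" "0 < t"
  shows "p ^ t * ((1 - real r / real t) ^ r * (1 - p) ^ r * ((real t * p) ^ r / fact r)) \<le> mu n p (frankl n t r)"
proof -
  have p0: "0 \<le> p" using assms by simp
  have "(real t - real r) ^ r / fact r \<le> real (t choose r)"
    using binomial_lower_power[OF assms(3)] by (simp add: pos_divide_le_eq mult.commute)
  hence "(real t - real r) ^ r / fact r * (p ^ (t - r) * (1 - p) ^ r * p ^ (2 * r)) \<le>
    real (t choose r) * (p ^ (t - r) * (1 - p) ^ r * p ^ (2 * r))"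
    using assms by (intro mult_right_mono) auto
  also have "\<dots> = real (t choose r) * (p ^ (t - r) * (1 - p) ^ r) * p ^ (2 * r)" by simp
  also have "\<dots> \<le> mu n p (threshold_family n (t + 2 * r) r)"
    by (rule mu_threshold_ge[OF p0 assms(2-4)])
  finally have 1: "(real t - real r) ^ r / fact r * (p ^ (t - r) * (1 - p) ^ r * p ^ (2 * r))
    \<le> mu n p (frankl n t r)" by (simp add: frankl_eq_threshold)
  have "real t - real r = (1 - real r / real t) * real t" using assms by (simp add: field_simps)
  hence e1: "(real t - real r) ^ r = (1 - real r / real t) ^ r * real t ^ r" by (simp add: power_mult_distrib)
  have e2: "p ^ t * p ^ r = p ^ (t - r) * p ^ (2 * r)"
    unfolding power_add[symmetric] using assms by (intro arg_cong[of _ _ "power p"]) simp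
  have "p ^ t * ((1 - real r / real t) ^ r * (1 - p) ^ r * ((real t * p) ^ r / fact r)) =
    (1 - real r / real t) ^ r * real t ^ r / fact r * (1 - p) ^ r * (p ^ t * p ^ r)"
    by (simp add: power_mult_distrib mult_ac)
  also have "\<dots> = (real t - real r) ^ r / fact r * (p ^ (t - r) * (1 - p) ^ r * p ^ (2 * r))"
    unfolding e1 e2 by (simp only: mult_ac)
  also note 1
  finally show ?thesis .
qed

lemma tail_sums_small:
  assumes "0 < \<eta>" 
  shows "\<exists>K\<ge>1. \<forall>n. (\<Sum>J=K..n. (4 * R) ^ J / fact J + (1 / 2) ^ J) \<le> (\<eta> :: real)"
proof -
  let ?b = "\<lambda>J. (4 * R) ^ J / fact J + (1 / 2 :: real) ^ J"
  have "summable ?b"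
  proof (rule summable_add)
    show "summable (\<lambda>J. (4 * R) ^ J / fact J)"
      using summable_exp[of "4 * R"] by (simp only: divide_inverse mult.commute[of "inverse _"])
  qed (simp add: summable_geometric)
  then obtain K where K: "\<And>m n. K \<le> m \<Longrightarrow> norm (sum ?b {m..<n}) < \<eta>"
    using assms unfolding summable_Cauchy by blast
  have "sum ?b {Suc K..n} \<le> \<eta>" for n
    using K[of "Suc K" "Suc n"] by (simp add: atLeastLessThanSuc_atLeastAtMost del: sum.op_ivl_Suc)
  thus ?thesis by (intro exI[of _ "Suc K"]) auto
qed

text \<open>A common form of the two ranges of parameters. As \<open>c\<^sub>0\<close> is fixed, \<open>t\<close> is of order \<open>1 / p\<close>, so that all
error terms can be expressed by \<open>p\<close>. The third condition says that \<open>t * p\<close> is at least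
\<open>r\<close> up to a relative error \<open>O(p)\<close>.\<close>
definition regime :: "nat \<Rightarrow> real \<Rightarrow> real \<Rightarrow> nat \<Rightarrow> nat \<Rightarrow> bool" where
  "regime r c\<^sub>0 p t n \<longleftrightarrow> c\<^sub>0 \<le> real t * p \<and> real t * p \<le> real r + 1 \<and>
     real r \<le> p * (real t + 2 * real r) \<and> t + 2 * r \<le> n"

lemma regime_mode_bound:
  assumes "regime r c\<^sub>0 p t n" "0 < p" "0 < c\<^sub>0"
  shows "real r \<le> (1 + 2 * real r * p / c\<^sub>0) * (real t * p)"
proof -
  have "2 * real r * p / c\<^sub>0 * c\<^sub>0 \<le> 2 * real r * p / c\<^sub>0 * (real t * p)"
    using assms by (intro mult_left_mono) (auto simp: regime_def)
  thus ?thesis using assms by (simp add: regime_def algebra_simps)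
qed

lemma eventually_small: "0 < a \<Longrightarrow> \<forall>\<^sub>F p in at_right (0::real). 0 < p \<and> p < a"
  by (auto simp: eventually_at_right_field)

text \<open>The masses of the two families of typical sets multiply to \<open>p ^ (2 * t)\<close> times a product of Poisson
weights, which is the order of the square of the measure of the Frankl family. Hence the error term of the concentration bound is negligible, the single pair
of typical parts carries nearly all of the product, and its Poisson weights must be nearly maximal.\<close>
lemma large_product_concentrates:
  fixes r :: nat and c\<^sub>0 \<delta> \<zeta> :: real
  assumes "0 < c\<^sub>0" "0 < \<delta>" "0 < \<zeta>" "\<delta> + \<zeta> < 1 / (real r + 2)"
  shows "\<forall>\<^sub>F p in at_right 0. \<forall>t n \<A> \<B>. regime r c\<^sub>0 p t n \<and> nice n t \<A> \<B> \<and>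
    (1 - \<delta>) * (mu n p (frankl n t r))\<^sup>2 \<le> mu n p \<A> * mu n p \<B> \<longrightarrow>
    (\<exists>j j'. near_mode r j j' \<and>
      (1 - \<delta> - \<zeta>) * (p ^ t * ((real t * p) ^ r / fact r))\<^sup>2 \<le>
      mu n p (\<A> \<inter> typical n t (j + j') j 0) * mu n p (\<B> \<inter> typical n t (j + j') j' 0))"
proof -
  define \<phi>0 where "\<phi>0 = c\<^sub>0 ^ r / fact r"
  define R where "R = real r + 1"
  have \<phi>0: "0 < \<phi>0" using assms by (simp add: \<phi>0_def)
  obtain K where K: "1 \<le> K" "\<And>n. (\<Sum>J=K..n. (4 * R) ^ J / fact J + (1 / 2) ^ J) \<le> \<zeta> / 4 * \<phi>0\<^sup>2"
    using tail_sums_small[of "\<zeta> / 4 * \<phi>0\<^sup>2" R] assms \<phi>0 by auto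
  define D where "D = 2 * real K * real K * (real K + 17) * (binomial_bound R)\<^sup>2"
  have e1: "\<forall>\<^sub>F p in at_right 0. 1 - \<delta> - \<zeta> / 2 < (1 - \<delta>) * ((1 - real r * p / c\<^sub>0) ^ r * (1 - p) ^ r)\<^sup>2"
    by (rule order_tendstoD(1)[where y = "1 - \<delta>"])
       (use assms in \<open>auto intro!: tendsto_eq_intros\<close>)
  have e2: "\<forall>\<^sub>F p in at_right 0.
    (1 + 2 * real r * p / c\<^sub>0) ^ (2 * r) * ((real r + 1) / (real r + 2)) < 1 - \<delta> - \<zeta>"
  proof (rule order_tendstoD(2))
    show "((\<lambda>p. (1 + 2 * real r * p / c\<^sub>0) ^ (2 * r) * ((real r + 1) / (real r + 2))) \<longlongrightarrow>
      (real r + 1) / (real r + 2)) (at_right 0)"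
      using assms by (auto intro!: tendsto_eq_intros)
    have "(real r + 1) / (real r + 2) = 1 - 1 / (real r + 2)" by (simp add: field_simps)
    thus "(real r + 1) / (real r + 2) < 1 - \<delta> - \<zeta>" using assms(4) by simp
  qed
  have e3: "\<forall>\<^sub>F p in at_right 0. D * p < \<zeta> / 4 * \<phi>0\<^sup>2"
    by (rule order_tendstoD(2)[where y = 0])
       (use assms \<phi>0 in \<open>auto intro!: tendsto_eq_intros\<close>)
  have e4: "\<forall>\<^sub>F p in at_right 0. 0 < p \<and> p < min (min (1 / 36) (1 / real K)) (c\<^sub>0 / (real r + 1))"
    using K assms by (intro eventually_small) auto
  show ?thesis
    using e1 e2 e3 e4
  proof eventually_elim
    case (elim p)
    have p: "0 < p" "36 * p \<le> 1" "p \<le> 1" "real K * p \<le> 1" "p * (real r + 1) \<le> c\<^sub>0"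
      using elim(4) K by (auto simp: field_simps)
    show ?case
    proof (intro allI impI, elim conjE)
      fix t n \<A> \<B>
      assume reg: "regime r c\<^sub>0 p t n" and nice: "nice n t \<A> \<B>"
        and big: "(1 - \<delta>) * (mu n p (frankl n t r))\<^sup>2 \<le> mu n p \<A> * mu n p \<B>"
      define \<phi> where "\<phi> i = (real t * p) ^ i / fact i" for i
      have c: "c\<^sub>0 \<le> real t * p" "real t * p \<le> real r + 1" "t + 2 * r \<le> n"
        using reg by (auto simp: regime_def)
      have "p * (real r + 1) \<le> p * real t" using c(1) p(5) by (simp add: mult.commute)
      hence tr: "real r + 1 \<le> real t" using p(1) by (simp add: mult_le_cancel_left_pos)
      hence t: "r \<le> t" "0 < t" "1 \<le> t" by linarith+
      have \<phi>r: "\<phi>0 \<le> \<phi> r" unfolding \<phi>_def \<phi>0_def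
        using c assms by (intro divide_right_mono power_mono) auto
      obtain j j' where jj: "mu n p \<A> * mu n p \<B> \<le>
        p ^ (2 * t) * ((\<Sum>J=K..n. (4 * R) ^ J / fact J + (1 / 2) ^ J) + D * p) +
        mu n p (\<A> \<inter> typical n t (j + j') j 0) * mu n p (\<B> \<inter> typical n t (j + j') j' 0)"
        using product_concentrates[OF nice p(1,2) _ _ t(3) p(4) K(1), of R] c(2)
        unfolding D_def R_def by auto
      define h where "h = mu n p (\<A> \<inter> typical n t (j + j') j 0) * mu n p (\<B> \<inter> typical n t (j + j') j' 0)"
      define x where "x = (1 - real r / real t) ^ r * (1 - p) ^ r"
      have "real r / real t \<le> real r * p / c\<^sub>0"
      proof -
        have "real r * c\<^sub>0 \<le> real r * (real t * p)" using c(1) by (intro mult_left_mono) auto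
        thus ?thesis using t assms(1) by (simp add: field_simps)
      qed
      moreover have "real r * p / c\<^sub>0 \<le> 1"
        using p assms(1) by (simp add: field_simps)
      ultimately have x: "(1 - real r * p / c\<^sub>0) ^ r * (1 - p) ^ r \<le> x"
        "0 \<le> (1 - real r * p / c\<^sub>0) ^ r * (1 - p) ^ r"
        unfolding x_def using p by (auto intro!: mult_mono power_mono mult_nonneg_nonneg zero_le_power)
      have \<delta>1: "\<delta> + \<zeta> < 1"
      proof -
        have "1 / (real r + 2) \<le> 1" by simp
        thus ?thesis using assms by linarith
      qed
      have "(1 - \<delta> - \<zeta> / 2) * (p ^ t * \<phi> r)\<^sup>2 \<le> (1 - \<delta>) * ((1 - real r * p / c\<^sub>0) ^ r * (1 - p) ^ r)\<^sup>2 * (p ^ t * \<phi> r)\<^sup>2"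
        using elim(1) by (intro mult_right_mono) auto
      also have "\<dots> \<le> (1 - \<delta>) * x\<^sup>2 * (p ^ t * \<phi> r)\<^sup>2"
        using x \<delta>1 assms by (intro mult_right_mono mult_left_mono power_mono) auto
      also have "\<dots> = (1 - \<delta>) * (p ^ t * (x * \<phi> r))\<^sup>2" by (simp add: power_mult_distrib mult_ac)
      also have "\<dots> \<le> (1 - \<delta>) * (mu n p (frankl n t r))\<^sup>2"
      proof (intro mult_left_mono power_mono)
        show "p ^ t * (x * \<phi> r) \<le> mu n p (frankl n t r)"
          using mu_frankl_ge[OF p(1,3) t(1) c(3) t(2)] by (simp add: x_def \<phi>_def)
        show "0 \<le> p ^ t * (x * \<phi> r)" using x p \<phi>r \<phi>0 by (auto intro!: mult_nonneg_nonneg)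
      qed (use \<delta>1 assms in auto)
      also note big
      also note jj
      also have "p ^ (2 * t) * ((\<Sum>J=K..n. (4 * R) ^ J / fact J + (1 / 2) ^ J) + D * p) \<le>
        p ^ (2 * t) * (\<zeta> / 2 * (\<phi> r)\<^sup>2)"
      proof (rule mult_left_mono)
        have "(\<Sum>J=K..n. (4 * R) ^ J / fact J + (1 / 2) ^ J) + D * p \<le> \<zeta> / 2 * \<phi>0\<^sup>2"
          using K(2)[of n] elim(3) by simp
        also have "\<dots> \<le> \<zeta> / 2 * (\<phi> r)\<^sup>2" using \<phi>r \<phi>0 assms by (intro mult_left_mono power_mono) auto
        finally show "(\<Sum>J=K..n. (4 * R) ^ J / fact J + (1 / 2) ^ J) + D * p \<le> \<zeta> / 2 * (\<phi> r)\<^sup>2" .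
      qed (use p in simp)
      finally have hh: "(1 - \<delta> - \<zeta>) * (p ^ t * \<phi> r)\<^sup>2 \<le> h"
        unfolding h_def by (simp add: algebra_simps power_mult_distrib power_mult)
      have "near_mode r j j'"
      proof (rule ccontr)
        assume nn: "\<not> near_mode r j j'"
        let ?L = "1 + 2 * real r * p / c\<^sub>0"
        have "h \<le> mu n p (typical n t (j + j') j 0) * mu n p (typical n t (j + j') j' 0)"
          unfolding h_def using p by (intro mult_mono mu_mono mu_nonneg typical_subset_Pow) auto
        also have "\<dots> \<le> p ^ (2 * t) * (\<phi> j * \<phi> j')"
          unfolding \<phi>_def by (rule mu_typical_pair_le) (use p in auto)
        also have "\<dots> \<le> p ^ (2 * t) * (?L ^ (2 * r) * ((real r + 1) / (real r + 2)) * (\<phi> r)\<^sup>2)"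
          unfolding \<phi>_def using c p assms nn regime_mode_bound[OF reg]
          by (intro mult_left_mono poisson_pair_not_near_mode) auto
        also have "\<dots> < p ^ (2 * t) * ((1 - \<delta> - \<zeta>) * (\<phi> r)\<^sup>2)"
          using elim(2) p \<phi>r \<phi>0 by (intro mult_strict_left_mono mult_strict_right_mono) auto
        also have "\<dots> = (1 - \<delta> - \<zeta>) * (p ^ t * \<phi> r)\<^sup>2" by (simp add: power_mult_distrib power_mult mult_ac)
        finally show False using hh by simp
      qed
      with hh show "\<exists>j j'. near_mode r j j' \<and>
        (1 - \<delta> - \<zeta>) * (p ^ t * ((real t * p) ^ r / fact r))\<^sup>2 \<le>
        mu n p (\<A> \<inter> typical n t (j + j') j 0) * mu n p (\<B> \<inter> typical n t (j + j') j' 0)"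
        unfolding h_def \<phi>_def by blast
    qed
  qed
qed

section \<open>Gains against losses\<close>

lemma nice_commute: "nice n t \<A> \<B> \<Longrightarrow> nice n t \<B> \<A>"
  unfolding nice_def cross_intersecting_def by (metis Int_commute)

text \<open>Let \<open>Q\<close> be maximal such that every gain has at most \<open>s + q\<close> gaps at some stage \<open>q \<ge> Q\<close>. Some gain
does not do so at any stage beyond \<open>Q\<close>, and this one excludes the typical sets with parameter \<open>Q\<close> from
\<open>\<B>\<close>. Since \<open>\<B>\<close> does contain a generic typical set, \<open>Q\<close> is positive.\<close>
lemma gains_late:
  assumes nice: "nice n t \<A> \<B>" and meets: "\<B> \<inter> typical n t (s + s') s' 0 \<noteq> {}"
    and ne: "\<A> - threshold_family n (t + (s + s')) s \<noteq> {}"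
  shows "\<exists>Q\<ge>1. \<A> - threshold_family n (t + (s + s')) s \<subseteq>
      (\<Union>q\<in>{Q..n}. threshold_family n (t + (s + s') + 3 * q) (s + q)) \<and>
    \<B> \<inter> typical n t (s + s') s' Q = {}"
proof -
  let ?m = "s + s'"
  let ?gain = "\<A> - threshold_family n (t + ?m) s"
  define late where "late Q \<longleftrightarrow> (\<forall>F\<in>?gain. \<exists>q\<ge>Q. gaps (t + ?m + 3 * q) F \<le> s + q)" for Q
  have An: "F \<subseteq> {1..n}" if "F \<in> \<A>" for F using nice that by (auto simp: nice_def)
  have gain: "Suc s \<le> gaps (t + ?m) F" if "F \<in> ?gain" for F
    using that An by (auto simp: threshold_family_def not_le)
  have bounded: "q \<le> n" if F: "F \<in> ?gain" "gaps (t + ?m + 3 * q) F \<le> s + q" for F q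
    using gaps_lower[OF An, of F "t + ?m + 3 * q"] F by simp
  have not_late: "\<B> \<inter> typical n t ?m s' Q = {}" if nl: "\<not> late (Suc Q)" for Q
  proof -
    obtain F where F: "F \<in> ?gain" "\<forall>q\<ge>Suc Q. \<not> gaps (t + ?m + 3 * q) F \<le> s + q"
      using nl unfolding late_def by blast
    have F2: "s + q < gaps (t + ?m + 3 * q) F" if "Q < q" for q using F(2)[rule_format, of q] that by simp
    have "G \<notin> typical n t ?m s' Q" if "G \<in> \<B>" for G
      using gain_excludes_typical[OF nice _ gain[OF F(1)] F2 that] F(1) by blast
    thus ?thesis by blast
  qed
  have "\<not> late (Suc n)"
    using ne bounded unfolding late_def by (metis Suc_n_not_le_n all_not_in_conv le_trans)
  \<comment> \<open>The maximal \<open>Q\<close> with \<open>late Q\<close> is the predecessor of the least failure; it exists as no gap count can stay small beyond \<open>n\<close>.\<close>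
  define Q' where "Q' = (LEAST Q. \<not> late Q)"
  have Q': "\<not> late Q'" unfolding Q'_def using \<open>\<not> late (Suc n)\<close> by (rule LeastI)
  have least: "late Q" if "Q < Q'" for Q using not_less_Least that unfolding Q'_def by blast
  have "late 1" using not_late[of 0] meets by auto
  moreover have "late 0" using \<open>late 1\<close> unfolding late_def by blast
  ultimately have "Q' \<noteq> 0" "Q' \<noteq> 1" using Q' by metis+
  then obtain Q where Q: "Q' = Suc Q" "1 \<le> Q" by (cases Q') auto
  have "late Q" using least Q by simp
  have "?gain \<subseteq> (\<Union>q\<in>{Q..n}. threshold_family n (t + ?m + 3 * q) (s + q))"
  proof (intro subsetI)
    fix F assume F: "F \<in> ?gain"
    then obtain q where q: "Q \<le> q" "gaps (t + ?m + 3 * q) F \<le> s + q"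
      using \<open>late Q\<close> unfolding late_def by blast
    hence "q \<in> {Q..n}" "F \<in> threshold_family n (t + ?m + 3 * q) (s + q)"
      using bounded[OF F q(2)] An F by (simp_all add: threshold_family_def)
    thus "F \<in> (\<Union>q\<in>{Q..n}. threshold_family n (t + ?m + 3 * q) (s + q))" by blast
  qed
  thus ?thesis using not_late[of Q] Q' Q by blast
qed

lemma typical_nonempty_fits:
  assumes "typical n t m s Q \<noteq> {}" "t \<le> n" shows "t + m \<le> n"
proof (cases "m = 0")
  case False
  obtain G where G: "G \<subseteq> {1..n}" "{t<..t + m} \<subseteq> G" using assms by (auto simp: typical_def)
  have "t + m \<in> {t<..t + m}" using False by simp
  hence "t + m \<in> {1..n}" using G by blast
  thus ?thesis by simp
qed (use assms in simp)

text \<open>A positive lower bound on \<open>(t choose s) * p ^ s\<close>, uniform in \<open>s \<le> r + 1\<close>.\<close>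
definition binomial_floor :: "nat \<Rightarrow> real \<Rightarrow> real" where
  "binomial_floor r c\<^sub>0 = (min 1 (c\<^sub>0 / (real r + 1))) ^ (r + 1)"

lemma binomial_floor_pos: "0 < c\<^sub>0 \<Longrightarrow> 0 < binomial_floor r c\<^sub>0"
  by (simp add: binomial_floor_def)

lemma binomial_floor_le:
  fixes p :: real
  assumes "0 < c\<^sub>0" "0 \<le> p" "c\<^sub>0 \<le> real t * p" "s \<le> r + 1" "s \<le> t"
  shows "binomial_floor r c\<^sub>0 \<le> real (t choose s) * p ^ s"
proof (cases "s = 0")
  case True
  have "binomial_floor r c\<^sub>0 \<le> 1" unfolding binomial_floor_def using assms by (intro power_le_one) auto
  thus ?thesis using True by simp
next
  case False
  let ?x = "min 1 (c\<^sub>0 / (real r + 1))"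
  have x0: "0 \<le> ?x" "?x \<le> 1" using assms by auto
  have "binomial_floor r c\<^sub>0 \<le> ?x ^ s"
    unfolding binomial_floor_def using assms x0 by (intro power_decreasing) auto
  also have "\<dots> \<le> (real t * p / real s) ^ s"
  proof (rule power_mono)
    have "c\<^sub>0 / (real r + 1) \<le> real t * p / real s"
      using assms False by (intro frac_le) auto
    thus "?x \<le> real t * p / real s" by linarith
  qed (use x0 in auto)
  also have "\<dots> = (real t / real s) ^ s * p ^ s" by (simp add: power_mult_distrib[symmetric])
  also have "\<dots> \<le> real (t choose s) * p ^ s"
    using binomial_ge_n_over_k_pow_k[OF assms(5)] assms(2) by (intro mult_right_mono) auto
  finally show ?thesis .
qed

text \<open>With \<open>Q\<close> as in \<open>gains_late\<close>, the gains have weighted mass \<open>O(p ^ Q)\<close> by the union bound over the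
stages \<open>q \<ge> Q\<close>. The losses contain all typical sets with parameter \<open>Q\<close>, of weighted mass at least a
constant times \<open>(1 / 8) ^ Q\<close>. As \<open>Q \<ge> 1\<close> and \<open>8 p \<le> 1\<close>, the quotient is \<open>O(p)\<close>.\<close>
lemma gains_le_losses:
  fixes p :: real
  assumes nice: "nice n t \<A> \<B>" and meets: "\<B> \<inter> typical n t (s + s') s' 0 \<noteq> {}"
    and reg: "regime r c\<^sub>0 p t n" and c0: "0 < c\<^sub>0" and s: "s \<le> r + 1" "s' \<le> r + 1" "r + 1 \<le> t"
    and p: "0 < p" "36 * p \<le> 1" "real (2 * r + 2) * p \<le> 1"
  shows "p ^ s / p ^ s' * mu n p (\<A> - threshold_family n (t + (s + s')) s) \<le>
    16 * binomial_bound (real r + 1) * 2 ^ (r + 5) / binomial_floor r c\<^sub>0 * p *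
    (p ^ s' / p ^ s * mu n p (threshold_family n (t + (s + s')) s' - \<B>))"
proof -
  let ?m = "s + s'" and ?C = "binomial_bound (real r + 1)" and ?a = "binomial_floor r c\<^sub>0"
  let ?gain = "\<A> - threshold_family n (t + ?m) s" and ?loss = "threshold_family n (t + ?m) s' - \<B>"
  have p01: "0 \<le> p" "p \<le> 1" using p by auto
  have C0: "0 \<le> ?C" using binomial_bound_ge_1[of "real r + 1"] by simp
  have a0: "0 < ?a" using binomial_floor_pos[OF c0] .
  show ?thesis
  proof (cases "?gain = {}")
    case True
    show ?thesis unfolding True using p01 C0 a0 mu_nonneg[OF p01, of n ?loss] by (simp add: mu_def)
  next
    case False
    obtain Q where Q: "1 \<le> Q" "?gain \<subseteq> (\<Union>q\<in>{Q..n}. threshold_family n (t + ?m + 3 * q) (s + q))"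
      "\<B> \<inter> typical n t ?m s' Q = {}"
      using gains_late[OF nice meets False] by blast
    have mp: "real ?m * p \<le> 1"
    proof -
      have "real ?m \<le> real (2 * r + 2)" using s by linarith
      hence "real ?m * p \<le> real (2 * r + 2) * p" using p01 by (intro mult_right_mono) auto
      thus ?thesis using p by linarith
    qed
    have tn: "t + ?m \<le> n"
      using typical_nonempty_fits[of n t ?m s' 0] meets reg by (auto simp: regime_def)
    have "p ^ s * mu n p ?gain \<le> p ^ s * (\<Sum>q=Q..n. mu n p (threshold_family n (t + ?m + 3 * q) (s + q)))"
      using p01 by (intro mult_left_mono mu_UN_le[OF p01 _ _ Q(2)]) (auto simp: threshold_family_def)
    also have "\<dots> \<le> (\<Sum>q=Q..n. ?C * p ^ (t + s') * p ^ q)"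
      unfolding sum_distrib_left
    proof (rule sum_mono)
      fix q
      have "p ^ s * mu n p (threshold_family n (t + ?m + 3 * q) (s + q)) \<le>
        p ^ s * (real ((t + ?m + 3 * q) choose (s + q)) * p ^ (t + ?m + 3 * q - (s + q)))"
        using p01 by (intro mult_left_mono mu_threshold_le) auto
      also have "t + ?m + 3 * q - (s + q) = t + s' + q + q" by simp
      also have "p ^ s * (real ((t + ?m + 3 * q) choose (s + q)) * p ^ (t + s' + q + q)) =
        (real ((t + ?m + 3 * q) choose (s + q)) * p ^ (s + q)) * (p ^ (t + s') * p ^ q)"
        by (simp add: power_add mult_ac)
      also have "\<dots> \<le> ?C * (p ^ (t + s') * p ^ q)"
        using reg mp p p01 by (intro mult_right_mono binomial_power_bounded[of p t _ ?m]) (auto simp: regime_def)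
      finally show "p ^ s * mu n p (threshold_family n (t + ?m + 3 * q) (s + q)) \<le> ?C * p ^ (t + s') * p ^ q"
        by (simp add: mult_ac)
    qed
    also have "\<dots> = ?C * p ^ (t + s') * (\<Sum>q=Q..n. p ^ q)" by (simp add: sum_distrib_left)
    also have "\<dots> \<le> ?C * p ^ (t + s') * (2 * p ^ Q)"
      using p C0 by (intro mult_left_mono sum_powers_le) auto
    also have "p ^ Q \<le> p * (8 * (1 / 8) ^ Q)"
    proof -
      obtain Q0 where Q0: "Q = Suc Q0" using Q(1) by (cases Q) auto
      have "p ^ Q0 \<le> (1 / 8) ^ Q0" using p by (intro power_mono) auto
      thus ?thesis unfolding Q0 using p by simp
    qed
    finally have gain: "p ^ s * mu n p ?gain \<le> ?C * p ^ (t + s') * (2 * (p * (8 * (1 / 8) ^ Q)))"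
      using C0 p01 by (simp add: mult_left_mono)
    have "typical n t ?m s' Q \<subseteq> ?loss" using Q(3) typical_subset_threshold by blast
    hence "mu n p (typical n t ?m s' Q) \<le> mu n p ?loss"
      by (rule mu_mono[OF p01]) (auto simp: threshold_family_def)
    moreover have "real (t choose s') * (p ^ (t - s') * (1 - p) ^ s') * p ^ ?m * ((1 - p) ^ (3 * Q + 3) / 2)
      \<le> mu n p (typical n t ?m s' Q)"
      using p s tn by (intro mu_typical_ge[OF p01]) auto
    ultimately have loss0: "p ^ s' * (real (t choose s') * (p ^ (t - s') * (1 - p) ^ s') * p ^ ?m * ((1 - p) ^ (3 * Q + 3) / 2))
      \<le> p ^ s' * mu n p ?loss"
      using p01 by (intro mult_left_mono) auto
    have e: "p ^ (t - s') * p ^ ?m = p ^ (t + s)"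
      unfolding power_add[symmetric] using s by (intro arg_cong[of _ _ "power p"]) simp
    have "?a * ((1 / 2) ^ (r + 5) * (1 / 8) ^ Q) * p ^ (t + s) \<le>
      (real (t choose s') * p ^ s') * ((1 - p) ^ s' * (1 - p) ^ (3 * Q + 3) / 2) * p ^ (t + s)"
    proof (rule mult_right_mono, rule mult_mono)
      show "?a \<le> real (t choose s') * p ^ s'"
        using reg c0 p01 s by (intro binomial_floor_le) (auto simp: regime_def)
      have "(1 / 2 :: real) ^ (r + 5) * (1 / 8) ^ Q = (1 / 2) ^ (r + 1) * (1 / 2) ^ (3 * Q + 3) / 2"
        unfolding power_add power_mult by (simp add: power3_eq_cube field_simps numeral_eq_Suc)
      also have "\<dots> \<le> (1 / 2) ^ s' * (1 / 2) ^ (3 * Q + 3) / 2"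
        using s by (intro divide_right_mono mult_right_mono power_decreasing) auto
      also have "\<dots> \<le> (1 - p) ^ s' * (1 - p) ^ (3 * Q + 3) / 2"
        using p by (intro divide_right_mono mult_mono power_mono) auto
      finally show "(1 / 2) ^ (r + 5) * (1 / 8) ^ Q \<le> (1 - p) ^ s' * (1 - p) ^ (3 * Q + 3) / 2" .
    qed (use p01 in auto)
    also have "\<dots> = p ^ s' * (real (t choose s') * (p ^ (t - s') * (1 - p) ^ s') * p ^ ?m * ((1 - p) ^ (3 * Q + 3) / 2))"
      unfolding e[symmetric] by (simp add: mult_ac)
    also note loss0
    finally have loss: "?a * ((1 / 2) ^ (r + 5) * (1 / 8) ^ Q) * p ^ (t + s) \<le> p ^ s' * mu n p ?loss" .
    define E where "E = (1 / 8 :: real) ^ Q"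
    define T where "T = (2 :: real) ^ (r + 5)"
    define H where "H = (1 / 2 :: real) ^ (r + 5)"
    have TH: "T * H = 1" unfolding T_def H_def power_mult_distrib[symmetric] by simp
    have "p ^ s / p ^ s' * mu n p ?gain \<le> ?C * p ^ (t + s') * (2 * (p * (8 * E))) / p ^ s'"
      using divide_right_mono[OF gain, of "p ^ s'"] p01 by (simp add: E_def)
    also have "\<dots> = (T * H) * (16 * ?C * p * E * p ^ t)"
      unfolding TH using p by (simp add: power_add)
    also have "\<dots> = 16 * ?C * T / ?a * p * (?a * (H * E) * p ^ (t + s) / p ^ s)"
      using p a0 by (simp add: power_add)
    also have "\<dots> \<le> 16 * ?C * T / ?a * p * (p ^ s' * mu n p ?loss / p ^ s)"
      using p01 C0 a0 loss unfolding E_def H_def T_def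
      by (intro mult_left_mono divide_right_mono) auto
    finally show ?thesis by (simp add: T_def)
  qed
qed

section \<open>From small gains to extremality\<close>

text \<open>The property \<open>extremal_pair\<close> without an order on the indices: the weights \<open>p powi (t - u)\<close> and
\<open>p powi (t - v)\<close> are the quotients \<open>p ^ x / p ^ y\<close> and \<open>p ^ y / p ^ x\<close>, and exchanging the two families amounts
to exchanging \<open>x\<close> and \<open>y\<close>.\<close>
definition extremal_at ::
    "nat \<Rightarrow> nat \<Rightarrow> real \<Rightarrow> real \<Rightarrow> nat set set \<Rightarrow> nat set set \<Rightarrow> nat \<Rightarrow> nat \<Rightarrow> bool" where
  "extremal_at n t p \<epsilon>\<^sub>1 \<A> \<B> x y \<longleftrightarrow>
   (let \<F> = threshold_family n (t + (x + y)) x;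
        \<G> = threshold_family n (t + (x + y)) y;
        w = (\<lambda>\<X> \<Y>. p ^ x / p ^ y * mu n p \<X> + p ^ y / p ^ x * mu n p \<Y>)
    in w \<A> \<B> \<le> w \<F> \<G> \<and> (w \<A> \<B> = w \<F> \<G> \<longleftrightarrow> \<A> = \<F> \<and> \<B> = \<G>) \<and>
       w (\<A> - \<F>) (\<B> - \<G>) \<le> \<epsilon>\<^sub>1 * w (sym_diff \<A> \<F>) (sym_diff \<B> \<G>) \<and>
       mu n p \<A> * mu n p \<B> \<le> mu n p \<F> * mu n p \<G> \<and>
       (mu n p \<A> * mu n p \<B> = mu n p \<F> * mu n p \<G> \<longleftrightarrow> \<A> = \<F> \<and> \<B> = \<G>))"

lemma extremal_at_commute: "extremal_at n t p \<epsilon>\<^sub>1 \<B> \<A> y x \<longleftrightarrow> extremal_at n t p \<epsilon>\<^sub>1 \<A> \<B> x y"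
  unfolding extremal_at_def Let_def
  by (simp only: add.commute[of y x] add.commute[of "p ^ y / p ^ x * _" "p ^ x / p ^ y * _"]
      mult.commute[of "mu n p \<B>" "mu n p \<A>"]
      mult.commute[of "mu n p (threshold_family n (t + (x + y)) y)" "mu n p (threshold_family n (t + (x + y)) x)"]
      conj_commute[of "\<B> = threshold_family n (t + (x + y)) y" "\<A> = threshold_family n (t + (x + y)) x"])

lemma extremal_pair_iff_extremal_at:
  assumes "(s, s') \<in> R_ex r" "1 \<le> t" "0 < p"
  shows "extremal_pair n t p \<epsilon>\<^sub>1 \<A> \<B> (s, s') \<longleftrightarrow> extremal_at n t p \<epsilon>\<^sub>1 \<A> \<B> s s'"
proof -
  have ss: "s' \<le> s" "s \<le> s' + 1" using assms(1) by (auto simp: R_ex_def split: if_splits)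
  let ?u = "t - (s - s')" and ?v = "t + (s - s')"
  have uv: "?u + 2 * s = t + (s + s')" "?v + 2 * s' = t + (s + s')" using ss assms(2) by auto
  have "int t - int ?u = int s - int s'" "int t - int ?v = int s' - int s" using ss assms(2) by auto
  hence pw: "p powi (int t - int ?u) = p ^ s / p ^ s'" "p powi (int t - int ?v) = p ^ s' / p ^ s"
    using assms(3) by (simp_all add: power_int_diff)
  show ?thesis
    unfolding extremal_pair_def extremal_at_def norm_measure_def frankl_eq_threshold Let_def prod.case uv pw ..
qed

lemma gain_loss_sum:
  fixes e :: real
  assumes "0 \<le> gA" "0 \<le> gB" "0 \<le> lA" "0 \<le> lB" "gA \<le> e * lB" "gB \<le> e * lA" "e \<le> 1 / 2"
  shows "2 * (gA + gB) \<le> lA + lB"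
proof -
  have "e * lB \<le> 1 / 2 * lB" "e * lA \<le> 1 / 2 * lA" using assms by (intro mult_right_mono; simp)+
  thus ?thesis using assms by simp
qed

lemma product_le_of_mean:
  fixes x y d :: real
  assumes "0 \<le> x" "0 \<le> y" "x + y \<le> 2 - d" "0 \<le> d"
  shows "x * y \<le> 1 - d / 2"
proof -
  have "4 * (x * y) \<le> (x + y) ^ 2" using sum_squares_bound[of x y] by (simp add: power2_sum)
  also have "\<dots> \<le> (2 - d) ^ 2" using assms by (intro power_mono) auto
  also have "\<dots> \<le> 2 * (2 - d)" unfolding power2_eq_square using assms by (intro mult_right_mono) auto
  finally show ?thesis by simp
qed

text \<open>The weighted measures \<open>a0\<close> and \<open>b0\<close> of the threshold families need not be equal, so a bound on
\<open>a + b\<close> is not enough. But the gains are so small that even \<open>a / a0 + b / b0\<close> drops below \<open>2\<close>, by at least half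
of the relative losses, and the mean inequality applies to these quotients.\<close>
lemma product_stable:
  fixes a b a0 b0 e gA gB lA lB :: real
  assumes "0 \<le> lA" "0 \<le> lB" "0 < a0" "0 < b0" "gA \<le> e * lB" "gB \<le> e * lA"
    and e: "e * b0 \<le> a0 / 2" "e * a0 \<le> b0 / 2"
    and ab: "a = a0 + gA - lA" "b = b0 + gB - lB" "0 \<le> a" "0 \<le> b"
  shows "a * b \<le> a0 * b0" "a * b = a0 * b0 \<Longrightarrow> lA = 0 \<and> lB = 0"
proof -
  define d where "d = lA / a0 / 2 + lB / b0 / 2"
  have "gA / a0 \<le> lB / b0 / 2"
  proof -
    have "gA / a0 \<le> e * lB / a0" using assms by (intro divide_right_mono) auto
    also have "\<dots> = (e * b0) * lB / (a0 * b0)" using assms by simp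
    also have "\<dots> \<le> (a0 / 2) * lB / (a0 * b0)" using assms by (intro divide_right_mono mult_right_mono) auto
    finally show ?thesis using assms by (simp add: field_simps)
  qed
  moreover have "gB / b0 \<le> lA / a0 / 2"
  proof -
    have "gB / b0 \<le> e * lA / b0" using assms by (intro divide_right_mono) auto
    also have "\<dots> = (e * a0) * lA / (a0 * b0)" using assms by simp
    also have "\<dots> \<le> (b0 / 2) * lA / (a0 * b0)" using assms by (intro divide_right_mono mult_right_mono) auto
    finally show ?thesis using assms by (simp add: field_simps)
  qed
  moreover have "a / a0 = 1 + gA / a0 - lA / a0" "b / b0 = 1 + gB / b0 - lB / b0"
    unfolding ab using assms(3,4) by (simp_all add: diff_divide_distrib add_divide_distrib)
  moreover have "A + B \<le> 2 - (u / 2 + v / 2)" if "g \<le> v / 2" "h \<le> u / 2" "A = 1 + g - u" "B = 1 + h - v"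
    for A B g h u v :: real using that by simp
  ultimately have "a / a0 + b / b0 \<le> 2 - d" unfolding d_def by blast
  moreover have d0: "0 \<le> d" using assms by (simp add: d_def)
  ultimately have "(a / a0) * (b / b0) \<le> 1 - d / 2"
    using assms by (intro product_le_of_mean) auto
  hence "(a / a0) * (b / b0) * (a0 * b0) \<le> (1 - d / 2) * (a0 * b0)"
    using assms(3,4) by (intro mult_right_mono) auto
  moreover have "(a / a0) * (b / b0) * (a0 * b0) = a * b" using assms(3,4) by simp
  ultimately have *: "a * b \<le> (1 - d / 2) * (a0 * b0)" by simp
  have "(1 - d / 2) * (a0 * b0) \<le> 1 * (a0 * b0)" using d0 assms by (intro mult_right_mono) auto
  with * show "a * b \<le> a0 * b0" by simp
  assume "a * b = a0 * b0"
  with * have "d * (a0 * b0) \<le> 0" by (simp add: algebra_simps)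
  hence "d \<le> 0" using assms by (simp add: mult_le_0_iff)
  hence "d = 0" using d0 by simp
  moreover have "0 \<le> lA / a0" "0 \<le> lB / b0" using assms by auto
  ultimately have "lA / a0 = 0" "lB / b0 = 0" by (auto simp: d_def add_nonneg_eq_0_iff)
  thus "lA = 0 \<and> lB = 0" using assms by simp
qed


text \<open>Once gains are dominated by losses with a small factor \<open>e\<close>, everything follows from writing the measure
of each family as that of the threshold family plus gain minus loss. In every equality case the
losses vanish, hence also the gains, and families differing by null sets are equal.\<close>
lemma extremal_at_of_gain_bounds:
  fixes p e :: real and t x y :: nat
  assumes p: "0 < p" "p < 1" and AB: "\<A> \<subseteq> Pow {1..n}" "\<B> \<subseteq> Pow {1..n}"
  defines "\<F> \<equiv> threshold_family n (t + (x + y)) x" and "\<G> \<equiv> threshold_family n (t + (x + y)) y"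
  defines "W \<equiv> p ^ x / p ^ y" and "V \<equiv> p ^ y / p ^ x"
  assumes gA: "W * mu n p (\<A> - \<F>) \<le> e * (V * mu n p (\<G> - \<B>))"
    and gB: "V * mu n p (\<B> - \<G>) \<le> e * (W * mu n p (\<F> - \<A>))"
    and e: "0 \<le> e" "e \<le> 1 / 2" "e \<le> \<epsilon>\<^sub>1"
    and pos: "0 < W * mu n p \<F>" "0 < V * mu n p \<G>"
    and cmp: "e * (V * mu n p \<G>) \<le> W * mu n p \<F> / 2" "e * (W * mu n p \<F>) \<le> V * mu n p \<G> / 2"
  shows "extremal_at n t p \<epsilon>\<^sub>1 \<A> \<B> x y"
proof -
  have p01: "0 \<le> p" "p \<le> 1" using p by auto
  have FG: "\<F> \<subseteq> Pow {1..n}" "\<G> \<subseteq> Pow {1..n}" unfolding \<F>_def \<G>_def by (rule threshold_subset_Pow)+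
  have WV: "0 < W" "0 < V" "W * V = 1" using p by (auto simp: W_def V_def)
  define ga where "ga = W * mu n p (\<A> - \<F>)"
  define gb where "gb = V * mu n p (\<B> - \<G>)"
  define la where "la = W * mu n p (\<F> - \<A>)"
  define lb where "lb = V * mu n p (\<G> - \<B>)"
  have nn: "0 \<le> ga" "0 \<le> gb" "0 \<le> la" "0 \<le> lb"
    unfolding ga_def gb_def la_def lb_def using WV mu_nonneg[OF p01] by (auto intro!: mult_nonneg_nonneg)
  have g: "ga \<le> e * lb" "gb \<le> e * la" using gA gB by (simp_all add: ga_def gb_def la_def lb_def)
  have bal: "W' * mu n p \<X> = W' * mu n p \<Y> + W' * mu n p (\<X> - \<Y>) - W' * mu n p (\<Y> - \<X>)"
    if "\<X> \<subseteq> Pow {1..n}" "\<Y> \<subseteq> Pow {1..n}" for W' :: real and \<X> \<Y>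
    using mu_Diff_Int[OF p01 that(1), of \<Y>] mu_Diff_Int[OF p01 that(2), of \<X>]
    by (simp add: Int_commute algebra_simps)
  have a: "W * mu n p \<A> = W * mu n p \<F> + ga - la" "V * mu n p \<B> = V * mu n p \<G> + gb - lb"
    unfolding ga_def gb_def la_def lb_def by (rule bal; fact)+
  have ab0: "0 \<le> W * mu n p \<A>" "0 \<le> V * mu n p \<B>"
    using WV mu_nonneg[OF p01] by (auto intro!: mult_nonneg_nonneg)
  have half: "2 * (ga + gb) \<le> la + lb" by (rule gain_loss_sum[OF nn g e(2)])
  have eq_iff: "\<A> = \<F> \<and> \<B> = \<G> \<longleftrightarrow> la = 0 \<and> lb = 0"
  proof
    assume "\<A> = \<F> \<and> \<B> = \<G>" thus "la = 0 \<and> lb = 0" by (simp add: la_def lb_def mu_def)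
  next
    assume l: "la = 0 \<and> lb = 0"
    hence z: "ga = 0" "gb = 0" using half nn by auto
    have "mu n p (\<F> - \<A>) = 0" "mu n p (\<A> - \<F>) = 0" "mu n p (\<G> - \<B>) = 0" "mu n p (\<B> - \<G>) = 0"
      using l z WV by (auto simp: ga_def gb_def la_def lb_def)
    moreover have "\<X> \<subseteq> \<Y>" if "mu n p (\<X> - \<Y>) = 0" "\<X> \<subseteq> Pow {1..n}" for \<X> \<Y>
      using mu_eq_0_iff[OF p, of "\<X> - \<Y>" n] that by auto
    ultimately show "\<A> = \<F> \<and> \<B> = \<G>" using FG AB by (intro conjI subset_antisym) auto
  qed
  have arith: "A + B \<le> F + G \<and> (A + B = F + G \<longleftrightarrow> la = 0 \<and> lb = 0)"
    if "A = F + ga - la" "B = G + gb - lb" for A B F G :: real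
    using that half nn by auto
  note X = arith[OF a, THEN conjunct1] and Xeq = arith[OF a, THEN conjunct2, folded eq_iff]
  have Y: "ga + gb \<le> \<epsilon>\<^sub>1 * (W * mu n p (sym_diff \<A> \<F>) + V * mu n p (sym_diff \<B> \<G>))"
  proof -
    have "ga + gb \<le> e * (la + lb)" using g by (simp add: algebra_simps)
    also have "\<dots> \<le> \<epsilon>\<^sub>1 * (ga + la + (gb + lb))" using e nn by (intro mult_mono) auto
    finally have "ga + gb \<le> \<epsilon>\<^sub>1 * (ga + la + (gb + lb))" .
    moreover have "ga + la = W * mu n p (sym_diff \<A> \<F>)" "gb + lb = V * mu n p (sym_diff \<B> \<G>)"
      using mu_sym_diff[OF p01 AB(1) FG(1)] mu_sym_diff[OF p01 AB(2) FG(2)]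
      by (simp_all add: ga_def la_def gb_def lb_def algebra_simps)
    ultimately show ?thesis by simp
  qed
  have prod: "(W * mu n p \<X>) * (V * mu n p \<Y>) = mu n p \<X> * mu n p \<Y>" for \<X> \<Y>
  proof -
    have "(W * mu n p \<X>) * (V * mu n p \<Y>) = (W * V) * (mu n p \<X> * mu n p \<Y>)" by (simp only: mult_ac)
    thus ?thesis using WV by simp
  qed
  note P = product_stable[OF nn(3,4) pos g cmp a ab0]
  have Z: "mu n p \<A> * mu n p \<B> \<le> mu n p \<F> * mu n p \<G>"
    using P(1) by (simp only: prod)
  have Zeq: "mu n p \<A> * mu n p \<B> = mu n p \<F> * mu n p \<G> \<longleftrightarrow> \<A> = \<F> \<and> \<B> = \<G>"
    using P(2) eq_iff by (auto simp only: prod)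
  show ?thesis
    unfolding extremal_at_def Let_def \<F>_def[symmetric] \<G>_def[symmetric] W_def[symmetric] V_def[symmetric]
    using X Xeq Y Z Zeq unfolding ga_def gb_def by blast
qed

text \<open>Both weighted threshold families have measure of order \<open>p ^ t\<close>, with constants depending on \<open>r\<close> and
\<open>c\<^sub>0\<close> only. This is what allows a bounded change of weights in the product inequality.\<close>
lemma weighted_threshold_bounds:
  fixes p :: real
  assumes reg: "regime r c\<^sub>0 p t n" and c0: "0 < c\<^sub>0" and xy: "x \<le> r + 1" "y \<le> r + 1" "r + 1 \<le> t"
    and p: "0 < p" "36 * p \<le> 1" "real (2 * r + 2) * p \<le> 1"
  shows "p ^ x / p ^ y * mu n p (threshold_family n (t + (x + y)) x) \<le> binomial_bound (real r + 1) * p ^ t"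
    and "t + (x + y) \<le> n \<Longrightarrow> binomial_floor r c\<^sub>0 * (1 / 2) ^ (r + 1) * p ^ t \<le>
      p ^ x / p ^ y * mu n p (threshold_family n (t + (x + y)) x)"
proof -
  let ?T = "threshold_family n (t + (x + y)) x"
  have p01: "0 \<le> p" "p \<le> 1" using p by auto
  have "real (x + y) \<le> real (2 * r + 2)" using xy by linarith
  hence "real (x + y) * p \<le> real (2 * r + 2) * p" using p01 by (intro mult_right_mono) auto
  hence "real (x + y) * p \<le> 1" using p by linarith
  hence "p ^ x * mu n p ?T \<le> binomial_bound (real r + 1) * p ^ (t + (x + y) - x)"
    using reg p by (intro weighted_mu_threshold_le) (auto simp: regime_def)
  also have "t + (x + y) - x = t + y" by simp
  finally have "p ^ x * mu n p ?T / p ^ y \<le> binomial_bound (real r + 1) * p ^ (t + y) / p ^ y"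
    using p by (intro divide_right_mono) auto
  thus "p ^ x / p ^ y * mu n p ?T \<le> binomial_bound (real r + 1) * p ^ t"
    using p by (simp add: power_add)
  assume tn: "t + (x + y) \<le> n"
  have e: "p ^ (t - x) * p ^ (x + y) = p ^ (t + y)"
    unfolding power_add[symmetric] using xy by (intro arg_cong[of _ _ "power p"]) simp
  have "binomial_floor r c\<^sub>0 * (1 / 2) ^ (r + 1) \<le> (real (t choose x) * p ^ x) * (1 - p) ^ x"
  proof (rule mult_mono)
    show "binomial_floor r c\<^sub>0 \<le> real (t choose x) * p ^ x"
      using reg c0 p01 xy by (intro binomial_floor_le) (auto simp: regime_def)
    have "(1 / 2 :: real) ^ (r + 1) \<le> (1 / 2) ^ x" using xy by (intro power_decreasing) auto
    also have "\<dots> \<le> (1 - p) ^ x" using p by (intro power_mono) auto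
    finally show "(1 / 2) ^ (r + 1) \<le> (1 - p) ^ x" .
  qed (use p01 in auto)
  hence "binomial_floor r c\<^sub>0 * (1 / 2) ^ (r + 1) * p ^ (t + y) \<le>
    (real (t choose x) * p ^ x) * (1 - p) ^ x * p ^ (t + y)"
    using p01 by (intro mult_right_mono) auto
  also have "\<dots> = p ^ x * (real (t choose x) * (p ^ (t - x) * (1 - p) ^ x) * p ^ (x + y))"
    unfolding e[symmetric] by (simp only: mult_ac)
  also have "\<dots> \<le> p ^ x * mu n p ?T"
    using xy tn p01 by (intro mult_left_mono mu_threshold_ge[OF p01]) auto
  finally have "binomial_floor r c\<^sub>0 * (1 / 2) ^ (r + 1) * p ^ (t + y) / p ^ y \<le> p ^ x * mu n p ?T / p ^ y"
    using p by (intro divide_right_mono) auto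
  thus "binomial_floor r c\<^sub>0 * (1 / 2) ^ (r + 1) * p ^ t \<le> p ^ x / p ^ y * mu n p ?T"
    using p by (simp add: power_add)
qed

lemma regime_large_t:
  assumes "regime r c\<^sub>0 p t n" "0 < p" "p * (real r + 1) \<le> c\<^sub>0"
  shows "r + 1 \<le> t" "t \<le> n"
proof -
  have "p * (real r + 1) \<le> real t * p" using assms(1,3) unfolding regime_def by linarith
  hence "p * (real r + 1) \<le> p * real t" by (metis mult.commute)
  hence "real r + 1 \<le> real t" by (rule mult_left_le_imp_le) fact
  thus "r + 1 \<le> t" by linarith
  show "t \<le> n" using assms by (simp add: regime_def)
qed

lemma typical_members_imply_extremal:
  fixes r :: nat and c\<^sub>0 \<epsilon>\<^sub>1 :: real
  assumes c0: "0 < c\<^sub>0" and "0 < \<epsilon>\<^sub>1"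
  shows "\<forall>\<^sub>F p in at_right 0. \<forall>t n \<A> \<B> x y. regime r c\<^sub>0 p t n \<and> nice n t \<A> \<B> \<and> x \<le> r + 1 \<and> y \<le> r + 1 \<and>
    \<A> \<inter> typical n t (x + y) x 0 \<noteq> {} \<and> \<B> \<inter> typical n t (x + y) y 0 \<noteq> {} \<longrightarrow>
    extremal_at n t p \<epsilon>\<^sub>1 \<A> \<B> x y"
proof -
  define C where "C = binomial_bound (real r + 1)"
  define a where "a = binomial_floor r c\<^sub>0 * (1 / 2) ^ (r + 1)"
  define \<kappa> where "\<kappa> = 16 * C * 2 ^ (r + 5) / binomial_floor r c\<^sub>0"
  have C: "1 \<le> C" unfolding C_def by (rule binomial_bound_ge_1)
  have a: "0 < a" unfolding a_def using binomial_floor_pos[OF c0] by simp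
  have \<kappa>: "0 < \<kappa>" unfolding \<kappa>_def using C binomial_floor_pos[OF c0] by simp
  have "\<forall>\<^sub>F p in at_right 0. 0 < p \<and> p < min (min (1 / 36) (1 / real (2 * r + 2)))
    (min (c\<^sub>0 / (real r + 1)) (min (1 / 2) (min \<epsilon>\<^sub>1 (a / (2 * C))) / \<kappa>))"
    using c0 a C \<kappa> assms by (intro eventually_small) auto
  thus ?thesis
  proof eventually_elim
    case (elim p)
    have p: "0 < p" "36 * p \<le> 1" "real (2 * r + 2) * p \<le> 1" "p * (real r + 1) \<le> c\<^sub>0"
      using elim by (auto simp: field_simps)
    define e where "e = \<kappa> * p"
    have "p < min (1 / 2) (min \<epsilon>\<^sub>1 (a / (2 * C))) / \<kappa>" using elim by simp
    hence "e < min (1 / 2) (min \<epsilon>\<^sub>1 (a / (2 * C)))" unfolding e_def using \<kappa> by (simp add: pos_less_divide_eq mult.commute)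
    hence e: "0 \<le> e" "e \<le> 1 / 2" "e \<le> \<epsilon>\<^sub>1" "e \<le> a / (2 * C)" using \<kappa> p by (auto simp: e_def)
    have eC: "e * C \<le> a / 2" using e(4) C by (simp add: field_simps)
    show ?case
    proof (intro allI impI, elim conjE)
      fix t n \<A> \<B> x y
      assume reg: "regime r c\<^sub>0 p t n" and nice: "nice n t \<A> \<B>" and x: "x \<le> r + 1" and y: "y \<le> r + 1"
        and A: "\<A> \<inter> typical n t (x + y) x 0 \<noteq> {}" and B: "\<B> \<inter> typical n t (x + y) y 0 \<noteq> {}"
      note tn = regime_large_t[OF reg p(1,4)]
      have fits: "t + (x + y) \<le> n" using typical_nonempty_fits[OF _ tn(2)] A by blast
      let ?\<F> = "threshold_family n (t + (x + y)) x" and ?\<G> = "threshold_family n (t + (x + y)) y"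
      have gA: "p ^ x / p ^ y * mu n p (\<A> - ?\<F>) \<le> e * (p ^ y / p ^ x * mu n p (?\<G> - \<B>))"
        using gains_le_losses[OF nice B reg c0 x y tn(1) p(1-3)] by (simp add: e_def \<kappa>_def C_def)
      have A': "\<A> \<inter> typical n t (y + x) x 0 \<noteq> {}" using A by (simp add: add.commute)
      have gB: "p ^ y / p ^ x * mu n p (\<B> - ?\<G>) \<le> e * (p ^ x / p ^ y * mu n p (?\<F> - \<A>))"
        using gains_le_losses[OF nice_commute[OF nice] A' reg c0 y x tn(1) p(1-3)]
        by (simp add: e_def \<kappa>_def C_def add.commute)
      note bx = weighted_threshold_bounds[OF reg c0 x y tn(1) p(1-3), folded C_def a_def]
      note by' = weighted_threshold_bounds[OF reg c0 y x tn(1) p(1-3), folded C_def a_def, unfolded add.commute[of y x]]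
      have pt: "0 < a * p ^ t" using a p by simp
      have small: "e * (C * p ^ t) \<le> a * p ^ t / 2"
        using mult_right_mono[OF eC, of "p ^ t"] p by (simp add: mult_ac)
      have cmp: "e * z \<le> w / 2" if "z \<le> C * p ^ t" "a * p ^ t \<le> w" for z w
        using mult_left_mono[OF that(1) e(1)] small that(2) by linarith
      show "extremal_at n t p \<epsilon>\<^sub>1 \<A> \<B> x y"
      proof (rule extremal_at_of_gain_bounds[OF _ _ _ _ gA gB e(1-3)])
        show "0 < p ^ x / p ^ y * mu n p ?\<F>" using bx(2)[OF fits] pt by linarith
        show "0 < p ^ y / p ^ x * mu n p ?\<G>" using by'(2)[OF fits] pt by linarith
        show "e * (p ^ y / p ^ x * mu n p ?\<G>) \<le> p ^ x / p ^ y * mu n p ?\<F> / 2"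
          by (rule cmp[OF by'(1) bx(2)[OF fits]])
        show "e * (p ^ x / p ^ y * mu n p ?\<F>) \<le> p ^ y / p ^ x * mu n p ?\<G> / 2"
          by (rule cmp[OF bx(1) by'(2)[OF fits]])
      qed (use p nice in \<open>auto simp: nice_def\<close>)
    qed
  qed
qed

section \<open>Uniqueness of the index pair\<close>

text \<open>The typical part of \<open>\<A>\<close> has order \<open>p ^ t\<close> with the weight \<open>p ^ j / p ^ j'\<close>, because the typical
part of \<open>\<B>\<close> has at most that order with the reciprocal weight. Under \<open>lt\<close> the weight \<open>p ^ x / p ^ y\<close> is
larger by a factor of at least \<open>1 / p\<close>, whereas the threshold families for \<open>x\<close> and \<open>y\<close> still have order
\<open>p ^ t\<close>; so nearly all of \<open>\<A>\<close> would be a gain far larger than all possible losses.\<close>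
lemma wrong_difference_excluded:
  fixes p :: real
  assumes reg: "regime r c\<^sub>0 p t n" and c0: "0 < c\<^sub>0"
    and le: "j \<le> r + 1" "j' \<le> r + 1" "x \<le> r + 1" "y \<le> r + 1" "r + 1 \<le> t"
    and p: "0 < p" "36 * p \<le> 1" "real (2 * r + 2) * p \<le> 1" "3 * binomial_bound (real r + 1) * p < c\<^sub>1"
    and A: "\<A> \<subseteq> Pow {1..n}"
    and big: "c\<^sub>1 * binomial_bound (real r + 1) * p ^ (2 * t) \<le>
      mu n p (\<A> \<inter> typical n t (j + j') j 0) * mu n p (\<B> \<inter> typical n t (j + j') j' 0)"
    and lt: "x + j' < j + y"
    and cond: "p ^ x / p ^ y * mu n p (\<A> - threshold_family n (t + (x + y)) x) \<le>
      p ^ x / p ^ y * mu n p (threshold_family n (t + (x + y)) x) +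
      p ^ y / p ^ x * mu n p (threshold_family n (t + (x + y)) y)"
  shows False
proof -
  let ?C = "binomial_bound (real r + 1)" and ?\<F> = "threshold_family n (t + (x + y)) x"
  let ?A = "\<A> \<inter> typical n t (j + j') j 0" and ?B = "\<B> \<inter> typical n t (j + j') j' 0"
  have p01: "0 \<le> p" "p \<le> 1" using p by auto
  have C: "1 \<le> ?C" by (rule binomial_bound_ge_1)
  have pt: "0 < p ^ t" using p by simp
  have "p ^ j' / p ^ j * mu n p ?B \<le> p ^ j' / p ^ j * mu n p (threshold_family n (t + (j' + j)) j')"
    using p01 typical_subset_threshold[of n t "j + j'" j' 0]
    by (intro mult_left_mono mu_mono threshold_subset_Pow) (auto simp: add.commute)
  also have "\<dots> \<le> ?C * p ^ t" by (rule weighted_threshold_bounds(1)[OF reg c0 le(2,1,5) p(1-3)])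
  finally have B: "p ^ j' / p ^ j * mu n p ?B \<le> ?C * p ^ t" .
  have "c\<^sub>1 * p ^ t * (?C * p ^ t) \<le> mu n p ?A * mu n p ?B"
    using big unfolding mult_2 power_add by (simp only: mult_ac)
  also have "\<dots> = (p ^ j / p ^ j' * mu n p ?A) * (p ^ j' / p ^ j * mu n p ?B)" using p by simp
  also have "\<dots> \<le> (p ^ j / p ^ j' * mu n p ?A) * (?C * p ^ t)"
    using p01 B by (intro mult_left_mono mult_nonneg_nonneg mu_nonneg) auto
  finally have "c\<^sub>1 * p ^ t * (?C * p ^ t) \<le> (p ^ j / p ^ j' * mu n p ?A) * (?C * p ^ t)" .
  moreover have "0 < ?C * p ^ t" using C pt by simp
  ultimately have A1: "c\<^sub>1 * p ^ t \<le> p ^ j / p ^ j' * mu n p ?A" by (rule mult_right_le_imp_le)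
  have "p ^ j / p ^ j' \<le> p * (p ^ x / p ^ y)"
  proof -
    have "p ^ (j + y) \<le> p ^ (Suc (x + j'))" using p01 lt by (intro power_decreasing) auto
    hence "p ^ j * p ^ y \<le> p * (p ^ x * p ^ j')" by (simp add: power_add)
    thus ?thesis using p by (simp add: field_simps)
  qed
  hence "p ^ j / p ^ j' * mu n p ?A \<le> p * (p ^ x / p ^ y) * mu n p ?A"
    by (intro mult_right_mono mu_nonneg p01)
  with A1 have A2: "c\<^sub>1 * p ^ t \<le> p * (p ^ x / p ^ y * mu n p ?A)" by (simp add: mult_ac)
  have "mu n p ?A \<le> mu n p \<A>" by (rule mu_mono[OF p01]) (use A in auto)
  also have "\<dots> = mu n p (\<A> - ?\<F>) + mu n p (\<A> \<inter> ?\<F>)" by (rule mu_Diff_Int[OF p01 A])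
  also have "mu n p (\<A> \<inter> ?\<F>) \<le> mu n p ?\<F>" by (rule mu_mono[OF p01 _ threshold_subset_Pow]) auto
  finally have "mu n p ?A \<le> mu n p (\<A> - ?\<F>) + mu n p ?\<F>" by simp
  hence "p ^ x / p ^ y * mu n p ?A \<le> p ^ x / p ^ y * (mu n p (\<A> - ?\<F>) + mu n p ?\<F>)"
    using p01 by (intro mult_left_mono) auto
  also have "\<dots> = p ^ x / p ^ y * mu n p (\<A> - ?\<F>) + p ^ x / p ^ y * mu n p ?\<F>" by (rule distrib_left)
  finally have A3: "p ^ x / p ^ y * mu n p ?A \<le>
    p ^ x / p ^ y * mu n p (\<A> - ?\<F>) + p ^ x / p ^ y * mu n p ?\<F>" .
  have X: "p ^ x / p ^ y * mu n p ?\<F> \<le> ?C * p ^ t"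
    by (rule weighted_threshold_bounds(1)[OF reg c0 le(3,4,5) p(1-3)])
  have Y: "p ^ y / p ^ x * mu n p (threshold_family n (t + (x + y)) y) \<le> ?C * p ^ t"
    using weighted_threshold_bounds(1)[OF reg c0 le(4,3,5) p(1-3)] by (simp add: add.commute)
  have "p ^ x / p ^ y * mu n p ?A \<le> 3 * (?C * p ^ t)" using A3 X Y cond by linarith
  hence "p * (p ^ x / p ^ y * mu n p ?A) \<le> p * (3 * (?C * p ^ t))" using p01(1) by (rule mult_left_mono)
  with A2 have "c\<^sub>1 * p ^ t \<le> (3 * ?C * p) * p ^ t" by (simp add: mult_ac)
  hence "c\<^sub>1 \<le> 3 * ?C * p" using pt by (rule mult_right_le_imp_le)
  thus False using p(4) by simp
qed

text \<open>In contrast to the crude bound by a constant, the factor here tends to \<open>1\<close> as \<open>p\<close> tends to \<open>0\<close>. The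
uniqueness argument compares it with \<open>sqrt (1 - \<delta>\<^sub>1)\<close>.\<close>
lemma weighted_threshold_poisson:
  fixes p :: real
  assumes reg: "regime r c\<^sub>0 p t n" and c0: "0 < c\<^sub>0" and p: "0 < p" "p \<le> 1"
    and xy: "x \<le> r + 1" "y \<le> r + 1"
  shows "p ^ x / p ^ y * mu n p (threshold_family n (t + (x + y)) x) \<le>
    (1 + (2 * real r + 2) * p / c\<^sub>0) ^ (r + 1) * (1 + 2 * real r * p / c\<^sub>0) ^ r * (p ^ t * ((real t * p) ^ r / fact r))"
proof -
  let ?M = "1 + (2 * real r + 2) * p / c\<^sub>0" and ?L = "1 + 2 * real r * p / c\<^sub>0"
  let ?k = "t + (x + y)" and ?T = "threshold_family n (t + (x + y)) x"
  have p0: "0 \<le> p" using p by simp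
  have c: "c\<^sub>0 \<le> real t * p" "real t * p \<le> real r + 1" using reg by (auto simp: regime_def)
  have M: "1 \<le> ?M" "1 \<le> ?L" using c0 p by auto
  have "real ?k * p \<le> ?M * (real t * p)"
  proof -
    have "(2 * real r + 2) * p / c\<^sub>0 * c\<^sub>0 \<le> (2 * real r + 2) * p / c\<^sub>0 * (real t * p)"
      using c0 p c by (intro mult_left_mono) auto
    hence "(2 * real r + 2) * p \<le> (2 * real r + 2) * p / c\<^sub>0 * (real t * p)" using c0 by simp
    moreover have "real (x + y) * p \<le> (2 * real r + 2) * p" using xy p by (intro mult_right_mono) auto
    ultimately have *: "real (x + y) * p \<le> (2 * real r + 2) * p / c\<^sub>0 * (real t * p)" by (rule order_trans[rotated])
    have "real ?k * p = real t * p + real (x + y) * p" by (simp add: algebra_simps)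
    also have "\<dots> \<le> real t * p + (2 * real r + 2) * p / c\<^sub>0 * (real t * p)" using * by (rule add_left_mono)
    also have "\<dots> = ?M * (real t * p)" by (simp only: distrib_right mult_1)
    finally show ?thesis .
  qed
  hence "(real ?k * p) ^ x \<le> (?M * (real t * p)) ^ x" using p by (intro power_mono) auto
  hence "(real ?k * p) ^ x / fact x \<le> ?M ^ x * ((real t * p) ^ x / fact x)"
    by (simp add: power_mult_distrib divide_right_mono)
  also have "\<dots> \<le> ?M ^ (r + 1) * (?L ^ r * ((real t * p) ^ r / fact r))"
  proof (rule mult_mono)
    show "?M ^ x \<le> ?M ^ (r + 1)" using M xy by (intro power_increasing) auto
    show "(real t * p) ^ x / fact x \<le> ?L ^ r * ((real t * p) ^ r / fact r)"
      using c c0 M regime_mode_bound[OF reg p(1) c0] by (intro poisson_weight_le_mode) auto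
  qed (use p M in auto)
  finally have P: "(real ?k * p) ^ x / fact x \<le> ?M ^ (r + 1) * (?L ^ r * ((real t * p) ^ r / fact r))" .
  have "p ^ x * mu n p ?T \<le> p ^ x * (real (?k choose x) * p ^ (?k - x))"
    using p by (intro mult_left_mono mu_threshold_le) auto
  also have "\<dots> = (real (?k choose x) * p ^ x) * p ^ (t + y)" by (simp add: mult_ac)
  also have "\<dots> \<le> (real ?k * p) ^ x / fact x * p ^ (t + y)"
    by (intro mult_right_mono binomial_power_le) (use p in auto)
  also have "\<dots> \<le> ?M ^ (r + 1) * (?L ^ r * ((real t * p) ^ r / fact r)) * p ^ (t + y)"
    using P p by (intro mult_right_mono) auto
  finally have "p ^ x * mu n p ?T / p ^ y \<le> ?M ^ (r + 1) * (?L ^ r * ((real t * p) ^ r / fact r)) * p ^ (t + y) / p ^ y"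
    using p by (intro divide_right_mono) auto
  also have "\<dots> = ?M ^ (r + 1) * ?L ^ r * (p ^ t * ((real t * p) ^ r / fact r))"
  proof -
    have "p ^ (t + y) / p ^ y = p ^ t" using p by (simp add: power_add)
    moreover have "?M ^ (r + 1) * (?L ^ r * ((real t * p) ^ r / fact r)) * p ^ (t + y) / p ^ y =
      ?M ^ (r + 1) * (?L ^ r * ((real t * p) ^ r / fact r)) * (p ^ (t + y) / p ^ y)" by simp
    ultimately show ?thesis by (simp only: mult_ac)
  qed
  finally show ?thesis by simp
qed

text \<open>If \<open>x - y\<close> differs from \<open>j - j'\<close>, the weights are wrong. Otherwise, if \<open>x \<noteq> j\<close>, the typical parts of
both families consist of gains with respect to \<open>(x, y)\<close>. By the mean inequality their weighted sum is at
least twice the root of the product of their measures, in which the weights cancel, and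
this exceeds the fraction of the possible losses that the second part of the conclusion admits.\<close>
lemma extremal_index_unique:
  fixes r :: nat and c\<^sub>0 \<epsilon>\<^sub>1 \<theta> :: real
  assumes c0: "0 < c\<^sub>0" and \<epsilon>: "0 < \<epsilon>\<^sub>1" "\<epsilon>\<^sub>1 < 1 / 2" and \<theta>: "0 < \<theta>" "\<epsilon>\<^sub>1 < (1 - \<epsilon>\<^sub>1) * sqrt \<theta>"
  shows "\<forall>\<^sub>F p in at_right 0. \<forall>t n \<A> \<B> j j' x y. regime r c\<^sub>0 p t n \<and> nice n t \<A> \<B> \<and>
    j \<le> r + 1 \<and> j' \<le> r + 1 \<and> x \<le> r + 1 \<and> y \<le> r + 1 \<and>
    \<theta> * (p ^ t * ((real t * p) ^ r / fact r))\<^sup>2 \<le>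
      mu n p (\<A> \<inter> typical n t (j + j') j 0) * mu n p (\<B> \<inter> typical n t (j + j') j' 0) \<and>
    extremal_at n t p \<epsilon>\<^sub>1 \<A> \<B> x y \<longrightarrow> x = j \<and> y = j'"
proof -
  define C where "C = binomial_bound (real r + 1)"
  define \<phi>0 where "\<phi>0 = c\<^sub>0 ^ r / fact r"
  define c1 where "c1 = \<theta> * \<phi>0\<^sup>2 / C"
  have C: "1 \<le> C" unfolding C_def by (rule binomial_bound_ge_1)
  have \<phi>0: "0 < \<phi>0" using c0 by (simp add: \<phi>0_def)
  have c1: "0 < c1" using C \<phi>0 \<theta> by (simp add: c1_def)
  have "\<forall>\<^sub>F p in at_right 0. 0 < p \<and> p < min (min (1 / 36) (1 / real (2 * r + 2)))
    (min (c\<^sub>0 / (real r + 1)) (c1 / (3 * C)))"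
    using c0 C c1 by (intro eventually_small) auto
  moreover have "\<forall>\<^sub>F p in at_right 0.
    \<epsilon>\<^sub>1 * ((1 + (2 * real r + 2) * p / c\<^sub>0) ^ (r + 1) * (1 + 2 * real r * p / c\<^sub>0) ^ r) < (1 - \<epsilon>\<^sub>1) * sqrt \<theta>"
    by (rule order_tendstoD(2)[where y = "\<epsilon>\<^sub>1"]) (use c0 \<theta> in \<open>auto intro!: tendsto_eq_intros\<close>)
  ultimately show ?thesis
  proof eventually_elim
    case (elim p)
    have p: "0 < p" "36 * p \<le> 1" "real (2 * r + 2) * p \<le> 1" "p * (real r + 1) \<le> c\<^sub>0" "3 * C * p < c1" "p \<le> 1"
      using elim(1) C by (auto simp: field_simps)
    have p01: "0 \<le> p" "p \<le> 1" using p by auto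
    define K where "K = (1 + (2 * real r + 2) * p / c\<^sub>0) ^ (r + 1) * (1 + 2 * real r * p / c\<^sub>0) ^ r"
    have K: "\<epsilon>\<^sub>1 * K < (1 - \<epsilon>\<^sub>1) * sqrt \<theta>" using elim(2) by (simp add: K_def)
    show ?case
    proof (intro allI impI, elim conjE)
      fix t n \<A> \<B> j j' x y
      assume reg: "regime r c\<^sub>0 p t n" and nice: "nice n t \<A> \<B>"
        and le: "j \<le> r + 1" "j' \<le> r + 1" "x \<le> r + 1" "y \<le> r + 1"
        and big: "\<theta> * (p ^ t * ((real t * p) ^ r / fact r))\<^sup>2 \<le>
          mu n p (\<A> \<inter> typical n t (j + j') j 0) * mu n p (\<B> \<inter> typical n t (j + j') j' 0)"
        and ext: "extremal_at n t p \<epsilon>\<^sub>1 \<A> \<B> x y"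
      define \<phi> where "\<phi> = (real t * p) ^ r / fact r"
      define A' where "A' = \<A> \<inter> typical n t (j + j') j 0"
      define B' where "B' = \<B> \<inter> typical n t (j + j') j' 0"
      let ?\<F> = "threshold_family n (t + (x + y)) x" and ?\<G> = "threshold_family n (t + (x + y)) y"
      define W where "W = p ^ x / p ^ y"
      define V where "V = p ^ y / p ^ x"
      have W: "0 < W" "0 < V" "W * V = 1" using p by (auto simp: W_def V_def)
      have AB: "\<A> \<subseteq> Pow {1..n}" "\<B> \<subseteq> Pow {1..n}" using nice by (auto simp: nice_def)
      note tn = regime_large_t[OF reg p(1,4)]
      have \<phi>: "\<phi>0 \<le> \<phi>" unfolding \<phi>_def \<phi>0_def using reg c0
        by (intro divide_right_mono power_mono) (auto simp: regime_def)
      define Y where "Y = W * mu n p (\<A> - ?\<F>) + V * mu n p (\<B> - ?\<G>)"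
      define L where "L = W * mu n p ?\<F> + V * mu n p ?\<G>"
      have nn: "0 \<le> W * mu n p \<X>" "0 \<le> V * mu n p \<X>" for \<X>
        using W mu_nonneg[OF p01] by (auto intro!: mult_nonneg_nonneg)
      have Y0: "0 \<le> Y" unfolding Y_def using nn by (intro add_nonneg_nonneg)
      have "Y \<le> \<epsilon>\<^sub>1 * (W * mu n p (sym_diff \<A> ?\<F>) + V * mu n p (sym_diff \<B> ?\<G>))"
        using ext unfolding extremal_at_def Let_def Y_def W_def V_def by blast
      also have "\<dots> = \<epsilon>\<^sub>1 * (Y + (W * mu n p (?\<F> - \<A>) + V * mu n p (?\<G> - \<B>)))"
        unfolding Y_def mu_sym_diff[OF p01 AB(1) threshold_subset_Pow] mu_sym_diff[OF p01 AB(2) threshold_subset_Pow]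
        by (simp add: algebra_simps)
      also have "\<dots> \<le> \<epsilon>\<^sub>1 * (Y + L)"
        unfolding L_def using W \<epsilon>
        by (intro mult_left_mono add_mono order_refl mu_mono[OF p01] threshold_subset_Pow) auto
      finally have YL: "(1 - \<epsilon>\<^sub>1) * Y \<le> \<epsilon>\<^sub>1 * L" by (simp add: algebra_simps)
      have L0: "0 \<le> L" unfolding L_def using nn by (intro add_nonneg_nonneg)
      have "Y \<le> L"
      proof -
        have "\<epsilon>\<^sub>1 * L \<le> (1 - \<epsilon>\<^sub>1) * L" using \<epsilon> L0 by (intro mult_right_mono) auto
        with YL have "(1 - \<epsilon>\<^sub>1) * Y \<le> (1 - \<epsilon>\<^sub>1) * L" by linarith
        thus ?thesis using \<epsilon> by (simp add: mult_le_cancel_left_pos)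
      qed
      have big': "c1 * C * p ^ (2 * t) \<le> mu n p A' * mu n p B'"
      proof -
        have "c1 * C * p ^ (2 * t) = \<theta> * (p ^ t * \<phi>0)\<^sup>2"
          using C by (simp add: c1_def power_mult_distrib power_mult mult_ac)
        also have "\<dots> \<le> \<theta> * (p ^ t * \<phi>)\<^sup>2"
          using \<theta> \<phi> \<phi>0 p01 by (intro mult_left_mono power_mono) auto
        finally show ?thesis using big unfolding A'_def B'_def \<phi>_def by linarith
      qed
      have cA: "W * mu n p (\<A> - ?\<F>) \<le> L" "V * mu n p (\<B> - ?\<G>) \<le> L"
        using \<open>Y \<le> L\<close> nn(1)[of "\<A> - ?\<F>"] nn(2)[of "\<B> - ?\<G>"] unfolding Y_def by linarith+
      have eq: "x + j' = j + y"
      proof (rule ccontr)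
        assume "x + j' \<noteq> j + y"
        then consider "x + j' < j + y" | "y + j < j' + x" by linarith
        then show False
        proof cases
          case 1
          show False
            by (rule wrong_difference_excluded[OF reg c0 le tn(1) p(1-3) _ AB(1) _ 1, of c1 \<B>])
               (use p big' cA in \<open>simp_all add: C_def A'_def B'_def L_def W_def V_def\<close>)
        next
          case 2
          show False
            by (rule wrong_difference_excluded[OF reg c0 le(2,1,4,3) tn(1) p(1-3) _ AB(2) _ 2, of c1 \<A>])
               (use p big' cA in \<open>simp_all add: C_def A'_def B'_def L_def W_def V_def add.commute mult.commute\<close>)
        qed
      qed
      have "x = j"
      proof (rule ccontr)
        assume ne: "x \<noteq> j"
        have "typical n t (j + j') j 0 \<inter> ?\<F> = {}"
          by (rule typical_threshold_disjoint) (use eq ne in auto)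
        hence "A' \<subseteq> \<A> - ?\<F>" unfolding A'_def by blast
        moreover have "typical n t (j + j') j' 0 \<inter> ?\<G> = {}"
          using typical_threshold_disjoint[of y j x j' n t] eq ne by (simp add: add.commute)
        hence "B' \<subseteq> \<B> - ?\<G>" unfolding B'_def by blast
        ultimately have "W * mu n p A' + V * mu n p B' \<le> Y"
          unfolding Y_def using W AB by (intro add_mono mult_left_mono mu_mono[OF p01]) auto
        moreover have "2 * sqrt (mu n p A' * mu n p B') \<le> W * mu n p A' + V * mu n p B'"
        proof -
          have "(W * mu n p A') * (V * mu n p B') = (W * V) * (mu n p A' * mu n p B')" by (simp only: mult_ac)
          hence e: "mu n p A' * mu n p B' = (W * mu n p A') * (V * mu n p B')" using W by simp
          have "2 * sqrt (a * b) \<le> a + b" if "0 \<le> a" "0 \<le> b" for a b :: real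
            using arith_geo_mean_sqrt[OF that] by simp
          from this[OF nn(1)[of A'] nn(2)[of B']] show ?thesis unfolding e .
        qed
        moreover have "2 * (sqrt \<theta> * (p ^ t * \<phi>)) \<le> 2 * sqrt (mu n p A' * mu n p B')"
        proof -
          have "sqrt \<theta> * (p ^ t * \<phi>) = sqrt (\<theta> * (p ^ t * \<phi>)\<^sup>2)"
            using \<phi> \<phi>0 p01 by (simp add: real_sqrt_mult)
          also have "\<dots> \<le> sqrt (mu n p A' * mu n p B')"
            using big unfolding A'_def B'_def \<phi>_def by (rule real_sqrt_le_mono)
          finally show ?thesis by simp
        qed
        moreover have "L \<le> 2 * (K * (p ^ t * \<phi>))"
          using weighted_threshold_poisson[OF reg c0 p(1,6) le(3,4)] weighted_threshold_poisson[OF reg c0 p(1,6) le(4,3)]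
          unfolding L_def W_def V_def K_def \<phi>_def by (simp add: add.commute)
        ultimately have YL': "2 * (sqrt \<theta> * (p ^ t * \<phi>)) \<le> Y" "L \<le> 2 * (K * (p ^ t * \<phi>))" by linarith+
        have "(1 - \<epsilon>\<^sub>1) * (2 * (sqrt \<theta> * (p ^ t * \<phi>))) \<le> (1 - \<epsilon>\<^sub>1) * Y"
          using YL'(1) \<epsilon> by (intro mult_left_mono) auto
        also note YL
        also have "\<epsilon>\<^sub>1 * L \<le> \<epsilon>\<^sub>1 * (2 * (K * (p ^ t * \<phi>)))"
          using YL'(2) \<epsilon> by (intro mult_left_mono) auto
        finally have "(1 - \<epsilon>\<^sub>1) * (2 * (sqrt \<theta> * (p ^ t * \<phi>))) \<le> \<epsilon>\<^sub>1 * (2 * (K * (p ^ t * \<phi>)))" .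
        hence "((1 - \<epsilon>\<^sub>1) * sqrt \<theta>) * (2 * (p ^ t * \<phi>)) \<le> (\<epsilon>\<^sub>1 * K) * (2 * (p ^ t * \<phi>))" by (simp add: mult_ac)
        moreover have "0 < 2 * (p ^ t * \<phi>)" using \<phi> \<phi>0 p by simp
        ultimately have "(1 - \<epsilon>\<^sub>1) * sqrt \<theta> \<le> \<epsilon>\<^sub>1 * K" by (rule mult_right_le_imp_le)
        thus False using K by simp
      qed
      thus "x = j \<and> y = j'" using eq by simp
    qed
  qed
qed

section \<open>Stability for large t\<close>

text \<open>The pair found by concentration is extremal because both families contain typical sets for it. If a
second pair is extremal, it has the same components, possibly exchanged; and \<open>R_ex r\<close>, whose pairs
satisfy \<open>s' \<le> s\<close>, contains both orders only if they coincide.\<close>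
lemma eventually_stability:
  fixes r :: nat and c\<^sub>0 \<epsilon>\<^sub>1 \<delta>\<^sub>1 :: real
  assumes c0: "0 < c\<^sub>0" and \<epsilon>: "0 < \<epsilon>\<^sub>1" "\<epsilon>\<^sub>1 < 1 / 2" and \<delta>: "0 < \<delta>\<^sub>1" "\<delta>\<^sub>1 < 1 / (real r + 2)"
  shows "\<forall>\<^sub>F p in at_right 0. \<forall>t n. regime r c\<^sub>0 p t n \<longrightarrow> stability n t r p \<epsilon>\<^sub>1 \<delta>\<^sub>1"
proof -
  \<comment> \<open>The strict inequality required for uniqueness reads \<open>b < 1 - \<delta>\<^sub>1\<close>; the slack \<open>\<zeta>\<close> is chosen to preserve it and \<open>\<delta>\<^sub>1 < 1 / (r + 2)\<close>.\<close>
  define b where "b = (\<epsilon>\<^sub>1 / (1 - \<epsilon>\<^sub>1))\<^sup>2"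
  define strict where "strict \<longleftrightarrow> \<epsilon>\<^sub>1 < (1 - \<epsilon>\<^sub>1) * sqrt (1 - \<delta>\<^sub>1)"
  have \<delta>1: "\<delta>\<^sub>1 < 1 / (real r + 2)" "1 / (real r + 2) \<le> 1" using \<delta> by auto
  have b: "b < 1 - \<delta>\<^sub>1" if strict
  proof -
    have "\<epsilon>\<^sub>1 / (1 - \<epsilon>\<^sub>1) < sqrt (1 - \<delta>\<^sub>1)" using that \<epsilon> by (simp add: strict_def field_simps)
    hence "b < (sqrt (1 - \<delta>\<^sub>1))\<^sup>2" unfolding b_def using \<epsilon> by (intro power_strict_mono) auto
    thus ?thesis using \<delta>1 by simp
  qed
  define \<zeta> where "\<zeta> = min (1 / 2 * (1 / (real r + 2) - \<delta>\<^sub>1)) (if strict then 1 / 2 * (1 - \<delta>\<^sub>1 - b) else 1)"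
  have \<zeta>: "0 < \<zeta>" using \<delta> b by (auto simp: \<zeta>_def)
  have \<zeta>': "\<delta>\<^sub>1 + \<zeta> < 1 / (real r + 2)"
  proof -
    have "\<zeta> \<le> 1 / 2 * (1 / (real r + 2) - \<delta>\<^sub>1)" unfolding \<zeta>_def by (rule min.cobounded1)
    thus ?thesis using \<delta>1(1) unfolding right_diff_distrib by linarith
  qed
  hence \<theta>: "0 < 1 - \<delta>\<^sub>1 - \<zeta>" using \<delta>1(2) by linarith
  have sharp: "\<epsilon>\<^sub>1 < (1 - \<epsilon>\<^sub>1) * sqrt (1 - \<delta>\<^sub>1 - \<zeta>)" if strict
  proof -
    have "\<zeta> \<le> (if strict then 1 / 2 * (1 - \<delta>\<^sub>1 - b) else 1)" unfolding \<zeta>_def by (rule min.cobounded2)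
    hence "\<zeta> \<le> 1 / 2 * (1 - \<delta>\<^sub>1 - b)" using that by simp
    hence "b < 1 - \<delta>\<^sub>1 - \<zeta>" using b[OF that] unfolding right_diff_distrib by linarith
    hence "sqrt b < sqrt (1 - \<delta>\<^sub>1 - \<zeta>)" by simp
    hence "\<epsilon>\<^sub>1 / (1 - \<epsilon>\<^sub>1) < sqrt (1 - \<delta>\<^sub>1 - \<zeta>)" unfolding b_def using \<epsilon> by simp
    thus ?thesis using \<epsilon> by (simp add: field_simps)
  qed
  have uniq: "\<forall>\<^sub>F p in at_right 0. strict \<longrightarrow> (\<forall>t n \<A> \<B> j j' x y. regime r c\<^sub>0 p t n \<and> nice n t \<A> \<B> \<and>
    j \<le> r + 1 \<and> j' \<le> r + 1 \<and> x \<le> r + 1 \<and> y \<le> r + 1 \<and>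
    (1 - \<delta>\<^sub>1 - \<zeta>) * (p ^ t * ((real t * p) ^ r / fact r))\<^sup>2 \<le>
      mu n p (\<A> \<inter> typical n t (j + j') j 0) * mu n p (\<B> \<inter> typical n t (j + j') j' 0) \<and>
    extremal_at n t p \<epsilon>\<^sub>1 \<A> \<B> x y \<longrightarrow> x = j \<and> y = j')"
  proof (cases strict)
    case True
    show ?thesis
      using extremal_index_unique[OF c0 \<epsilon> \<theta> sharp[OF True]] by eventually_elim blast
  qed simp
  have small: "\<forall>\<^sub>F p in at_right 0. 0 < p \<and> p < c\<^sub>0 / (real r + 1)"
    using c0 by (intro eventually_small) auto
  show ?thesis
    using large_product_concentrates[OF c0 \<delta>(1) \<zeta> \<zeta>'] typical_members_imply_extremal[OF c0 \<epsilon>(1), of r] uniq small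
  proof eventually_elim
    case (elim p)
    note conc = elim(1)[rule_format] and ext = elim(2)[rule_format] and un = elim(3)[rule_format]
    have p: "0 < p" "p * (real r + 1) \<le> c\<^sub>0" using elim(4) by (auto simp: field_simps)
    show ?case
    proof (intro allI impI)
      fix t n assume reg: "regime r c\<^sub>0 p t n"
      note tn = regime_large_t[OF reg p]
      hence t1: "1 \<le> t" by simp
      have main: "(\<exists>ss. ss \<in> R_ex r \<and> extremal_pair_sw n t p \<epsilon>\<^sub>1 \<A> \<B> ss) \<and>
        (strict \<longrightarrow> (\<exists>!ss. ss \<in> R_ex r \<and> extremal_pair_sw n t p \<epsilon>\<^sub>1 \<A> \<B> ss))"
        if nice: "nice n t \<A> \<B>" and big: "(1 - \<delta>\<^sub>1) * (mu n p (frankl n t r))\<^sup>2 \<le> mu n p \<A> * mu n p \<B>" for \<A> \<B>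
      proof -
        obtain j j' where near: "near_mode r j j'" and
          jj: "(1 - \<delta>\<^sub>1 - \<zeta>) * (p ^ t * ((real t * p) ^ r / fact r))\<^sup>2 \<le>
            mu n p (\<A> \<inter> typical n t (j + j') j 0) * mu n p (\<B> \<inter> typical n t (j + j') j' 0)"
          using conc[of t n \<A> \<B>] reg nice big by blast
        have le: "j \<le> r + 1" "j' \<le> r + 1" using near_mode_le[OF near] by auto
        have "0 < (1 - \<delta>\<^sub>1 - \<zeta>) * (p ^ t * ((real t * p) ^ r / fact r))\<^sup>2"
          using \<theta> p t1 by simp
        hence "mu n p (\<A> \<inter> typical n t (j + j') j 0) * mu n p (\<B> \<inter> typical n t (j + j') j' 0) \<noteq> 0"
          using jj by linarith
        hence ne: "\<A> \<inter> typical n t (j + j') j 0 \<noteq> {}" "\<B> \<inter> typical n t (j + j') j' 0 \<noteq> {}"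
          by (auto simp: mu_def)
        have at: "extremal_at n t p \<epsilon>\<^sub>1 \<A> \<B> j j'" using ext[of t n \<A> \<B> j j'] reg nice le ne by blast
        have sw: "extremal_pair_sw n t p \<epsilon>\<^sub>1 \<A> \<B> (s, s') \<longleftrightarrow>
          extremal_at n t p \<epsilon>\<^sub>1 \<A> \<B> s s' \<or> extremal_at n t p \<epsilon>\<^sub>1 \<A> \<B> s' s" if "(s, s') \<in> R_ex r" for s s'
          unfolding extremal_pair_sw_def extremal_pair_iff_extremal_at[OF that t1 p(1)]
          using extremal_at_commute by blast
        define ss where "ss = (if (j, j') \<in> R_ex r then (j, j') else (j', j))"
        have ss: "ss \<in> R_ex r" using near by (auto simp: ss_def near_mode_def)
        have good: "extremal_pair_sw n t p \<epsilon>\<^sub>1 \<A> \<B> ss"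
          using ss at sw by (auto simp: ss_def split: if_splits)
        have only: "ss' = ss" if strict "ss' \<in> R_ex r" "extremal_pair_sw n t p \<epsilon>\<^sub>1 \<A> \<B> ss'" for ss'
        proof -
          obtain s s' where s: "ss' = (s, s')" by (cases ss')
          have R: "s \<le> r + 1" "s' \<le> r + 1" using near_mode_le[of r s s'] that(2) s by (auto simp: near_mode_def)
          have un': "x = j \<and> y = j'" if "extremal_at n t p \<epsilon>\<^sub>1 \<A> \<B> x y" "x \<le> r + 1" "y \<le> r + 1" for x y
            using un[OF \<open>strict\<close>, of t n \<A> \<B> j j' x y] reg nice le jj that by blast
          have "ss' = (j, j') \<or> ss' = (j', j)"
            using that(2,3) sw un' R unfolding s by blast
          moreover have "j = j'" if "(j, j') \<in> R_ex r" "(j', j) \<in> R_ex r"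
            using that by (auto simp: R_ex_def split: if_splits)
          ultimately show ?thesis using that(2) by (auto simp: ss_def)
        qed
        show ?thesis using ss good only by blast
      qed
      show "stability n t r p \<epsilon>\<^sub>1 \<delta>\<^sub>1"
        unfolding stability_def strict_def[symmetric] using main by blast
    qed
  qed
qed

lemma eventually_right_large_nat:
  assumes "\<forall>\<^sub>F p in at_right (0::real). P p" "0 \<le> M"
  shows "\<exists>t\<^sub>0::nat. 1 \<le> t\<^sub>0 \<and> (\<forall>t\<ge>t\<^sub>0. \<forall>p. 0 < p \<and> p \<le> M / real t \<longrightarrow> P p)"
proof -
  obtain b where b: "0 < b" "\<And>p. 0 < p \<Longrightarrow> p < b \<Longrightarrow> P p"
    using assms(1) unfolding eventually_at_right_field by auto
  obtain t\<^sub>0 :: nat where t0: "M / b < real t\<^sub>0" using reals_Archimedean2 by blast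
  have "P p" if "Suc t\<^sub>0 \<le> t" "0 < p" "p \<le> M / real t" for t p
  proof (rule b(2)[OF that(2)])
    have "M / b < real t" using t0 that(1) by linarith
    hence "M / real t < b" using b(1) that(1) by (simp add: field_simps)
    thus "p < b" using that(3) by simp
  qed
  thus ?thesis by (intro exI[of _ "Suc t\<^sub>0"]) auto
qed

theorem theorem4:
  fixes r :: nat and \<epsilon> \<epsilon>\<^sub>1 \<delta>\<^sub>1 :: real
  assumes "0 < \<epsilon>" "\<epsilon> < 1 / 2"
    and "0 < \<epsilon>\<^sub>1" "\<epsilon>\<^sub>1 < 1 / 2"
    and "0 < \<delta>\<^sub>1" "\<delta>\<^sub>1 < 1 / (real r + 2)"
  shows "(r \<ge> 1 \<longrightarrow>
      (\<exists>t\<^sub>0::nat. \<forall>t\<ge>t\<^sub>0. \<forall>n\<ge>t + 2 * r. \<forall>p::real.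
        real r / (real t + 2 * real r - 1) \<le> p \<and> p \<le> (real r + 1) / (real t + 2 * real r + 1) \<longrightarrow>
        stability n t r p \<epsilon>\<^sub>1 \<delta>\<^sub>1)) \<and>
    (r = 0 \<longrightarrow>
      (\<exists>t\<^sub>0::nat. \<forall>t\<ge>t\<^sub>0. \<forall>n\<ge>t. \<forall>p::real.
        \<epsilon> / real t \<le> p \<and> p \<le> 1 / (real t + 1) \<longrightarrow>
        stability n t 0 p \<epsilon>\<^sub>1 \<delta>\<^sub>1))"
proof (intro conjI impI)
  assume r: "r \<ge> 1"
  \<comment> \<open>For \<open>r \<ge> 1\<close> the lower bound on \<open>p\<close> gives \<open>t * p \<ge> r * t / (t + 2 * r - 1)\<close>, which is at least \<open>1 / 3\<close>.\<close>
  have "\<forall>\<^sub>F p in at_right 0. \<forall>t n. regime r (1 / 3) p t n \<longrightarrow> stability n t r p \<epsilon>\<^sub>1 \<delta>\<^sub>1"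
    by (rule eventually_stability) (use assms in auto)
  from eventually_right_large_nat[OF this, of "real r + 1"]
  obtain t\<^sub>0 :: nat where t0: "1 \<le> t\<^sub>0" "\<And>t p n. t\<^sub>0 \<le> t \<Longrightarrow> 0 < p \<Longrightarrow> p \<le> (real r + 1) / real t \<Longrightarrow>
    regime r (1 / 3) p t n \<Longrightarrow> stability n t r p \<epsilon>\<^sub>1 \<delta>\<^sub>1" by auto
  show "\<exists>t\<^sub>0::nat. \<forall>t\<ge>t\<^sub>0. \<forall>n\<ge>t + 2 * r. \<forall>p::real.
        real r / (real t + 2 * real r - 1) \<le> p \<and> p \<le> (real r + 1) / (real t + 2 * real r + 1) \<longrightarrow>
        stability n t r p \<epsilon>\<^sub>1 \<delta>\<^sub>1"
  proof (rule exI[of _ t\<^sub>0], intro allI impI, elim conjE)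
    fix t n p
    assume t: "t\<^sub>0 \<le> t" and n: "t + 2 * r \<le> n"
      and lo: "real r / (real t + 2 * real r - 1) \<le> p" and hi: "p \<le> (real r + 1) / (real t + 2 * real r + 1)"
    have t1: "1 \<le> real t" "1 \<le> real r" using t t0(1) r by auto
    have D: "0 < real t + 2 * real r - 1" "0 < real t + 2 * real r + 1" using t1 by auto
    have "0 < real r / (real t + 2 * real r - 1)" using t1 D by simp
    hence p0: "0 < p" using lo by linarith
    have lo': "real r \<le> p * (real t + 2 * real r - 1)" using lo D by (simp add: pos_divide_le_eq)
    have hi': "p * (real t + 2 * real r + 1) \<le> real r + 1" using hi D by (simp add: pos_le_divide_eq)
    have "p * real t \<le> p * (real t + 2 * real r + 1)" using p0 t1 by (intro mult_left_mono) auto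
    hence pt: "p * real t \<le> real r + 1" using hi' by linarith
    have "1 / 3 \<le> real t * p"
    proof -
      have "real t + 2 * real r - 1 \<le> 3 * real t * real r"
      proof -
        have "0 \<le> (real t - 1) * (real r - 1)" using t1 by simp
        moreover have "real t * 1 \<le> real t * real r" "1 * real r \<le> real t * real r"
          using t1 by (intro mult_left_mono mult_right_mono; simp)+
        ultimately show ?thesis by (simp add: algebra_simps)
      qed
      hence "p * (real t + 2 * real r - 1) \<le> p * (3 * real t * real r)" using p0 by (intro mult_left_mono) auto
      hence "1 * real r \<le> (3 * real t * p) * real r" using lo' by (simp add: mult_ac)
      hence "1 \<le> 3 * real t * p" using t1 by (simp add: mult_le_cancel_right)
      thus ?thesis by simp
    qed
    moreover have "real r \<le> p * (real t + 2 * real r)"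
    proof -
      have "p * (real t + 2 * real r - 1) \<le> p * (real t + 2 * real r)" using p0 by (intro mult_left_mono) auto
      thus ?thesis using lo' by linarith
    qed
    ultimately have "regime r (1 / 3) p t n" using pt n by (simp add: regime_def mult.commute)
    moreover have "p \<le> (real r + 1) / real t" using pt t1 by (simp add: pos_le_divide_eq)
    ultimately show "stability n t r p \<epsilon>\<^sub>1 \<delta>\<^sub>1" using t0(2)[OF t p0] by blast
  qed
next
  assume r: "r = 0"
  have "\<forall>\<^sub>F p in at_right 0. \<forall>t n. regime 0 \<epsilon> p t n \<longrightarrow> stability n t 0 p \<epsilon>\<^sub>1 \<delta>\<^sub>1"
    by (rule eventually_stability) (use assms r in auto)
  from eventually_right_large_nat[OF this, of 1]
  obtain t\<^sub>0 :: nat where t0: "1 \<le> t\<^sub>0" "\<And>t p n. t\<^sub>0 \<le> t \<Longrightarrow> 0 < p \<Longrightarrow> p \<le> 1 / real t \<Longrightarrow>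
    regime 0 \<epsilon> p t n \<Longrightarrow> stability n t 0 p \<epsilon>\<^sub>1 \<delta>\<^sub>1" by auto
  show "\<exists>t\<^sub>0::nat. \<forall>t\<ge>t\<^sub>0. \<forall>n\<ge>t. \<forall>p::real.
        \<epsilon> / real t \<le> p \<and> p \<le> 1 / (real t + 1) \<longrightarrow> stability n t 0 p \<epsilon>\<^sub>1 \<delta>\<^sub>1"
  proof (rule exI[of _ t\<^sub>0], intro allI impI, elim conjE)
    fix t n p
    assume t: "t\<^sub>0 \<le> t" and n: "t \<le> n" and lo: "\<epsilon> / real t \<le> p" and hi: "p \<le> 1 / (real t + 1)"
    have t1: "1 \<le> real t" using t t0(1) by auto
    have "0 < \<epsilon> / real t" using assms t1 by simp
    hence p0: "0 < p" using lo by linarith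
    have lo': "\<epsilon> \<le> real t * p" using lo t1 by (simp add: pos_divide_le_eq mult.commute)
    have hi': "p * (real t + 1) \<le> 1" using hi by (simp add: pos_le_divide_eq)
    have "p * real t \<le> p * (real t + 1)" using p0 by (intro mult_left_mono) auto
    hence pt: "p * real t \<le> 1" using hi' by linarith
    have "regime 0 \<epsilon> p t n" using lo' pt n p0 by (simp add: regime_def mult.commute)
    moreover have "p \<le> 1 / real t" using pt t1 by (simp add: pos_le_divide_eq)
    ultimately show "stability n t 0 p \<epsilon>\<^sub>1 \<delta>\<^sub>1" using t0(2)[OF t p0] by blast
  qed
qed

end
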